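(* Let $\rho,\tilde\rho\in L^\infty(\Omega)\setminus\{0\}$ be such that $\rho\le\tilde\rho$ a.e. in $\Omega$, $\rho\not\equiv\tilde\rho$, and either $\rho$ or $\tilde\rho$ satisfies u.c.p. Then $\lambda_k(\rho)>\lambda_k(\tilde\rho)$ for all admissible $k\in\mathbb{Z}\setminus\{0\}$.
   Context: $\Omega\subset\mathbb{R}^N$ is a bounded domain with Lipschitz continuous boundary. The kernel $K:\mathbb{R}^N\setminus\{0\}\to(0,+\infty)$ satisfies: (1) $mK\in L^1(\mathbb{R}^N)$, where $m(x)=\min\{|x|^2,1\}$; (2) $K(x)\ge\alpha|x|^{-(N+2s)}$ for all $x\in\mathbb{R}^N\setminus\{0\}$, for some $\alpha>0$ and $s\in(0,1)$ with $N>2s$; (3) $K(-x)=K(x)$ for all $x\in\mathbb{R}^N\setminus\{0\}$. Set $[u]_K^2=\int_{\mathbb{R}^{2N}}(u(x)-u(y))^2K(x-y)\,dx\,dy$ and $X_K(\Omega)=\{u\in L^2(\mathbb{R}^N):[u]_K<\infty,\ u=0\text{ a.e. in }\mathbb{R}^N\setminus\Omega\}$, a Hilbert space with scalar product $\langle u,v\rangle=\int_{\mathbb{R}^{2N}}(u(x)-u(y))(v(x)-v(y))K(x-y)\,dx\,dy$ and norm $\|u\|=[u]_K$. For a weight $\rho\in L^\infty(\Omega)$, the weighted eigenvalue problem is $L_Ku=\lambda\rho(x)u$ in $\Omega$, $u=0$ in $\mathbb{R}^N\setminus\Omega$, where $L_Ku(x)=\mathrm{P.V.}\int_{\mathbb{R}^N}(u(x)-u(y))K(x-y)\,dy$;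 it is understood weakly: $\lambda\in\mathbb{R}$ is an eigenvalue with eigenfunction $u\in X_K(\Omega)\setminus\{0\}$ if $\langle u,v\rangle=\lambda\int_\Omega\rho(x)uv\,dx$ for all $v\in X_K(\Omega)$. The set of all eigenvalues is denoted $\sigma(\rho)$. For each integer $k\ge 0$, $\mathcal{F}_k$ is the family of all $k$-dimensional linear subspaces of $X_K(\Omega)$. If $\rho^+\not\equiv0$, the positive eigenvalues form a sequence $0<\lambda_1(\rho)<\lambda_2(\rho)\le\ldots\to\infty$ given, for $k\ge1$, by $$\lambda_k^{-1}(\rho)=\sup_{F\in\mathcal{F}_k}\inf_{u\in F,\|u\|=1}\int_\Omega\rho u^2\,dx=\inf_{F\in\mathcal{F}_{k-1}}\sup_{u\in F^\perp,\|u\|=1}\int_\Omega\rho u^2\,dx.$$ If $\rho^-\not\equiv0$, the negative eigenvalues form a sequence $0>\lambda_{-1}(\rho)>\lambda_{-2}(\rho)\ge\ldots\to-\infty$ given, for $k\ge1$, by $$\lambda_{-k}^{-1}(\rho)=\inf_{F\in\mathcal{F}_k}\sup_{u\in F,\|u\|=1}\int_\Omega\rho u^2\,dx=\sup_{F\in\mathcal{F}_{k-1}}\inf_{u\in F^\perp,\|u\|=1}\int_\Omega\rho u^2\,dx.$$ Here $\rho^\pm$ are the positive and negative parts of $\rho$, and $F^\perp$ is the orthogonal complement in $X_K(\Omega)$. An index $k\in\mathbb{Z}\setminus\{0\}$ is called admissible if the corresponding eigenvalues (of index $k$, for both weights involved) exist; i.e. for $k>0$ both weights have positive part $\not\equiv0$,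 and for $k<0$ both have negative part $\not\equiv0$. A weight $\rho\in L^\infty(\Omega)\setminus\{0\}$ satisfies u.c.p. (unique continuation property) if for every eigenfunction $u\in X_K(\Omega)$ of the problem with weight $\rho$ (for any $\lambda\in\sigma(\rho)$), the set $\{x\in\Omega:u(x)=0\}$ has Lebesgue measure zero. *)

theory Defs
  imports "HOL-Analysis.Analysis"
begin

text \<open>
  Near every boundary point, in coordinates where the unit vector \<open>e\<close> is the vertical axis,
  \<open>\<Omega>\<close> is the strict epigraph of a Lipschitz function on the hyperplane orthogonal to \<open>e\<close>.
\<close>

definition lipschitz_boundary :: "'a::euclidean_space set \<Rightarrow> bool" where
  "lipschitz_boundary \<Omega> \<longleftrightarrow>
     (\<forall>p\<in>frontier \<Omega>. \<exists>r>0. \<exists>e. norm e = 1 \<and>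
        (\<exists>(g :: 'a \<Rightarrow> real) L. L-lipschitz_on {y. y \<bullet> e = 0} g \<and>
           \<Omega> \<inter> ball p r = {x \<in> ball p r. g (x - (x \<bullet> e) *\<^sub>R e) < x \<bullet> e}))"

definition bounded_lipschitz_domain :: "'a::euclidean_space set \<Rightarrow> bool" where
  "bounded_lipschitz_domain \<Omega> \<longleftrightarrow>
     open \<Omega> \<and> connected \<Omega> \<and> \<Omega> \<noteq> {} \<and> bounded \<Omega> \<and> lipschitz_boundary \<Omega>"

text \<open>
  The value of a kernel at the origin is irrelevant and left unconstrained: the diagonal is a
  null set. Measurability of \<open>K\<close> is part of the integrability condition.
\<close>

definition admissible_kernel :: "('a::euclidean_space \<Rightarrow> real) \<Rightarrow> bool" where
  "admissible_kernel K \<longleftrightarrow>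
     (\<forall>x. x \<noteq> 0 \<longrightarrow> K x > 0) \<and>
     integrable lebesgue (\<lambda>x. min ((norm x)\<^sup>2) 1 * K x) \<and>
     (\<exists>\<alpha> s. \<alpha> > 0 \<and> 0 < s \<and> s < 1 \<and> real DIM('a) > 2 * s \<and>
        (\<forall>x. x \<noteq> 0 \<longrightarrow> K x \<ge> \<alpha> * norm x powr (- (real DIM('a) + 2 * s)))) \<and>
     (\<forall>x. x \<noteq> 0 \<longrightarrow> K (- x) = K x)"

definition K_inner ::
  "('a::euclidean_space \<Rightarrow> real) \<Rightarrow> ('a \<Rightarrow> real) \<Rightarrow> ('a \<Rightarrow> real) \<Rightarrow> real" where
  "K_inner K u v = (LINT (x, y)|lebesgue. (u x - u y) * (v x - v y) * K (x - y))"

definition K_norm :: "('a::euclidean_space \<Rightarrow> real) \<Rightarrow> ('a \<Rightarrow> real) \<Rightarrow> real" where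
  "K_norm K u = sqrt (LINT (x, y)|lebesgue. (u x - u y)\<^sup>2 * K (x - y))"

text \<open>
  Elements of \<open>X_K(\<Omega>)\<close> are represented by Lebesgue measurable functions; identification of
  functions that agree almost everywhere is made explicit wherever it matters.
\<close>

definition X_space ::
  "'a::euclidean_space set \<Rightarrow> ('a \<Rightarrow> real) \<Rightarrow> ('a \<Rightarrow> real) set" where
  "X_space \<Omega> K =
     {u. u \<in> borel_measurable lebesgue \<and>
         integrable lebesgue (\<lambda>x. (u x)\<^sup>2) \<and>
         integrable lebesgue (\<lambda>(x, y). (u x - u y)\<^sup>2 * K (x - y)) \<and>
         (AE x in lebesgue. x \<notin> \<Omega> \<longrightarrow> u x = 0)}"

definition Linfty :: "'a::euclidean_space set \<Rightarrow> ('a \<Rightarrow> real) set" where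
  "Linfty \<Omega> =
     {\<rho>. \<rho> \<in> borel_measurable (lebesgue_on \<Omega>) \<and> (\<exists>C. AE x in lebesgue_on \<Omega>. \<bar>\<rho> x\<bar> \<le> C)}"

definition eigenfunction ::
  "'a::euclidean_space set \<Rightarrow> ('a \<Rightarrow> real) \<Rightarrow> ('a \<Rightarrow> real) \<Rightarrow> real \<Rightarrow> ('a \<Rightarrow> real) \<Rightarrow> bool" where
  "eigenfunction \<Omega> K \<rho> l u \<longleftrightarrow>
     u \<in> X_space \<Omega> K \<and> \<not> (AE x in lebesgue. u x = 0) \<and>
     (\<forall>v\<in>X_space \<Omega> K. K_inner K u v = l * (LINT x|lebesgue_on \<Omega>. \<rho> x * u x * v x))"

definition spectrum_of ::
  "'a::euclidean_space set \<Rightarrow> ('a \<Rightarrow> real) \<Rightarrow> ('a \<Rightarrow> real) \<Rightarrow> real set" where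
  "spectrum_of \<Omega> K \<rho> = {l. \<exists>u. eigenfunction \<Omega> K \<rho> l u}"

definition ucp ::
  "'a::euclidean_space set \<Rightarrow> ('a \<Rightarrow> real) \<Rightarrow> ('a \<Rightarrow> real) \<Rightarrow> bool" where
  "ucp \<Omega> K \<rho> \<longleftrightarrow>
     (\<forall>l\<in>spectrum_of \<Omega> K \<rho>. \<forall>u. eigenfunction \<Omega> K \<rho> l u \<longrightarrow>
        {x \<in> \<Omega>. u x = 0} \<in> null_sets lebesgue)"

text \<open>
  The \<open>k\<close>-dimensional linear subspaces of \<open>X_K(\<Omega>)\<close>, a space of functions modulo equality almost
  everywhere. Each subspace is encoded as the set of all representatives of its elements;
  \<open>e 0, \<dots>, e (k - 1)\<close> represent a basis.
\<close>

definition subspaces ::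
  "'a::euclidean_space set \<Rightarrow> ('a \<Rightarrow> real) \<Rightarrow> nat \<Rightarrow> ('a \<Rightarrow> real) set set" where
  "subspaces \<Omega> K k =
     {F. \<exists>e :: nat \<Rightarrow> 'a \<Rightarrow> real.
        (\<forall>i<k. e i \<in> X_space \<Omega> K) \<and>
        (\<forall>c :: nat \<Rightarrow> real. (AE x in lebesgue. (\<Sum>i<k. c i * e i x) = 0) \<longrightarrow> (\<forall>i<k. c i = 0)) \<and>
        F = {u \<in> X_space \<Omega> K. \<exists>c :: nat \<Rightarrow> real. AE x in lebesgue. u x = (\<Sum>i<k. c i * e i x)}}"

definition orth_compl ::
  "'a::euclidean_space set \<Rightarrow> ('a \<Rightarrow> real) \<Rightarrow> ('a \<Rightarrow> real) set \<Rightarrow> ('a \<Rightarrow> real) set" where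
  "orth_compl \<Omega> K F = {u \<in> X_space \<Omega> K. \<forall>v\<in>F. K_inner K u v = 0}"

definition unit_sphere ::
  "('a::euclidean_space \<Rightarrow> real) \<Rightarrow> ('a \<Rightarrow> real) set \<Rightarrow> ('a \<Rightarrow> real) set" where
  "unit_sphere K F = {u \<in> F. K_norm K u = 1}"

definition weight_form ::
  "'a::euclidean_space set \<Rightarrow> ('a \<Rightarrow> real) \<Rightarrow> ('a \<Rightarrow> real) \<Rightarrow> real" where
  "weight_form \<Omega> \<rho> u = (LINT x|lebesgue_on \<Omega>. \<rho> x * (u x)\<^sup>2)"

text \<open>
  \<open>is_eigenvalue_of_index \<Omega> K \<rho> k l\<close> says that \<open>l = \<lambda>\<^sub>k(\<rho>)\<close>: \<open>l\<close> is an eigenvalue of the same sign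
  as \<open>k\<close>, in the position fixed by the two min-max formulas (which also encode the counting with
  multiplicity). All suprema and infima are over nonempty bounded sets of reals, because the
  quadratic form of a bounded weight is bounded on the unit sphere of \<open>X_K(\<Omega>)\<close>.
\<close>

definition is_eigenvalue_of_index ::
  "'a::euclidean_space set \<Rightarrow> ('a \<Rightarrow> real) \<Rightarrow> ('a \<Rightarrow> real) \<Rightarrow> int \<Rightarrow> real \<Rightarrow> bool" where
  "is_eigenvalue_of_index \<Omega> K \<rho> k l \<longleftrightarrow>
     l \<in> spectrum_of \<Omega> K \<rho> \<and>
     (if k > 0 then
        l > 0 \<and>
        inverse l = (SUP F\<in>subspaces \<Omega> K (nat k).
                       INF u\<in>unit_sphere K F. weight_form \<Omega> \<rho> u) \<and>
        inverse l = (INF F\<in>subspaces \<Omega> K (nat k - 1).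
                       SUP u\<in>unit_sphere K (orth_compl \<Omega> K F). weight_form \<Omega> \<rho> u)
      else
        l < 0 \<and>
        inverse l = (INF F\<in>subspaces \<Omega> K (nat (- k)).
                       SUP u\<in>unit_sphere K F. weight_form \<Omega> \<rho> u) \<and>
        inverse l = (SUP F\<in>subspaces \<Omega> K (nat (- k) - 1).
                       INF u\<in>unit_sphere K (orth_compl \<Omega> K F). weight_form \<Omega> \<rho> u))"

definition eigval ::
  "'a::euclidean_space set \<Rightarrow> ('a \<Rightarrow> real) \<Rightarrow> ('a \<Rightarrow> real) \<Rightarrow> int \<Rightarrow> real" where
  "eigval \<Omega> K \<rho> k = (THE l. is_eigenvalue_of_index \<Omega> K \<rho> k l)"

definition admissible ::
  "'a::euclidean_space set \<Rightarrow> ('a \<Rightarrow> real) \<Rightarrow> ('a \<Rightarrow> real) \<Rightarrow> int \<Rightarrow> bool" where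
  "admissible \<Omega> \<rho> \<rho>' k \<longleftrightarrow>
     (k > 0 \<and> \<not> (AE x in lebesgue_on \<Omega>. max (\<rho> x) 0 = 0)
            \<and> \<not> (AE x in lebesgue_on \<Omega>. max (\<rho>' x) 0 = 0)) \<or>
     (k < 0 \<and> \<not> (AE x in lebesgue_on \<Omega>. max (- \<rho> x) 0 = 0)
            \<and> \<not> (AE x in lebesgue_on \<Omega>. max (- \<rho>' x) 0 = 0))"

end

theory Submission
  imports Defs "HOL-Library.Diagonal_Subsequence"
begin

text \<open>
  The number \<^term>\<open>eigval \<Omega> K \<rho> k\<close> is the unique one that satisfies the two min-max formulas and is an
  eigenvalue, so such a number has to be constructed before anything can be compared.

  Write \<open>a u v\<close> for \<^term>\<open>K_inner K u v\<close> and \<open>b u v\<close> for the integral of \<open>\<rho> u v\<close> over \<open>\<Omega>\<close>, so that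
  \<open>u\<close> is an eigenfunction for \<open>1 / \<mu>\<close> exactly when \<open>b u v = \<mu> * a u v\<close> for all \<open>v\<close>. Maximizing \<open>b u u\<close>
  on the unit sphere of \<open>a\<close>, then on the part of the sphere that is orthogonal to the first maximizer, and
  so on, gives orthonormal eigenfunctions \<open>e 0, e 1, \<dots>\<close> with \<open>\<mu> 0 \<ge> \<mu> 1 \<ge> \<dots> > 0\<close>
  (\<open>eigen_system\<close>). A dimension count then shows that \<open>\<mu> n\<close> is the value of both min-max expressions of
  index \<open>n + 1\<close>, so the eigenvalue of that index is \<open>1 / \<mu> n\<close>.

  Two facts make the construction work. The maxima are attained because the unit ball of \<open>a\<close> is compact in
  \<open>L\<^sup>2\<close> (\<open>closed_unit_ball_compact\<close>): the lower bound on \<open>K\<close> makes it so singular that the energy inside a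
  small cube dominates the variance on that cube (\<open>local_Poincare\<close>), whence finitely many cube averages
  control the \<open>L\<^sup>2\<close> norm up to an arbitrarily small multiple of the energy (\<open>grid_Poincare\<close>). The maxima
  are positive in every dimension because bump functions with disjoint supports can be concentrated where
  \<open>\<rho> > 0\<close> (\<open>positive_subspaces\<close>).

  For the comparison of \<open>\<rho> \<le> \<rho>'\<close> take the span of the first \<open>n + 1\<close> eigenfunctions of \<open>\<rho>\<close>. It contains
  some \<open>u \<noteq> 0\<close> orthogonal to the first \<open>n\<close> eigenfunctions of \<open>\<rho>'\<close>, and then
  \<open>\<mu> n * a u u \<le> b u u \<le> b' u u \<le> \<mu>' n * a u u\<close>.
  If \<open>\<mu> n = \<mu>' n\<close>, all of these are equalities. The first one forces \<open>u\<close> to be an eigenfunction of \<open>\<rho>\<close>,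
  the last one an eigenfunction of \<open>\<rho>'\<close> (\<open>eigenvalue_comparison\<close>). So whichever weight has the unique
  continuation property, \<open>u\<close> vanishes almost nowhere on \<open>\<Omega>\<close>, and the middle equality
  \<open>\<integral> (\<rho>' - \<rho>) u\<^sup>2 = 0\<close> gives \<open>\<rho> = \<rho>'\<close> almost everywhere, a contradiction.
  Negative indices reduce to positive ones by changing the sign of both weights.
\<close>

section \<open>Lebesgue measure on the product space\<close>

text \<open>
  The measure \<open>lebesgue\<close> on a product is the completion of the product measure, so measurability of a
  coordinate map between completed measures needs that preimages of null sets are null, besides Borel
  measurability. The three maps of interest are the two projections and \<open>(x, y) \<mapsto> x - y\<close>.
\<close>

lemma measurable_lebesgue_if_null_preimage:
  fixes T :: "'b::euclidean_space \<Rightarrow> 'a::euclidean_space"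
  assumes T: "T \<in> borel \<rightarrow>\<^sub>M borel"
    and null: "\<And>N. N \<in> null_sets lborel \<Longrightarrow> T -` N \<in> null_sets lborel"
  shows "T \<in> lebesgue \<rightarrow>\<^sub>M lebesgue"
proof (rule measurableI)
  fix A :: "'a set" assume "A \<in> sets lebesgue"
  then obtain S N N' where A: "A = S \<union> N" "N \<subseteq> N'" "N' \<in> null_sets lborel" "S \<in> sets lborel"
    by (rule sets_completionE)
  have "T -` S \<in> sets lebesgue"
    using measurable_sets[OF T, of S] A by auto
  moreover have "T -` N \<in> null_sets lebesgue"
    using null[OF A(3)] A(2) by (meson null_sets_completion_subset null_sets_completionI vimage_mono)
  ultimately show "T -` A \<inter> space lebesgue \<in> sets lebesgue"
    unfolding A by auto
qed auto

lemma AE_lebesgue_compose: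
  fixes T :: "'b::euclidean_space \<Rightarrow> 'a::euclidean_space"
  assumes null: "\<And>N. N \<in> null_sets lborel \<Longrightarrow> T -` N \<in> null_sets lborel"
    and P: "AE x in lebesgue. P x"
  shows "AE z in lebesgue. P (T z)"
proof -
  have "AE x in lborel. P x" using P by (simp add: AE_completion_iff)
  then obtain N where N: "N \<in> null_sets lborel" "\<And>x. x \<notin> N \<Longrightarrow> P x"
    by (elim AE_E3) auto
  have "AE z in lborel. z \<notin> T -` N"
    using null[OF N(1)] by (rule AE_not_in)
  then have "AE z in lborel. P (T z)" by eventually_elim (use N in auto)
  then show ?thesis by (rule AE_completion)
qed

lemma null_preimage_fst:
  "N \<in> null_sets lborel \<Longrightarrow>
   (fst :: 'a::euclidean_space \<times> 'a \<Rightarrow> 'a) -` N \<in> null_sets lborel"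
  using lborel.times_in_null_sets1[of N lborel UNIV]
  by (auto simp: vimage_fst simp flip: lborel_prod)

lemma null_preimage_snd:
  "N \<in> null_sets lborel \<Longrightarrow>
   (snd :: 'a::euclidean_space \<times> 'a \<Rightarrow> 'a) -` N \<in> null_sets lborel"
  using lborel.times_in_null_sets2[of N lborel UNIV]
  by (auto simp: vimage_snd simp flip: lborel_prod)

lemma nn_integral_lborel_reflect:
  fixes f :: "'a::euclidean_space \<Rightarrow> ennreal"
  assumes [measurable]: "f \<in> borel_measurable borel"
  shows "(\<integral>\<^sup>+y. f (x - y) \<partial>lborel) = (\<integral>\<^sup>+y. f y \<partial>lborel)"
proof -
  have "lborel = distr lborel borel (\<lambda>y::'a. x + (-1) *\<^sub>R y)"
    by (subst lborel_affine[of "-1" x]) (simp_all add: density_1)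
  then have "(\<integral>\<^sup>+y. f y \<partial>lborel) = (\<integral>\<^sup>+y. f y \<partial>distr lborel borel (\<lambda>y. x + (-1) *\<^sub>R y))"
    by simp
  also have "\<dots> = (\<integral>\<^sup>+y. f (x - y) \<partial>lborel)"
    by (subst nn_integral_distr) auto
  finally show ?thesis by simp
qed

lemma nn_integral_lborel_convolution:
  fixes f g :: "'a::euclidean_space \<Rightarrow> ennreal"
  assumes [measurable]: "f \<in> borel_measurable borel" "g \<in> borel_measurable borel"
  shows "(\<integral>\<^sup>+z. f (fst z) * g (fst z - snd z) \<partial>lborel) = (\<integral>\<^sup>+x. f x \<partial>lborel) * (\<integral>\<^sup>+x. g x \<partial>lborel)"
proof -
  have "(\<integral>\<^sup>+z. f (fst z) * g (fst z - snd z) \<partial>lborel)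
      = (\<integral>\<^sup>+x. (\<integral>\<^sup>+y. f x * g (x - y) \<partial>lborel) \<partial>lborel)"
    unfolding lborel_prod[symmetric] by (subst lborel.nn_integral_fst[symmetric]) auto
  also have "\<dots> = (\<integral>\<^sup>+x. f x * (\<integral>\<^sup>+y. g y \<partial>lborel) \<partial>lborel)"
    by (simp add: nn_integral_cmult nn_integral_lborel_reflect)
  also have "\<dots> = (\<integral>\<^sup>+x. f x \<partial>lborel) * (\<integral>\<^sup>+x. g x \<partial>lborel)"
    by (simp add: nn_integral_multc)
  finally show ?thesis .
qed

lemma null_preimage_diff:
  assumes "N \<in> null_sets lborel"
  shows "(\<lambda>z. fst z - snd z :: 'a::euclidean_space) -` N \<in> null_sets lborel"
proof -
  have [measurable]: "N \<in> sets borel" using assms by auto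
  have "(\<lambda>z. fst z - snd z :: 'a) \<in> borel \<rightarrow>\<^sub>M borel"
    unfolding borel_prod[symmetric] by measurable
  from measurable_sets[OF this \<open>N \<in> sets borel\<close>]
  have "(\<lambda>z. fst z - snd z :: 'a) -` N \<in> sets borel" by simp
  moreover have "emeasure lborel ((\<lambda>z. fst z - snd z :: 'a) -` N) = 0"
  proof -
    have "emeasure lborel ((\<lambda>z. fst z - snd z :: 'a) -` N)
        = (\<integral>\<^sup>+z. indicator ((\<lambda>z. fst z - snd z :: 'a) -` N) z \<partial>lborel)"
      using calculation by simp
    also have "\<dots> = (\<integral>\<^sup>+z. 1 * indicator N (fst z - snd z :: 'a) \<partial>lborel)"
      by (intro nn_integral_cong) (auto simp: indicator_def)
    also have "\<dots> = integral\<^sup>N (lborel :: 'a measure) (\<lambda>_. 1) * (\<integral>\<^sup>+x. indicator N x \<partial>lborel)"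
      by (rule nn_integral_lborel_convolution) auto
    also have "\<dots> = 0" using assms by auto
    finally show ?thesis .
  qed
  ultimately show ?thesis by auto
qed

lemma
  shows measurable_lebesgue_fst: "(fst :: 'a::euclidean_space \<times> 'a \<Rightarrow> 'a) \<in> lebesgue \<rightarrow>\<^sub>M lebesgue"
    and measurable_lebesgue_snd: "(snd :: 'a::euclidean_space \<times> 'a \<Rightarrow> 'a) \<in> lebesgue \<rightarrow>\<^sub>M lebesgue"
    and measurable_lebesgue_diff: "(\<lambda>z. fst z - snd z :: 'a) \<in> lebesgue \<rightarrow>\<^sub>M lebesgue"
proof -
  have "(fst :: 'a \<times> 'a \<Rightarrow> 'a) \<in> borel \<rightarrow>\<^sub>M borel" "(snd :: 'a \<times> 'a \<Rightarrow> 'a) \<in> borel \<rightarrow>\<^sub>M borel"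
    "(\<lambda>z. fst z - snd z :: 'a) \<in> borel \<rightarrow>\<^sub>M borel"
    unfolding borel_prod[symmetric] by measurable
  then show "(fst :: 'a::euclidean_space \<times> 'a \<Rightarrow> 'a) \<in> lebesgue \<rightarrow>\<^sub>M lebesgue"
    "(snd :: 'a::euclidean_space \<times> 'a \<Rightarrow> 'a) \<in> lebesgue \<rightarrow>\<^sub>M lebesgue"
    "(\<lambda>z. fst z - snd z :: 'a) \<in> lebesgue \<rightarrow>\<^sub>M lebesgue"
    using null_preimage_fst null_preimage_snd null_preimage_diff
    by (auto intro!: measurable_lebesgue_if_null_preimage)
qed

lemma borel_measurable_lebesgue_product:
  fixes f :: "'a::euclidean_space \<Rightarrow> 'b::topological_space"
  assumes "f \<in> borel_measurable lebesgue"
  shows borel_measurable_lebesgue_fst: "(\<lambda>z. f (fst z)) \<in> borel_measurable (lebesgue :: ('a \<times> 'a) measure)"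
    and borel_measurable_lebesgue_snd: "(\<lambda>z. f (snd z)) \<in> borel_measurable (lebesgue :: ('a \<times> 'a) measure)"
    and borel_measurable_lebesgue_diff: "(\<lambda>z. f (fst z - snd z)) \<in> borel_measurable lebesgue"
  using measurable_compose[OF measurable_lebesgue_fst assms] measurable_compose[OF measurable_lebesgue_snd assms]
    measurable_compose[OF measurable_lebesgue_diff assms] by auto

lemma AE_lebesgue_product:
  assumes "AE x in lebesgue. P x"
  shows AE_lebesgue_fst: "AE z in lebesgue. P (fst (z :: 'a::euclidean_space \<times> 'a))"
    and AE_lebesgue_snd: "AE z in lebesgue. P (snd (z :: 'a::euclidean_space \<times> 'a))"
    and AE_lebesgue_diff: "AE z in lebesgue. P (fst z - snd z :: 'a)"
  using AE_lebesgue_compose[OF null_preimage_fst assms] AE_lebesgue_compose[OF null_preimage_snd assms]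
    AE_lebesgue_compose[OF null_preimage_diff assms] by auto

lemma lebesgue_borel_representative:
  fixes f :: "'a::euclidean_space \<Rightarrow> real"
  assumes "f \<in> borel_measurable lebesgue"
  obtains f' where "f' \<in> borel_measurable borel" "AE x in lebesgue. f x = f' x"
proof -
  obtain f' where "f' \<in> borel_measurable lborel" "AE x in lborel. f x = f' x"
    using completion_ex_borel_measurable_real[OF assms] by blast
  then show ?thesis
    by (intro that[of f'] AE_completion) simp_all
qed

lemma integrable_lborel_representative:
  fixes f f' :: "'a::euclidean_space \<Rightarrow> real"
  assumes "integrable lebesgue f" "f' \<in> borel_measurable borel" "AE x in lebesgue. f x = f' x"
  shows "integrable lborel f'"
proof -
  have "integrable lebesgue f'"
    using assms(2) by (intro integrable_cong_AE_imp[OF assms(1) _ assms(3)] measurable_completion) auto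
  then show ?thesis using assms(2) by (subst (asm) integrable_completion) auto
qed

text \<open>
  Replacing both functions by Borel representatives reduces this to Tonelli's theorem for \<open>lborel\<close>, where
  the inner integral of \<open>\<lambda>y. g (x - y)\<close> does not depend on \<open>x\<close>.
\<close>

lemma integrable_lebesgue_convolution:
  fixes f g :: "'a::euclidean_space \<Rightarrow> real"
  assumes f: "integrable lebesgue f" and g: "integrable lebesgue g"
  shows "integrable lebesgue (\<lambda>z. f (fst z) * g (fst z - snd z))"
proof -
  obtain f' where f'[measurable]: "f' \<in> borel_measurable borel" and ff: "AE x in lebesgue. f x = f' x"
    using lebesgue_borel_representative f by blast
  obtain g' where g'[measurable]: "g' \<in> borel_measurable borel" and gg: "AE x in lebesgue. g x = g' x"
    using lebesgue_borel_representative g by blast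
  have if': "integrable lborel f'" and ig': "integrable lborel g'"
    using integrable_lborel_representative f f' ff g g' gg by blast+
  have eq: "AE z in lebesgue. f' (fst z) * g' (fst z - snd z) = f (fst z) * g (fst z - snd z)"
    using AE_lebesgue_fst[OF ff] AE_lebesgue_diff[OF gg] by eventually_elim auto
  have [measurable]: "(\<lambda>z. f' (fst z) * g' (fst z - snd z)) \<in> borel_measurable borel"
    unfolding borel_prod[symmetric] by measurable
  have "(\<integral>\<^sup>+z. norm (f' (fst z) * g' (fst z - snd z)) \<partial>lborel)
     = (\<integral>\<^sup>+z. ennreal (norm (f' (fst z))) * ennreal (norm (g' (fst z - snd z))) \<partial>lborel)"
    by (simp add: abs_mult ennreal_mult)
  also have "\<dots> = (\<integral>\<^sup>+x. norm (f' x) \<partial>lborel) * (\<integral>\<^sup>+x. norm (g' x) \<partial>lborel)"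
    by (rule nn_integral_lborel_convolution) auto
  also have "\<dots> < \<infinity>"
    using if' ig' by (auto simp: integrable_iff_bounded ennreal_mult_less_top)
  finally have "integrable lborel (\<lambda>z. f' (fst z) * g' (fst z - snd z))"
    by (intro integrableI_bounded) auto
  then have 1: "integrable lebesgue (\<lambda>z. f' (fst z) * g' (fst z - snd z))"
    by (subst integrable_completion) auto
  have 2: "(\<lambda>z. f (fst z) * g (fst z - snd z)) \<in> borel_measurable lebesgue"
    using f g by (intro borel_measurable_times borel_measurable_lebesgue_product borel_measurable_integrable)
  show ?thesis
    by (rule integrable_cong_AE_imp[OF 1 2]) (use eq in auto)
qed

lemma lebesgue_product_integral:
  fixes f g :: "'a::euclidean_space \<Rightarrow> real"
  assumes f: "integrable lebesgue f" and g: "integrable lebesgue g"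
  shows integrable_lebesgue_product: "integrable lebesgue (\<lambda>z. f (fst z) * g (snd z))" (is ?A)
    and integral_lebesgue_product:
      "(LINT z|lebesgue. f (fst z) * g (snd z)) = integral\<^sup>L lebesgue f * integral\<^sup>L lebesgue g" (is ?B)
proof -
  obtain f' where f'[measurable]: "f' \<in> borel_measurable borel" and ff: "AE x in lebesgue. f x = f' x"
    using lebesgue_borel_representative f by blast
  obtain g' where g'[measurable]: "g' \<in> borel_measurable borel" and gg: "AE x in lebesgue. g x = g' x"
    using lebesgue_borel_representative g by blast
  have if': "integrable lborel f'" and ig': "integrable lborel g'"
    using integrable_lborel_representative f f' ff g g' gg by blast+
  have eq: "AE z in lebesgue. f' (fst z) * g' (snd z) = f (fst z) * g (snd z)"
    using AE_lebesgue_fst[OF ff] AE_lebesgue_snd[OF gg] by eventually_elim auto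
  have bm[measurable]: "(\<lambda>z. f' (fst z) * g' (snd z)) \<in> borel_measurable borel"
    unfolding borel_prod[symmetric] by measurable
  have int: "integrable (lborel \<Otimes>\<^sub>M lborel) (\<lambda>z. f' (fst z) * g' (snd z))"
    by (rule lborel_pair.Fubini_integrable)
      (use if' ig' in \<open>auto simp: abs_mult intro!: integrable_mult_left\<close>)
  then have 1: "integrable lebesgue (\<lambda>z. f' (fst z) * g' (snd z))"
    using bm by (subst integrable_completion) (auto simp: lborel_prod)
  have 2: "(\<lambda>z. f (fst z) * g (snd z)) \<in> borel_measurable lebesgue"
    using f g by (intro borel_measurable_times borel_measurable_lebesgue_product borel_measurable_integrable)
  show ?A
    by (rule integrable_cong_AE_imp[OF 1 2]) (use eq in auto)
  have "(LINT z|lebesgue. f (fst z) * g (snd z)) = (LINT z|lebesgue. f' (fst z) * g' (snd z))"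
    using 1 2 eq by (intro integral_cong_AE) auto
  also have "\<dots> = (LINT z|(lborel \<Otimes>\<^sub>M lborel). f' (fst z) * g' (snd z))"
    using bm by (subst integral_completion) (auto simp: lborel_prod)
  also have "\<dots> = (LINT x|lborel. (LINT y|lborel. f' x * g' y))"
    using lborel_pair.integral_fst'[OF int] by simp
  also have "\<dots> = integral\<^sup>L lborel f' * integral\<^sup>L lborel g'"
    by simp
  also have "integral\<^sup>L lborel f' = integral\<^sup>L lebesgue f'"
    by (simp add: integral_completion)
  also have "\<dots> = integral\<^sup>L lebesgue f"
    by (rule integral_cong_AE[OF _ _ AE_symmetric[OF ff]]) (use f f' in \<open>auto intro: measurable_completion\<close>)
  also have "integral\<^sup>L lborel g' = integral\<^sup>L lebesgue g'"
    by (simp add: integral_completion)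
  also have "\<dots> = integral\<^sup>L lebesgue g"
    by (rule integral_cong_AE[OF _ _ AE_symmetric[OF gg]]) (use g g' in \<open>auto intro: measurable_completion\<close>)
  finally show ?B .
qed


lemma integrable_lebesgue_swap:
  fixes f :: "'a::euclidean_space \<times> 'a \<Rightarrow> real"
  assumes "integrable lebesgue f"
  shows "integrable lebesgue (\<lambda>z. f (snd z, fst z))"
proof -
  obtain f' where f'[measurable]: "f' \<in> borel_measurable borel" and ff: "AE x in lebesgue. f x = f' x"
    using lebesgue_borel_representative assms by blast
  have if': "integrable lborel f'"
    using integrable_lborel_representative assms f' ff by blast
  have "distr lborel borel (\<lambda>z::'a\<times>'a. (snd z, fst z))
      = distr (lborel \<Otimes>\<^sub>M lborel) (lborel \<Otimes>\<^sub>M lborel) (\<lambda>(x, y). (y, x))"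
    by (rule distr_cong) (simp_all only: lborel_prod sets_lborel case_prod_unfold)
  also have "\<dots> = lborel"
    using lborel_pair.distr_pair_swap[where 'a='a and 'b='a, symmetric] unfolding lborel_prod .
  finally have *: "lborel = distr lborel borel (\<lambda>z::'a\<times>'a. (snd z, fst z))" ..
  have sw: "(\<lambda>z::'a\<times>'a. (snd z, fst z)) \<in> borel \<rightarrow>\<^sub>M borel"
    unfolding borel_prod[symmetric] by measurable
  have null: "(\<lambda>z::'a\<times>'a. (snd z, fst z)) -` N \<in> null_sets lborel" if "N \<in> null_sets lborel" for N
  proof -
    have "emeasure (distr lborel borel (\<lambda>z::'a\<times>'a. (snd z, fst z))) N = 0"
      unfolding *[symmetric] using that by auto
    moreover have "N \<in> sets borel" using that by auto
    ultimately show ?thesis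
      using sw measurable_sets[OF sw, of N] by (subst (asm) emeasure_distr) auto
  qed
  have 1: "integrable lebesgue (\<lambda>z::'a\<times>'a. f' (snd z, fst z))"
  proof -
    have "integrable (distr lborel borel (\<lambda>z::'a\<times>'a. (snd z, fst z))) f'"
      unfolding *[symmetric] by (rule if')
    then have "integrable lborel (\<lambda>z::'a\<times>'a. f' (snd z, fst z))"
      using sw by (subst (asm) integrable_distr_eq) auto
    then show ?thesis
      by (auto simp: integrable_completion)
  qed
  have "f \<circ> (\<lambda>z. (snd z, fst z)) \<in> borel_measurable lebesgue"
    using assms sw null by (intro measurable_comp[OF measurable_lebesgue_if_null_preimage]) auto
  then show ?thesis
    using AE_lebesgue_compose[OF null ff] by (intro integrable_cong_AE_imp[OF 1]) (auto simp: comp_def)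
qed

section \<open>Variational eigenvalues of a pair of quadratic forms\<close>

text \<open>
  Fewer equations than unknowns: one step of Gaussian elimination per equation. This is the only
  dimension count in the whole argument.
\<close>

lemma homogeneous_system_nontrivial_solution:
  fixes A :: "'i \<Rightarrow> 'j \<Rightarrow> real"
  assumes "finite J" "finite I" "card J < card I"
  shows "\<exists>c. (\<exists>i\<in>I. c i \<noteq> 0) \<and> (\<forall>j\<in>J. (\<Sum>i\<in>I. c i * A i j) = 0)"
  using assms
proof (induction J arbitrary: I A rule: finite_induct)
  case empty
  then obtain i where "i \<in> I" by fastforce
  then show ?case by (intro exI[of _ "\<lambda>_. 1"]) auto
next
  case (insert l J)
  show ?case
  proof (cases "\<forall>i\<in>I. A i l = 0")
    case True
    have "card J < card I" using insert by simp
    from insert.IH[OF \<open>finite I\<close> this, of A] True show ?thesis by auto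
  next
    case False
    then obtain p where p: "p \<in> I" "A p l \<noteq> 0" by auto
    \<comment> \<open>Pivot on the coefficient of unknown \<open>p\<close> in equation \<open>l\<close>; \<open>s\<close> is back substitution.\<close>
    define B where "B i j = A i j - A i l / A p l * A p j" for i j
    have "finite (I - {p})" "card J < card (I - {p})"
      using insert p by auto
    from insert.IH[OF this, of B] obtain c where
      c: "\<exists>i\<in>I - {p}. c i \<noteq> 0" "\<And>j. j \<in> J \<Longrightarrow> (\<Sum>i\<in>I - {p}. c i * B i j) = 0" by auto
    define s where "s = - (\<Sum>i\<in>I - {p}. c i * (A i l / A p l))"
    have eq: "(\<Sum>i\<in>I. (c(p := s)) i * A i j) = (\<Sum>i\<in>I - {p}. c i * B i j)" for j
    proof -
      have "(\<Sum>i\<in>I. (c(p := s)) i * A i j) = s * A p j + (\<Sum>i\<in>I - {p}. c i * A i j)"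
        using p \<open>finite I\<close> by (subst sum.remove[of I p]) (auto intro!: sum.cong)
      also have "s * A p j = - (\<Sum>i\<in>I - {p}. c i * (A i l / A p l * A p j))"
        by (simp add: s_def sum_distrib_right mult.assoc)
      finally show ?thesis
        by (simp add: B_def algebra_simps sum_subtractf)
    qed
    have "(\<Sum>i\<in>I - {p}. c i * B i l) = 0"
      using p by (simp add: B_def)
    then have "\<forall>j\<in>insert l J. (\<Sum>i\<in>I. (c(p := s)) i * A i j) = 0"
      unfolding eq using c(2) by auto
    moreover have "\<exists>i\<in>I. (c(p := s)) i \<noteq> 0" using c(1) by auto
    ultimately show ?thesis by blast
  qed
qed

locale function_space =
  fixes X :: "('i \<Rightarrow> real) set"
  assumes nonempty: "X \<noteq> {}"
    and comb: "u \<in> X \<Longrightarrow> v \<in> X \<Longrightarrow> (\<lambda>x. p * u x + q * v x) \<in> X"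
begin

lemma zero_mem: "(\<lambda>x. 0) \<in> X"
  using nonempty comb[of _ _ 0 0] by auto

lemma sum_mem: "(\<And>i. i < (n::nat) \<Longrightarrow> e i \<in> X) \<Longrightarrow> (\<lambda>x. \<Sum>i<n. c i * e i x) \<in> X"
proof (induction n)
  case (Suc n)
  then show ?case using comb[of "\<lambda>x. \<Sum>i<n. c i * e i x" "e n" 1 "c n"] by auto
qed (simp add: zero_mem)

lemma scale_mem: "u \<in> X \<Longrightarrow> (\<lambda>x. p * u x) \<in> X"
  using comb[of u u p 0] by simp

lemma diff_mem: "u \<in> X \<Longrightarrow> v \<in> X \<Longrightarrow> (\<lambda>x. u x - v x) \<in> X"
  using comb[of u v 1 "-1"] by simp

end

locale symmetric_form = function_space X for X :: "('i \<Rightarrow> real) set" +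
  fixes f :: "('i \<Rightarrow> real) \<Rightarrow> ('i \<Rightarrow> real) \<Rightarrow> real"
  assumes comb_left: "u \<in> X \<Longrightarrow> v \<in> X \<Longrightarrow> w \<in> X \<Longrightarrow> f (\<lambda>x. p * u x + q * v x) w = p * f u w + q * f v w"
    and sym: "u \<in> X \<Longrightarrow> v \<in> X \<Longrightarrow> f u v = f v u"
begin

lemma comb_right: "u \<in> X \<Longrightarrow> v \<in> X \<Longrightarrow> w \<in> X \<Longrightarrow> f w (\<lambda>x. p * u x + q * v x) = p * f w u + q * f w v"
  using comb_left[of u v w p q] sym comb by metis

lemma zero_left: "w \<in> X \<Longrightarrow> f (\<lambda>x. 0) w = 0"
  using comb_left[of w w w 0 0] by simp

lemma sum_left:
  "(\<And>i. i < (n::nat) \<Longrightarrow> e i \<in> X) \<Longrightarrow> w \<in> X \<Longrightarrow> f (\<lambda>x. \<Sum>i<n. c i * e i x) w = (\<Sum>i<n. c i * f (e i) w)"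
proof (induction n)
  case (Suc n)
  then show ?case
    using comb_left[of "\<lambda>x. \<Sum>i<n. c i * e i x" "e n" w 1 "c n"] sum_mem[of n e c] by auto
qed (simp add: zero_left)

lemma sum_right:
  "(\<And>i. i < (n::nat) \<Longrightarrow> e i \<in> X) \<Longrightarrow> w \<in> X \<Longrightarrow> f w (\<lambda>x. \<Sum>i<n. c i * e i x) = (\<Sum>i<n. c i * f w (e i))"
  using sum_left[of n e w c] sum_mem[of n e c] by (simp add: sym)

lemma scale_left: "u \<in> X \<Longrightarrow> w \<in> X \<Longrightarrow> f (\<lambda>x. p * u x) w = p * f u w"
  using comb_left[of u u w p 0] by simp

lemma scale_square: "u \<in> X \<Longrightarrow> f (\<lambda>x. p * u x) (\<lambda>x. p * u x) = p\<^sup>2 * f u u"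
  using scale_left[of u _ p] sym scale_mem by (simp add: power2_eq_square)

lemma diff_left: "u \<in> X \<Longrightarrow> v \<in> X \<Longrightarrow> w \<in> X \<Longrightarrow> f (\<lambda>x. u x - v x) w = f u w - f v w"
  using comb_left[of u v w 1 "-1"] by simp

lemma comb_square:
  assumes "u \<in> X" "v \<in> X"
  shows "f (\<lambda>x. p * u x + q * v x) (\<lambda>x. p * u x + q * v x) = p\<^sup>2 * f u u + 2 * p * q * f u v + q\<^sup>2 * f v v"
  using assms comb[OF assms, of p q] sym[OF assms]
  by (simp add: comb_left comb_right algebra_simps power2_eq_square)

text \<open>
  A quadratic form that is nonnegative along the line \<open>w + t v\<close> and vanishes at \<open>w\<close> has a minimum there, so
  its derivative \<open>2 * f w v\<close> is zero. Applied to the difference of two forms this turns extremality of a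
  Rayleigh quotient into an eigenvalue equation.
\<close>

lemma isotropic_vector_in_kernel:
  assumes w: "w \<in> X" and v: "v \<in> X" and "f w w = 0"
    and nonneg: "\<And>t. 0 \<le> f (\<lambda>x. 1 * w x + t * v x) (\<lambda>x. 1 * w x + t * v x)"
  shows "f w v = 0"
proof (rule ccontr)
  assume ne: "f w v \<noteq> 0"
  \<comment> \<open>The step is small enough for the linear term to dominate the quadratic one.\<close>
  define s where "s = 1 / (\<bar>f v v\<bar> + 1)"
  have s: "s > 0" "s * f v v \<le> 1"
    by (auto simp: s_def field_simps)
  have "0 \<le> 2 * (- s * f w v) * f w v + (- s * f w v)\<^sup>2 * f v v"
    using nonneg[of "- s * f w v"] unfolding comb_square[OF w v] by (simp add: \<open>f w w = 0\<close>)
  also have "\<dots> = (s * (f w v)\<^sup>2) * (s * f v v - 2)"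
    by (simp add: power2_eq_square algebra_simps)
  also have "\<dots> < 0"
    using s ne by (intro mult_pos_neg) auto
  finally show False by simp
qed

end

text \<open>
  The first \<open>n\<close> steps of the successive maximization of \<open>b u u / a u u\<close>: besides the eigenvector equation,
  the definition keeps the extremal property of each step, since both min-max formulas and the comparison
  rest on it.
\<close>

definition eigen_system ::
  "('i \<Rightarrow> real) set \<Rightarrow> (('i \<Rightarrow> real) \<Rightarrow> ('i \<Rightarrow> real) \<Rightarrow> real) \<Rightarrow> (('i \<Rightarrow> real) \<Rightarrow> ('i \<Rightarrow> real) \<Rightarrow> real)
    \<Rightarrow> nat \<Rightarrow> (nat \<Rightarrow> 'i \<Rightarrow> real) \<Rightarrow> (nat \<Rightarrow> real) \<Rightarrow> bool" where
  "eigen_system X a b n e \<mu> \<longleftrightarrow>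
     (\<forall>i<n. e i \<in> X \<and> 0 < \<mu> i \<and> a (e i) (e i) = 1 \<and> (\<forall>j<i. a (e i) (e j) = 0) \<and>
        (\<forall>v\<in>X. b (e i) v = \<mu> i * a (e i) v) \<and>
        (\<forall>v\<in>X. (\<forall>j<i. a v (e j) = 0) \<longrightarrow> b v v \<le> \<mu> i * a v v))"

text \<open>
  The set \<open>X\<close> consists of functions, not of equivalence classes. For this reason \<open>a\<close> is only assumed
  to be positive semidefinite; functions that vanish almost everywhere are its null vectors.
\<close>

locale form_pair = a: symmetric_form X a + b: symmetric_form X b
  for X :: "('i \<Rightarrow> real) set" and a b +
  assumes a_nonneg: "u \<in> X \<Longrightarrow> 0 \<le> a u u"
begin

context
  fixes n e \<mu>
  assumes sys: "eigen_system X a b n e \<mu>"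
begin

lemma
  shows eigen_mem: "i < n \<Longrightarrow> e i \<in> X"
    and eigen_pos: "i < n \<Longrightarrow> 0 < \<mu> i"
    and eigen_eq: "i < n \<Longrightarrow> v \<in> X \<Longrightarrow> b (e i) v = \<mu> i * a (e i) v"
    and eigen_max: "i < n \<Longrightarrow> v \<in> X \<Longrightarrow> (\<And>j. j < i \<Longrightarrow> a v (e j) = 0) \<Longrightarrow> b v v \<le> \<mu> i * a v v"
  using sys unfolding eigen_system_def by blast+

lemma eigen_orthonormal: "i < n \<Longrightarrow> j < n \<Longrightarrow> a (e i) (e j) = (if i = j then 1 else 0)"
  using sys a.sym[OF eigen_mem eigen_mem, of i j] unfolding eigen_system_def
  by (metis linorder_neqE_nat)

lemma eigen_decreasing: "i \<le> j \<Longrightarrow> j < n \<Longrightarrow> \<mu> j \<le> \<mu> i"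
  using eigen_max[of i "e j"] eigen_eq[of j "e j"] eigen_orthonormal[of j] eigen_mem[of j] by simp

text \<open>
  Orthogonal projection away from the eigenvectors. Pairings with vectors orthogonal to them do not change;
  for \<open>b\<close> this is because \<open>b (e i)\<close> is proportional to \<open>a (e i)\<close>.
\<close>

lemma eigen_projection:
  assumes "u \<in> X"
  obtains u' where "u' \<in> X" "\<And>j. j < n \<Longrightarrow> a u' (e j) = 0"
    "\<And>w. w \<in> X \<Longrightarrow> (\<And>j. j < n \<Longrightarrow> a w (e j) = 0) \<Longrightarrow> a w u' = a w u \<and> b w u' = b w u"
proof -
  define p where "p x = (\<Sum>i<n. a u (e i) * e i x)" for x
  have p: "p \<in> X" using a.sum_mem[where n=n and e=e and c="\<lambda>i. a u (e i)"] eigen_mem by (simp add: p_def[abs_def])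
  define u' where "u' x = u x - p x" for x
  have u': "u' \<in> X" using a.diff_mem[OF assms p] by (simp add: u'_def[abs_def])
  show thesis
  proof
    show "u' \<in> X" by fact
    show "a u' (e j) = 0" if "j < n" for j
    proof -
      have "a p (e j) = (\<Sum>i<n. a u (e i) * a (e i) (e j))"
        unfolding p_def[abs_def] by (rule a.sum_left) (use eigen_mem that in auto)
      also have "\<dots> = (\<Sum>i<n. if i = j then a u (e j) else 0)"
        using that by (intro sum.cong) (auto simp: eigen_orthonormal)
      also have "\<dots> = a u (e j)" using that by simp
      finally show ?thesis
        using a.diff_left[OF assms p eigen_mem[OF that]] by (simp add: u'_def[abs_def])
    qed
    fix w assume w: "w \<in> X" "\<And>j. j < n \<Longrightarrow> a w (e j) = 0"
    have "a w p = (\<Sum>i<n. a u (e i) * a w (e i))"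
      unfolding p_def[abs_def] by (rule a.sum_right) (use eigen_mem w in auto)
    then have 1: "a p w = 0" using w p by (simp add: a.sym)
    have "b w p = (\<Sum>i<n. a u (e i) * b w (e i))"
      unfolding p_def[abs_def] by (rule b.sum_right) (use eigen_mem w in auto)
    also have "\<dots> = 0"
      using w eigen_mem by (intro sum.neutral) (auto simp: b.sym[of w] eigen_eq a.sym[of _ w])
    finally have 2: "b p w = 0" using w p by (simp add: b.sym)
    show "a w u' = a w u \<and> b w u' = b w u"
      using a.diff_left[OF assms p w(1)] b.diff_left[OF assms p w(1)] 1 2
        a.sym[OF w(1) assms] b.sym[OF w(1) assms] a.sym[OF w(1) u'] b.sym[OF w(1) u']
      by (simp add: u'_def[abs_def])
  qed
qed

text \<open>
  The form \<open>M * a - b\<close> is nonnegative on the orthogonal complement and vanishes at \<open>w\<close>, so \<open>w\<close> lies in its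
  kernel there; by projection the equation extends to all test vectors.
\<close>

lemma maximizer_is_eigenvector:
  assumes w: "w \<in> X" "\<And>j. j < n \<Longrightarrow> a w (e j) = 0" and eq: "b w w = M * a w w"
    and max: "\<And>v. v \<in> X \<Longrightarrow> (\<And>j. j < n \<Longrightarrow> a v (e j) = 0) \<Longrightarrow> b v v \<le> M * a v v"
    and v: "v \<in> X"
  shows "b w v = M * a w v"
proof -
  interpret q: symmetric_form X "\<lambda>u v. M * a u v - b u v"
    by unfold_locales (auto simp: a.comb_left b.comb_left algebra_simps a.sym b.sym)
  obtain v' where v': "v' \<in> X" "\<And>j. j < n \<Longrightarrow> a v' (e j) = 0" "a w v' = a w v" "b w v' = b w v"
    using eigen_projection[OF v] w by metis
  have "M * a w v' - b w v' = 0"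
  proof (rule q.isotropic_vector_in_kernel[OF w(1) v'(1)])
    show "M * a w w - b w w = 0" using eq by simp
    fix t
    have "b (\<lambda>x. 1 * w x + t * v' x) (\<lambda>x. 1 * w x + t * v' x)
        \<le> M * a (\<lambda>x. 1 * w x + t * v' x) (\<lambda>x. 1 * w x + t * v' x)"
    proof (rule max)
      show "(\<lambda>x. 1 * w x + t * v' x) \<in> X" using a.comb w v' by blast
      show "a (\<lambda>x. 1 * w x + t * v' x) (e j) = 0" if "j < n" for j
        using that w v' eigen_mem[of j] a.comb_left[of w v' "e j" 1 t] by simp
    qed
    then show "0 \<le> M * a (\<lambda>x. 1 * w x + t * v' x) (\<lambda>x. 1 * w x + t * v' x)
        - b (\<lambda>x. 1 * w x + t * v' x) (\<lambda>x. 1 * w x + t * v' x)" by simp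
  qed
  then show ?thesis using v' by simp
qed

lemma eigen_span:
  fixes c
  defines "u \<equiv> \<lambda>x. \<Sum>i<n. c i * e i x"
  shows eigen_span_mem: "u \<in> X"
    and eigen_span_a: "v \<in> X \<Longrightarrow> a u v = (\<Sum>i<n. c i * a (e i) v)"
    and eigen_span_b: "v \<in> X \<Longrightarrow> b u v = (\<Sum>i<n. \<mu> i * (c i * a (e i) v))"
    and eigen_span_coeff: "j < n \<Longrightarrow> a u (e j) = c j"
    and eigen_span_norm: "a u u = (\<Sum>i<n. (c i)\<^sup>2)"
    and eigen_span_form: "b u u = (\<Sum>i<n. \<mu> i * (c i)\<^sup>2)"
proof -
  show u: "u \<in> X" unfolding u_def by (rule a.sum_mem) (rule eigen_mem)
  show au: "a u v = (\<Sum>i<n. c i * a (e i) v)" if "v \<in> X" for v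
    unfolding u_def using that by (intro a.sum_left) (auto intro: eigen_mem)
  show bu: "b u v = (\<Sum>i<n. \<mu> i * (c i * a (e i) v))" if "v \<in> X" for v
  proof -
    have "b u v = (\<Sum>i<n. c i * b (e i) v)"
      unfolding u_def using that by (intro b.sum_left) (auto intro: eigen_mem)
    also have "\<dots> = (\<Sum>i<n. \<mu> i * (c i * a (e i) v))"
      using that by (intro sum.cong) (auto simp: eigen_eq)
    finally show ?thesis .
  qed
  show co: "a u (e j) = c j" if "j < n" for j
  proof -
    have "a u (e j) = (\<Sum>i<n. if i = j then c j else 0)"
      unfolding au[OF eigen_mem[OF that]]
      using that by (intro sum.cong) (auto simp: eigen_orthonormal)
    then show ?thesis using that by simp
  qed
  have ec: "a (e i) u = c i" if "i < n" for i
    using co[OF that] a.sym[OF u eigen_mem[OF that]] by simp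
  show "a u u = (\<Sum>i<n. (c i)\<^sup>2)"
    unfolding au[OF u] by (intro sum.cong) (auto simp: ec power2_eq_square)
  show "b u u = (\<Sum>i<n. \<mu> i * (c i)\<^sup>2)"
    unfolding bu[OF u] by (intro sum.cong) (auto simp: ec power2_eq_square)
qed

end

lemma eigen_system_le: "eigen_system X a b n e \<mu> \<Longrightarrow> m \<le> n \<Longrightarrow> eigen_system X a b m e \<mu>"
  unfolding eigen_system_def by auto

lemma eigen_span_ge:
  assumes sys: "eigen_system X a b (Suc n) e \<mu>"
  shows "\<mu> n * (\<Sum>i<Suc n. (c i)\<^sup>2) \<le> (\<Sum>i<Suc n. \<mu> i * (c i)\<^sup>2)"
  unfolding sum_distrib_left
  by (intro sum_mono mult_right_mono) (auto intro: eigen_decreasing[OF sys])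

text \<open>
  If the Rayleigh quotient of a linear combination equals its smallest possible value \<open>\<mu> n\<close>, then only
  eigenvectors of eigenvalue \<open>\<mu> n\<close> occur with nonzero coefficient.
\<close>

lemma eigen_span_eq:
  assumes sys: "eigen_system X a b (Suc n) e \<mu>" and v: "v \<in> X"
    and eq: "b (\<lambda>x. \<Sum>i<Suc n. c i * e i x) (\<lambda>x. \<Sum>i<Suc n. c i * e i x)
      = \<mu> n * a (\<lambda>x. \<Sum>i<Suc n. c i * e i x) (\<lambda>x. \<Sum>i<Suc n. c i * e i x)"
  shows "b (\<lambda>x. \<Sum>i<Suc n. c i * e i x) v = \<mu> n * a (\<lambda>x. \<Sum>i<Suc n. c i * e i x) v"
proof -
  have "(\<Sum>i<Suc n. (\<mu> i - \<mu> n) * (c i)\<^sup>2) = 0"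
    using eq unfolding eigen_span_norm[OF sys] eigen_span_form[OF sys]
    by (simp only: left_diff_distrib sum_subtractf sum_distrib_left)
  moreover have "0 \<le> (\<mu> i - \<mu> n) * (c i)\<^sup>2" if "i < Suc n" for i
    using eigen_decreasing[OF sys, of i n] that by simp
  ultimately have "(\<mu> i - \<mu> n) * (c i)\<^sup>2 = 0" if "i < Suc n" for i
    using that by (subst (asm) sum_nonneg_eq_0_iff) auto
  then have "\<mu> i * (c i * a (e i) v) = \<mu> n * (c i * a (e i) v)" if "i < Suc n" for i
    using that by fastforce
  then show ?thesis
    unfolding eigen_span_a[OF sys v] eigen_span_b[OF sys v] sum_distrib_left by (intro sum.cong) auto
qed

lemma span_meets_orthogonal:
  assumes f: "\<And>i. i < (k::nat) \<Longrightarrow> f i \<in> X" and g: "\<And>j. j < (m::nat) \<Longrightarrow> g j \<in> X" and "m < k"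
  obtains c where "\<exists>i<k. c i \<noteq> 0" "\<And>j. j < m \<Longrightarrow> a (\<lambda>x. \<Sum>i<k. c i * f i x) (g j) = 0"
proof -
  obtain c where "\<exists>i\<in>{..<k}. c i \<noteq> 0" "\<forall>j\<in>{..<m}. (\<Sum>i\<in>{..<k}. c i * a (f i) (g j)) = 0"
    using homogeneous_system_nontrivial_solution[of "{..<m}" "{..<k}" "\<lambda>i j. a (f i) (g j)"] \<open>m < k\<close> by auto
  then show ?thesis
    by (intro that[of c]) (auto simp: a.sum_left[of k f] f g)
qed

end

text \<open>
  The compactness hypothesis combines weak compactness of the unit ball of \<open>a\<close> with weak continuity of
  \<open>b\<close>: this is all that the direct method needs.
\<close>

locale compact_form_pair = form_pair +
  assumes b_bounded: "\<exists>C. \<forall>u\<in>X. b u u \<le> C * a u u"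
    and compact: "(\<And>n. u n \<in> X) \<Longrightarrow> (\<And>n. a (u n) (u n) \<le> 1) \<Longrightarrow>
      \<exists>w\<in>X. \<exists>r::nat\<Rightarrow>nat. a w w \<le> 1 \<and> (\<forall>v\<in>X. (\<lambda>n. b (u (r n)) v) \<longlonglongrightarrow> b w v) \<and>
        (\<lambda>n. b (u (r n)) (u (r n))) \<longlonglongrightarrow> b w w \<and> strict_mono r"
begin

text \<open>
  The direct method of the calculus of variations. A limit of a maximizing sequence stays orthogonal to the
  eigenvectors although \<open>a\<close> is only lower semicontinuous along the sequence: the constraints
  \<open>a u (e j) = 0\<close> are equivalent to \<open>b u (e j) = 0\<close>, and \<open>b\<close> is continuous.
\<close>

lemma maximizer_exists:
  assumes sys: "eigen_system X a b n e \<mu>"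
    and u0: "u0 \<in> X" "\<forall>j<n. a u0 (e j) = 0" "0 < b u0 u0"
  obtains w M where "0 < M" "w \<in> X" "\<forall>j<n. a w (e j) = 0" "a w w = 1" "b w w = M"
    "\<forall>v\<in>X. (\<forall>j<n. a v (e j) = 0) \<longrightarrow> b v v \<le> M * a v v"
proof -
  define V where "V = {v\<in>X. \<forall>j<n. a v (e j) = 0}"
  obtain C where C: "\<And>u. u \<in> X \<Longrightarrow> b u u \<le> C * a u u" using b_bounded by auto
  define S where "S = (\<lambda>v. b v v) ` {v\<in>V. a v v \<le> 1}"
  have zero: "(\<lambda>x. 0) \<in> V"
    using a.zero_mem a.zero_left eigen_mem[OF sys] by (auto simp: V_def)
  have scale: "(\<lambda>x. t * v x) \<in> V" if "v \<in> V" for t v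
    using that a.scale_mem a.scale_left eigen_mem[OF sys] by (auto simp: V_def)
  have "S \<noteq> {}"
    using zero a.zero_left[OF a.zero_mem] by (force simp: S_def)
  have "bdd_above S"
  proof (rule bdd_aboveI)
    fix s assume "s \<in> S"
    then obtain v where v: "v \<in> X" "a v v \<le> 1" "s = b v v" by (auto simp: S_def V_def)
    have "s \<le> C * a v v" using C v by auto
    also have "\<dots> \<le> \<bar>C\<bar> * a v v" using a_nonneg[OF v(1)] by (intro mult_right_mono) auto
    also have "\<dots> \<le> \<bar>C\<bar>" using v by (simp add: mult_left_le)
    finally show "s \<le> \<bar>C\<bar>" .
  qed
  define M where "M = Sup S"
  have unit: "b v v \<le> M" if "v \<in> V" "a v v \<le> 1" for v
    unfolding M_def using that \<open>bdd_above S\<close> by (intro cSup_upper) (auto simp: S_def)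
  have max: "b v v \<le> M * a v v" if v: "v \<in> V" for v
  proof (cases "a v v = 0")
    case True
    then show ?thesis using C[of v] v by (simp add: V_def)
  next
    case False
    then have pos: "a v v > 0" using a_nonneg[of v] v by (simp add: V_def)
    have vX: "v \<in> X" using v by (simp add: V_def)
    \<comment> \<open>Homogeneity carries the bound from unit vectors to all vectors.\<close>
    define t where "t = 1 / sqrt (a v v)"
    have t2: "t\<^sup>2 = 1 / a v v" using pos by (simp add: t_def power_divide)
    have "t\<^sup>2 * b v v \<le> M"
      using unit[OF scale[OF v, of t]] pos by (simp add: a.scale_square[OF vX] b.scale_square[OF vX] t2)
    then show ?thesis using pos by (simp add: t2 field_simps)
  qed
  have "a u0 u0 > 0"
    using C[OF u0(1)] u0(3) a_nonneg[OF u0(1)] by (cases "a u0 u0 = 0") auto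
  moreover have "0 < M * a u0 u0"
    using max[of u0] u0 by (auto simp: V_def)
  ultimately have "0 < M" by (simp add: zero_less_mult_iff)
  have "\<exists>v. v \<in> V \<and> a v v \<le> 1 \<and> M - 1 / real (Suc n) < b v v" for n
    using less_cSupD[OF \<open>S \<noteq> {}\<close>, of "M - 1 / real (Suc n)"] by (auto simp: M_def S_def)
  then obtain u where u: "\<And>n. u n \<in> V" "\<And>n. a (u n) (u n) \<le> 1"
    "\<And>n. M - 1 / real (Suc n) < b (u n) (u n)" by metis
  have uX: "\<And>n. u n \<in> X" using u by (auto simp: V_def)
  obtain w r where w: "w \<in> X" "a w w \<le> 1" "\<And>v. v \<in> X \<Longrightarrow> (\<lambda>n. b (u (r n)) v) \<longlonglongrightarrow> b w v"
    "(\<lambda>n. b (u (r n)) (u (r n))) \<longlonglongrightarrow> b w w" "strict_mono r"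
    using compact[where u=u, OF uX u(2)] by blast
  have wV: "w \<in> V"
  proof -
    have "a w (e j) = 0" if j: "j < n" for j
    proof -
      have "b (u i) (e j) = 0" for i
        using eigen_eq[OF sys j uX] eigen_mem[OF sys j] u(1)[of i] uX[of i] j
        by (simp add: b.sym[of _ "e j"] a.sym[of "e j"] V_def)
      then have "b w (e j) = 0"
        using LIMSEQ_unique[OF w(3)[OF eigen_mem[OF sys j]], of 0] by simp
      then have "\<mu> j * a (e j) w = 0"
        using eigen_eq[OF sys j w(1)] b.sym[OF w(1) eigen_mem[OF sys j]] by simp
      then show ?thesis
        using eigen_pos[OF sys j] a.sym[OF w(1) eigen_mem[OF sys j]] by simp
    qed
    then show ?thesis using w by (simp add: V_def)
  qed
  have "(\<lambda>n. M - 1 / real (Suc n)) \<longlonglongrightarrow> M - 0"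
    by (intro tendsto_intros LIMSEQ_Suc[OF lim_1_over_n])
  then have lim: "(\<lambda>n. M - 1 / real (Suc (r n))) \<longlonglongrightarrow> M"
    using LIMSEQ_subseq_LIMSEQ[OF _ w(5)] by (fastforce simp: comp_def)
  have "M \<le> b w w"
    using u(3) by (intro LIMSEQ_le[OF lim w(4)]) (auto intro: less_imp_le)
  moreover have "b w w \<le> M * a w w" using max[OF wV] .
  moreover have "M * a w w \<le> M" using w(2) \<open>0 < M\<close> by (simp add: mult_left_le)
  ultimately have "b w w = M" "M * a w w = M" by linarith+
  with \<open>0 < M\<close> have "a w w = 1" by simp
  show thesis
    using \<open>0 < M\<close> wV \<open>a w w = 1\<close> \<open>b w w = M\<close> max by (intro that[of M w]) (auto simp: V_def)
qed

lemma eigen_system_exists: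
  assumes rich: "\<And>n::nat. \<exists>f. (\<forall>i<n. f i \<in> X) \<and>
    (\<forall>c. (\<exists>i<n. c i \<noteq> 0) \<longrightarrow> 0 < b (\<lambda>x. \<Sum>i<n. c i * f i x) (\<lambda>x. \<Sum>i<n. c i * f i x))"
  shows "\<exists>e \<mu>. eigen_system X a b n e \<mu>"
proof (induction n)
  case 0
  then show ?case by (simp add: eigen_system_def)
next
  case (Suc n)
  then obtain e \<mu> where sys: "eigen_system X a b n e \<mu>" by blast
  obtain f where f: "\<And>i. i < Suc n \<Longrightarrow> f i \<in> X"
    "\<And>c. (\<exists>i<Suc n. c i \<noteq> 0) \<Longrightarrow> 0 < b (\<lambda>x. \<Sum>i<Suc n. c i * f i x) (\<lambda>x. \<Sum>i<Suc n. c i * f i x)"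
    using rich[of "Suc n"] by blast
  obtain c where c: "\<exists>i<Suc n. c i \<noteq> 0" "\<And>j. j < n \<Longrightarrow> a (\<lambda>x. \<Sum>i<Suc n. c i * f i x) (e j) = 0"
    by (rule span_meets_orthogonal[where f=f and g=e and k="Suc n" and m=n])
      (use f(1) eigen_mem[OF sys] in auto)
  define g where "g x = (\<Sum>i<Suc n. c i * f i x)" for x
  have g: "g \<in> X"
    unfolding g_def[abs_def] using f(1) by (intro a.sum_mem)
  have g_pos: "0 < b g g"
    unfolding g_def[abs_def] using c(1) by (rule f(2))
  have g_orth: "\<forall>j<n. a g (e j) = 0"
    unfolding g_def[abs_def] by (intro allI impI c(2))
  obtain w M where w: "0 < M" "w \<in> X" "\<forall>j<n. a w (e j) = 0" "a w w = 1" "b w w = M"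
    "\<forall>v\<in>X. (\<forall>j<n. a v (e j) = 0) \<longrightarrow> b v v \<le> M * a v v"
    by (rule maximizer_exists[OF sys g g_orth g_pos]) (rule that)
  have eq: "b w v = M * a w v" if "v \<in> X" for v
    by (rule maximizer_is_eigenvector[OF sys w(2)]) (use w that in simp_all)
  have "eigen_system X a b (Suc n) (e(n := w)) (\<mu>(n := M))"
    unfolding eigen_system_def
  proof (intro allI impI)
    fix i assume "i < Suc n"
    then consider "i < n" | "i = n" by linarith
    then show "(e(n := w)) i \<in> X \<and> 0 < (\<mu>(n := M)) i \<and> a ((e(n := w)) i) ((e(n := w)) i) = 1 \<and>
      (\<forall>j<i. a ((e(n := w)) i) ((e(n := w)) j) = 0) \<and>
      (\<forall>v\<in>X. b ((e(n := w)) i) v = (\<mu>(n := M)) i * a ((e(n := w)) i) v) \<and>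
      (\<forall>v\<in>X. (\<forall>j<i. a v ((e(n := w)) j) = 0) \<longrightarrow> b v v \<le> (\<mu>(n := M)) i * a v v)"
    proof cases
      case 1
      then show ?thesis using sys unfolding eigen_system_def by simp
    next
      case 2
      then show ?thesis using w eq by simp
    qed
  qed
  then show ?case by blast
qed

end

text \<open>
  The core of the theorem. A vector in the span of \<open>e 0, \<dots>, e n\<close> that is orthogonal to
  \<open>e' 0, \<dots>, e' (n - 1)\<close> has a Rayleigh quotient of at least \<open>\<mu> n\<close> for \<open>b\<close> and of at most \<open>\<mu>' n\<close> for \<open>b'\<close>.
  When the two numbers agree, it is extremal for both forms and hence an eigenvector of both.
\<close>

lemma eigenvalue_comparison:
  assumes "form_pair X a b" "form_pair X a b'"
    and sys: "eigen_system X a b (Suc n) e \<mu>" and sys': "eigen_system X a b' (Suc n) e' \<mu>'"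
    and le: "\<And>u. u \<in> X \<Longrightarrow> b u u \<le> b' u u"
  obtains "\<mu> n < \<mu>' n"
  | u where "u \<in> X" "a u u \<noteq> 0" "b u u = b' u u" "\<And>v. v \<in> X \<Longrightarrow> b u v = \<mu> n * a u v"
      "\<And>v. v \<in> X \<Longrightarrow> b' u v = \<mu> n * a u v"
proof -
  interpret b: form_pair X a b by fact
  interpret b': form_pair X a b' by fact
  obtain c where c: "\<exists>i<Suc n. c i \<noteq> 0" "\<And>j. j < n \<Longrightarrow> a (\<lambda>x. \<Sum>i<Suc n. c i * e i x) (e' j) = 0"
    by (rule b.span_meets_orthogonal[where f=e and g=e' and k="Suc n" and m=n])
      (use b.eigen_mem[OF sys] b'.eigen_mem[OF sys'] in auto)
  define u where "u x = (\<Sum>i<Suc n. c i * e i x)" for x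
  have u: "u \<in> X" unfolding u_def[abs_def] by (rule b.eigen_span_mem[OF sys])
  have au: "a u u = (\<Sum>i<Suc n. (c i)\<^sup>2)" and bu: "b u u = (\<Sum>i<Suc n. \<mu> i * (c i)\<^sup>2)"
    unfolding u_def[abs_def] by (rule b.eigen_span_norm[OF sys] b.eigen_span_form[OF sys])+
  have pos: "a u u > 0"
  proof -
    obtain i where "i < Suc n" "c i \<noteq> 0" using c by auto
    then show ?thesis unfolding au by (intro sum_pos2[of _ i]) auto
  qed
  have 1: "\<mu> n * a u u \<le> b u u"
    unfolding au bu by (rule b.eigen_span_ge[OF sys])
  have 2: "b' u u \<le> \<mu>' n * a u u"
    using c(2) u by (intro b'.eigen_max[OF sys']) (auto simp: u_def[abs_def])
  show thesis
  proof (cases "\<mu> n < \<mu>' n")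
    case False
    then have "\<mu>' n * a u u \<le> \<mu> n * a u u" using pos by simp
    with 1 2 le[OF u] have eqs: "b u u = \<mu> n * a u u" "b' u u = \<mu> n * a u u" "\<mu>' n * a u u = \<mu> n * a u u"
      by linarith+
    then have "\<mu>' n = \<mu> n" using pos by simp
    show thesis
    proof (rule that(2))
      show "b u v = \<mu> n * a u v" if "v \<in> X" for v
        using b.eigen_span_eq[OF sys that, of c] eqs unfolding u_def[abs_def] by blast
      show "b' u v = \<mu> n * a u v" if "v \<in> X" for v
      proof (rule b'.maximizer_is_eigenvector[OF b'.eigen_system_le[OF sys', of n]])
        show "a u (e' j) = 0" if "j < n" for j using c(2)[OF that] by (simp add: u_def[abs_def])
        show "b' v v \<le> \<mu> n * a v v" if "v \<in> X" "\<And>j. j < n \<Longrightarrow> a v (e' j) = 0" for v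
          using b'.eigen_max[OF sys' _ that(1), where i=n] that \<open>\<mu>' n = \<mu> n\<close> by simp
      qed (use that u eqs in auto)
    qed (use u pos eqs in auto)
  qed (rule that(1))
qed

section \<open>The energy space and Poincare inequalities\<close>

definition increment :: "('a \<Rightarrow> real) \<Rightarrow> 'a \<times> 'a \<Rightarrow> real" where
  "increment u z = u (fst z) - u (snd z)"

definition kernel_at :: "('a::euclidean_space \<Rightarrow> real) \<Rightarrow> 'a \<times> 'a \<Rightarrow> real" where
  "kernel_at K z = K (fst z - snd z)"

lemma K_inner_eq: "K_inner K u v = (LINT z|lebesgue. increment u z * increment v z * kernel_at K z)"
  by (simp add: K_inner_def increment_def kernel_at_def case_prod_unfold)

lemma K_norm_eq: "K_norm K u = sqrt (K_inner K u u)"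
  by (simp add: K_norm_def K_inner_def power2_eq_square)

lemma X_space_iff:
  "u \<in> X_space \<Omega> K \<longleftrightarrow> u \<in> borel_measurable lebesgue \<and> integrable lebesgue (\<lambda>x. (u x)\<^sup>2) \<and>
     integrable lebesgue (\<lambda>z. (increment u z)\<^sup>2 * kernel_at K z) \<and> (AE x in lebesgue. x \<notin> \<Omega> \<longrightarrow> u x = 0)"
  by (simp add: X_space_def increment_def kernel_at_def case_prod_unfold)

lemma measurable_increment:
  fixes u :: "'a::euclidean_space \<Rightarrow> real"
  assumes "u \<in> borel_measurable lebesgue"
  shows "increment u \<in> borel_measurable lebesgue"
  unfolding increment_def[abs_def]
  using assms by (intro borel_measurable_diff borel_measurable_lebesgue_product)

lemma AE_increment_zero:
  fixes u :: "'a::euclidean_space \<Rightarrow> real"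
  assumes "AE x in lebesgue. u x = 0"
  shows "AE z in lebesgue. increment u z = 0"
  using AE_lebesgue_fst[OF assms] AE_lebesgue_snd[OF assms] by eventually_elim (simp add: increment_def)

lemma abs_mult_le_sum_squares: "\<bar>x * y\<bar> \<le> x\<^sup>2 + (y::real)\<^sup>2"
proof -
  have "0 \<le> (\<bar>x\<bar> - \<bar>y\<bar>)\<^sup>2" "0 \<le> x\<^sup>2 + y\<^sup>2" by auto
  moreover have "0 \<le> \<bar>x\<bar> * \<bar>y\<bar>" by simp
  ultimately show ?thesis unfolding power2_diff abs_mult power2_abs by linarith
qed

lemma integrable_mult_of_squares:
  fixes f g k :: "'b \<Rightarrow> real"
  assumes [measurable]: "f \<in> borel_measurable M" "g \<in> borel_measurable M" "k \<in> borel_measurable M"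
    and "integrable M (\<lambda>x. (f x)\<^sup>2 * k x)" "integrable M (\<lambda>x. (g x)\<^sup>2 * k x)"
  shows "integrable M (\<lambda>x. f x * g x * k x)"
proof (rule Bochner_Integration.integrable_bound)
  show "integrable M (\<lambda>x. (f x)\<^sup>2 * k x + (g x)\<^sup>2 * k x)" using assms by auto
  show "AE x in M. norm (f x * g x * k x) \<le> norm ((f x)\<^sup>2 * k x + (g x)\<^sup>2 * k x)"
  proof (rule AE_I2)
    fix x
    have "norm (f x * g x * k x) = \<bar>f x * g x\<bar> * \<bar>k x\<bar>" by (simp add: abs_mult)
    also have "\<dots> \<le> ((f x)\<^sup>2 + (g x)\<^sup>2) * \<bar>k x\<bar>"
      by (intro mult_right_mono abs_mult_le_sum_squares) auto
    also have "\<dots> = norm ((f x)\<^sup>2 * k x + (g x)\<^sup>2 * k x)"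
      by (simp add: abs_mult flip: distrib_right)
    finally show "norm (f x * g x * k x) \<le> norm ((f x)\<^sup>2 * k x + (g x)\<^sup>2 * k x)" .
  qed
qed simp

locale bounded_domain_kernel =
  fixes \<Omega> :: "'a::euclidean_space set" and K :: "'a \<Rightarrow> real"
  assumes open_domain: "open \<Omega>" and bounded_domain: "bounded \<Omega>"
    and admissible: "admissible_kernel K"
begin

abbreviation "X \<equiv> X_space \<Omega> K"

lemma domain_sets[measurable, simp]: "\<Omega> \<in> sets lebesgue" "\<Omega> \<in> lmeasurable"
  using open_domain bounded_domain by (auto simp: lmeasurable_open)

text \<open>
  Only the product of \<open>K\<close> with the cutoff \<open>min (norm x)\<^sup>2 1\<close> is assumed to be measurable. Away from the
  origin one can divide by the cutoff.
\<close>

lemma kernel_measurable: "K \<in> borel_measurable lebesgue"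
proof -
  have m: "(\<lambda>x. min ((norm x)\<^sup>2) 1 * K x) \<in> borel_measurable lebesgue"
    using admissible by (auto simp: admissible_kernel_def)
  have n: "(\<lambda>x::'a. min ((norm x)\<^sup>2) 1) \<in> borel_measurable lebesgue"
    by (intro measurable_completion) simp
  have "K = (\<lambda>x. if x = 0 then K 0 else (min ((norm x)\<^sup>2) 1 * K x) / min ((norm x)\<^sup>2) 1)"
    by (auto simp: fun_eq_iff min_def)
  also have "\<dots> \<in> borel_measurable lebesgue"
    using m n by (intro measurable_If borel_measurable_divide) auto
  finally show ?thesis .
qed

lemma kernel_at_measurable: "kernel_at K \<in> borel_measurable lebesgue"
  unfolding kernel_at_def[abs_def] by (rule borel_measurable_lebesgue_diff[OF kernel_measurable])

text \<open>
  The unconstrained value of the kernel at the origin does no harm: on the diagonal the increment is zero.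
\<close>

lemma increment_kernel_nonneg: "0 \<le> (increment u z)\<^sup>2 * kernel_at K z"
  using admissible
  by (cases "fst z = snd z") (auto simp: increment_def kernel_at_def admissible_kernel_def less_imp_le)

lemma K_inner_integrable:
  assumes "u \<in> X" "v \<in> X"
  shows "integrable lebesgue (\<lambda>z. increment u z * increment v z * kernel_at K z)"
  using assms by (intro integrable_mult_of_squares measurable_increment kernel_at_measurable) (auto simp: X_space_iff)

lemma product_integrable:
  assumes "u \<in> X" "v \<in> X"
  shows "integrable lebesgue (\<lambda>x. u x * v x)"
  using integrable_mult_of_squares[of u lebesgue v "\<lambda>_. 1"] assms by (simp add: X_space_iff)

lemma X_space_comb:
  assumes "u \<in> X" "v \<in> X"
  shows "(\<lambda>x. p * u x + q * v x) \<in> X"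
proof -
  have 1: "integrable lebesgue (\<lambda>x. p\<^sup>2 * (u x)\<^sup>2 + 2 * p * q * (u x * v x) + q\<^sup>2 * (v x)\<^sup>2)"
    using assms product_integrable[OF assms] by (auto simp: X_space_iff)
  have "integrable lebesgue (\<lambda>z. p\<^sup>2 * ((increment u z)\<^sup>2 * kernel_at K z)
      + 2 * p * q * (increment u z * increment v z * kernel_at K z) + q\<^sup>2 * ((increment v z)\<^sup>2 * kernel_at K z))"
    using assms K_inner_integrable[OF assms]
    by (intro Bochner_Integration.integrable_add integrable_mult_right) (auto simp: X_space_iff)
  moreover have "p\<^sup>2 * ((increment u z)\<^sup>2 * kernel_at K z)
      + 2 * p * q * (increment u z * increment v z * kernel_at K z) + q\<^sup>2 * ((increment v z)\<^sup>2 * kernel_at K z)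
      = (increment (\<lambda>x. p * u x + q * v x) z)\<^sup>2 * kernel_at K z" for z
    unfolding increment_def by algebra
  moreover have "p\<^sup>2 * (u x)\<^sup>2 + 2 * p * q * (u x * v x) + q\<^sup>2 * (v x)\<^sup>2 = (p * u x + q * v x)\<^sup>2" for x
    by algebra
  moreover have "AE x in lebesgue. x \<notin> \<Omega> \<longrightarrow> p * u x + q * v x = 0"
  proof -
    have "AE x in lebesgue. x \<notin> \<Omega> \<longrightarrow> u x = 0" "AE x in lebesgue. x \<notin> \<Omega> \<longrightarrow> v x = 0"
      using assms by (auto simp: X_space_iff)
    then show ?thesis by eventually_elim auto
  qed
  ultimately show ?thesis
    using assms 1 by (auto simp: X_space_iff)
qed

sublocale function_space X
proof
  have "(\<lambda>x. 0) \<in> X" by (simp add: X_space_iff increment_def)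
  then show "X \<noteq> {}" by blast
qed (rule X_space_comb)

sublocale K: symmetric_form X "K_inner K"
proof
  fix u v w :: "'a \<Rightarrow> real" and p q
  assume X: "u \<in> X" "v \<in> X" "w \<in> X"
  have "increment (\<lambda>x. p * u x + q * v x) z * increment w z * kernel_at K z
     = p * (increment u z * increment w z * kernel_at K z) + q * (increment v z * increment w z * kernel_at K z)" for z
    unfolding increment_def by algebra
  then show "K_inner K (\<lambda>x. p * u x + q * v x) w = p * K_inner K u w + q * K_inner K v w"
    unfolding K_inner_eq using K_inner_integrable X by simp
qed (simp add: K_inner_eq mult.commute)

lemma K_inner_nonneg: "0 \<le> K_inner K u u"
  unfolding K_inner_eq using increment_kernel_nonneg[of u]
  by (intro integral_nonneg_AE) (auto simp: power2_eq_square)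

lemma K_inner_AE_zero:
  assumes "AE x in lebesgue. u x = 0"
  shows "K_inner K u v = 0"
  unfolding K_inner_eq
proof (rule integral_eq_zero_AE)
  show "AE z in lebesgue. increment u z * increment v z * kernel_at K z = 0"
    using AE_increment_zero[OF assms] by eventually_elim simp
qed

definition mass :: "('a \<Rightarrow> real) \<Rightarrow> real" where
  "mass u = (LINT x|lebesgue. (u x)\<^sup>2)"

lemma square_integrable_on:
  assumes "u \<in> X" and Q: "Q \<in> lmeasurable"
  shows "integrable lebesgue (\<lambda>x. indicator Q x * u x)" "integrable lebesgue (\<lambda>x. indicator Q x * (u x)\<^sup>2)"
    "integrable lebesgue (indicat_real Q)"
proof -
  have u: "integrable lebesgue (\<lambda>x. (u x)\<^sup>2)" "u \<in> borel_measurable lebesgue"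
    using assms by (auto simp: X_space_iff)
  have [measurable]: "Q \<in> sets lebesgue" using Q by (rule fmeasurableD)
  show i: "integrable lebesgue (indicat_real Q)" using Q
    by (simp add: fmeasurable_def)
  show "integrable lebesgue (\<lambda>x. indicator Q x * u x)"
  proof (rule Bochner_Integration.integrable_bound)
    show "integrable lebesgue (\<lambda>x. indicat_real Q x + (u x)\<^sup>2)" using i u by auto
    show "AE x in lebesgue. norm (indicator Q x * u x) \<le> norm (indicat_real Q x + (u x)\<^sup>2)"
      using abs_mult_le_sum_squares[of 1] by (intro AE_I2) (auto simp: indicator_def)
  qed (use u in measurable)
  show "integrable lebesgue (\<lambda>x. indicator Q x * (u x)\<^sup>2)"
    using integrable_mult_indicator[OF _ u(1), of Q] by simp
qed

text \<open>
  Both sides are \<open>2 |Q|\<^sup>2\<close> times the variance of \<open>u\<close> on \<open>Q\<close>; the left-hand side is the one that can be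
  compared with the energy.
\<close>

lemma variance_identity:
  assumes u: "u \<in> X" and Q: "Q \<in> lmeasurable"
  shows "integrable lebesgue (\<lambda>z. indicator Q (fst z) * indicator Q (snd z) * (increment u z)\<^sup>2)"
    and "(LINT z|lebesgue. indicator Q (fst z) * indicator Q (snd z) * (increment u z)\<^sup>2)
     = 2 * measure lebesgue Q * (LINT x|lebesgue. indicator Q x * (u x)\<^sup>2)
       - 2 * (LINT x|lebesgue. indicator Q x * u x)\<^sup>2"
proof -
  note i = square_integrable_on[OF u Q]
  note ip = integrable_lebesgue_product and vp = integral_lebesgue_product
  have eq: "indicator Q (fst z) * indicator Q (snd z) * (increment u z)\<^sup>2
    = (indicator Q (fst z) * (u (fst z))\<^sup>2) * indicat_real Q (snd z)
      + (indicator Q (fst z) * (indicator Q (snd z) * (u (snd z))\<^sup>2)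
      - 2 * ((indicator Q (fst z) * u (fst z)) * (indicator Q (snd z) * u (snd z))))" for z
    unfolding increment_def by algebra
  show "integrable lebesgue (\<lambda>z. indicator Q (fst z) * indicator Q (snd z) * (increment u z)\<^sup>2)"
    unfolding eq
    by (intro Bochner_Integration.integrable_add Bochner_Integration.integrable_diff integrable_mult_right
        ip[OF i(2) i(3)] ip[OF i(3) i(2)] ip[OF i(1) i(1)])
  have m: "integral\<^sup>L lebesgue (indicat_real Q) = measure lebesgue Q"
    by simp
  show "(LINT z|lebesgue. indicator Q (fst z) * indicator Q (snd z) * (increment u z)\<^sup>2)
     = 2 * measure lebesgue Q * (LINT x|lebesgue. indicator Q x * (u x)\<^sup>2)
       - 2 * (LINT x|lebesgue. indicator Q x * u x)\<^sup>2"
    unfolding eq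
    by (subst Bochner_Integration.integral_add Bochner_Integration.integral_diff,
        (intro Bochner_Integration.integrable_add Bochner_Integration.integrable_diff integrable_mult_right
        ip[OF i(2) i(3)] ip[OF i(3) i(2)] ip[OF i(1) i(1)])+)+
      (simp add: vp[OF i(2) i(3)] vp[OF i(3) i(2)] vp[OF i(1) i(1)] m power2_eq_square[of "integral\<^sup>L _ _"])
qed

lemma mean_square_le:
  assumes u: "u \<in> X" and Q: "Q \<in> lmeasurable"
  shows "(LINT x|lebesgue. indicator Q x * u x)\<^sup>2 \<le> measure lebesgue Q * (LINT x|lebesgue. indicator Q x * (u x)\<^sup>2)"
proof -
  have "0 \<le> (LINT z|lebesgue. indicator Q (fst z) * indicator Q (snd z) * (increment u z)\<^sup>2)"
    by (intro integral_nonneg_AE) auto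
  then show ?thesis unfolding variance_identity(2)[OF u Q] by simp
qed

text \<open>
  Where the kernel is at least \<open>\<kappa>\<close>, the energy on \<open>Q \<times> Q\<close> dominates \<open>\<kappa>\<close> times the double integral of the
  squared increment, that is, the variance.
\<close>

lemma local_Poincare:
  assumes u: "u \<in> X" and Q: "Q \<in> lmeasurable" and "\<kappa> > 0"
    and lower: "\<And>x y. x \<in> Q \<Longrightarrow> y \<in> Q \<Longrightarrow> x \<noteq> y \<Longrightarrow> \<kappa> \<le> K (x - y)"
  shows "measure lebesgue Q * (LINT x|lebesgue. indicator Q x * (u x)\<^sup>2)
     \<le> (LINT x|lebesgue. indicator Q x * u x)\<^sup>2
       + 1 / (2 * \<kappa>) * (LINT z|lebesgue. indicator Q (fst z) * indicator Q (snd z) * ((increment u z)\<^sup>2 * kernel_at K z))"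
    and "integrable lebesgue (\<lambda>z. indicator Q (fst z) * indicator Q (snd z) * ((increment u z)\<^sup>2 * kernel_at K z))"
proof -
  have Qs: "Q \<in> sets lebesgue" using Q by (rule fmeasurableD)
  show i: "integrable lebesgue (\<lambda>z. indicator Q (fst z) * indicator Q (snd z) * ((increment u z)\<^sup>2 * kernel_at K z))"
  proof (rule Bochner_Integration.integrable_bound)
    show int: "integrable lebesgue (\<lambda>z. (increment u z)\<^sup>2 * kernel_at K z)"
      using u by (simp add: X_space_iff)
    have "(\<lambda>z. indicat_real Q (fst z)) \<in> borel_measurable (lebesgue :: ('a \<times> 'a) measure)"
      "(\<lambda>z. indicat_real Q (snd z)) \<in> borel_measurable (lebesgue :: ('a \<times> 'a) measure)"
      using Qs by (auto intro: borel_measurable_lebesgue_product)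
    then show "(\<lambda>z. indicator Q (fst z) * indicator Q (snd z) * ((increment u z)\<^sup>2 * kernel_at K z))
      \<in> borel_measurable lebesgue"
      using measurable_increment[of u] kernel_at_measurable u
      by (intro borel_measurable_times borel_measurable_power) (auto simp: X_space_iff)
  qed (auto simp: indicator_def)
  have "(LINT z|lebesgue. indicator Q (fst z) * indicator Q (snd z) * (increment u z)\<^sup>2)
    \<le> (LINT z|lebesgue. 1 / \<kappa> * (indicator Q (fst z) * indicator Q (snd z) * ((increment u z)\<^sup>2 * kernel_at K z)))"
  proof (intro integral_mono variance_identity(1)[OF u Q] integrable_mult_right i)
    fix z :: "'a \<times> 'a"
    show "indicator Q (fst z) * indicator Q (snd z) * (increment u z)\<^sup>2
      \<le> 1 / \<kappa> * (indicator Q (fst z) * indicator Q (snd z) * ((increment u z)\<^sup>2 * kernel_at K z))"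
    proof (cases "fst z \<in> Q \<and> snd z \<in> Q \<and> fst z \<noteq> snd z")
      case True
      then have "\<kappa> \<le> kernel_at K z" using lower by (simp add: kernel_at_def)
      then have "(increment u z)\<^sup>2 * \<kappa> \<le> (increment u z)\<^sup>2 * kernel_at K z"
        by (intro mult_left_mono) auto
      then show ?thesis using True \<open>\<kappa> > 0\<close> by (simp add: field_simps)
    qed (auto simp: indicator_def increment_def)
  qed
  then show "measure lebesgue Q * (LINT x|lebesgue. indicator Q x * (u x)\<^sup>2)
     \<le> (LINT x|lebesgue. indicator Q x * u x)\<^sup>2
       + 1 / (2 * \<kappa>) * (LINT z|lebesgue. indicator Q (fst z) * indicator Q (snd z) * ((increment u z)\<^sup>2 * kernel_at K z))"
    unfolding variance_identity(2)[OF u Q] by (simp add: field_simps)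
qed

lemma kernel_lower_bound:
  obtains \<alpha> s where "\<alpha> > 0" "0 < s"
    "\<And>d z. norm z \<le> d \<Longrightarrow> z \<noteq> 0 \<Longrightarrow> \<alpha> * d powr (- (real DIM('a) + 2 * s)) \<le> K z"
proof -
  obtain \<alpha> s where as: "\<alpha> > 0" "0 < s" "\<And>x. x \<noteq> 0 \<Longrightarrow> K x \<ge> \<alpha> * norm x powr (- (real DIM('a) + 2 * s))"
    using admissible by (auto simp: admissible_kernel_def)
  show thesis
  proof (rule that[OF as(1,2)])
    fix d and z :: 'a assume "norm z \<le> d" "z \<noteq> 0"
    then have "d powr (- (real DIM('a) + 2 * s)) \<le> norm z powr (- (real DIM('a) + 2 * s))"
      using as by (intro powr_mono2') auto
    then have "\<alpha> * d powr (- (real DIM('a) + 2 * s)) \<le> \<alpha> * norm z powr (- (real DIM('a) + 2 * s))"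
      using as by simp
    with as(3)[OF \<open>z \<noteq> 0\<close>] show "\<alpha> * d powr (- (real DIM('a) + 2 * s)) \<le> K z" by linarith
  qed
qed

lemma X_indicator_domain:
  assumes u: "u \<in> X" and Q: "\<Omega> \<subseteq> Q" "Q \<in> sets lebesgue"
  shows "(LINT x|lebesgue. indicator Q x * u x) = (LINT x|lebesgue. indicator \<Omega> x * u x)"
    and "(LINT x|lebesgue. indicator Q x * (u x)\<^sup>2) = mass u"
proof -
  have um[measurable]: "u \<in> borel_measurable lebesgue" and z: "AE x in lebesgue. x \<notin> \<Omega> \<longrightarrow> u x = 0"
    using u by (auto simp: X_space_iff)
  note Q(2)[measurable]
  have 1: "AE x in lebesgue. indicator Q x * u x = indicator \<Omega> x * u x"
    using z by eventually_elim (use Q in \<open>auto simp: indicator_def\<close>)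
  show "(LINT x|lebesgue. indicator Q x * u x) = (LINT x|lebesgue. indicator \<Omega> x * u x)"
    by (rule integral_cong_AE[OF _ _ 1]) measurable
  have 2: "AE x in lebesgue. indicator Q x * (u x)\<^sup>2 = (u x)\<^sup>2"
    using z by eventually_elim (use Q in \<open>auto simp: indicator_def\<close>)
  show "(LINT x|lebesgue. indicator Q x * (u x)\<^sup>2) = mass u"
    unfolding mass_def by (rule integral_cong_AE[OF _ _ 2]) measurable
qed

lemma mass_nonneg: "0 \<le> mass u"
  unfolding mass_def by (intro integral_nonneg_AE) auto

text \<open>
  Apply the local inequality on a cube whose volume exceeds that of \<open>\<Omega>\<close> by at least \<open>1\<close>. Since \<open>u\<close> lives
  on \<open>\<Omega>\<close>, the squared integral of \<open>u\<close> is at most \<open>|\<Omega>|\<close> times its mass and is absorbed by the left-hand side.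
\<close>

lemma Poincare:
  obtains C where "C \<ge> 0" "\<And>u. u \<in> X \<Longrightarrow> mass u \<le> C * K_inner K u u"
proof -
  define m where "m = measure lebesgue \<Omega>"
  obtain R where R: "\<And>x. x \<in> \<Omega> \<Longrightarrow> norm x \<le> R" using bounded_domain by (auto simp: bounded_iff)
  \<comment> \<open>The cube with half side \<open>t\<close> contains \<open>\<Omega>\<close>, and as \<open>t \<ge> 1\<close> its volume is at least \<open>2 * t\<close>.\<close>
  define t where "t = max R 0 + m + 1"
  define Q where "Q = cbox (- t *\<^sub>R One) (t *\<^sub>R One :: 'a)"
  have m: "m \<ge> 0" by (simp add: m_def)
  then have t: "t \<ge> 1" "t \<ge> m + 1" "t \<ge> R" by (auto simp: t_def)
  have Q: "Q \<in> lmeasurable" by (simp add: Q_def)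
  have sub: "\<Omega> \<subseteq> Q"
  proof
    fix x assume "x \<in> \<Omega>"
    then have "\<bar>x \<bullet> b\<bar> \<le> t" if "b \<in> Basis" for b
      using R[of x] t(3) Basis_le_norm[OF that, of x] by linarith
    then show "x \<in> Q" unfolding Q_def mem_box by (auto simp: abs_le_iff minus_le_iff)
  qed
  have "measure lebesgue Q = (2 * t) ^ DIM('a)"
    using t by (simp add: Q_def content_cbox_if box_eq_empty algebra_simps flip: prod_constant)
  also have "\<dots> \<ge> 2 * t" using t by (intro self_le_power) auto
  finally have q: "measure lebesgue Q \<ge> m + 1" using t by linarith
  obtain \<alpha> s where as: "\<alpha> > 0" "0 < s"
    "\<And>d z. norm z \<le> d \<Longrightarrow> z \<noteq> 0 \<Longrightarrow> \<alpha> * d powr (- (real DIM('a) + 2 * s)) \<le> K z"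
    by (rule kernel_lower_bound) blast
  obtain d where d: "\<And>x y. x \<in> Q \<Longrightarrow> y \<in> Q \<Longrightarrow> norm (x - y) \<le> d" "d > 0"
  proof -
    obtain e where "\<And>x. x \<in> Q \<Longrightarrow> norm x \<le> e"
      using bounded_cbox unfolding Q_def bounded_iff by blast
    then have "norm (x - y) \<le> 2 * \<bar>e\<bar> + 1" if "x \<in> Q" "y \<in> Q" for x y
      using norm_triangle_ineq4[of x y] that by (smt (verit))
    then show thesis by (intro that) auto
  qed
  define \<kappa> where "\<kappa> = \<alpha> * d powr (- (real DIM('a) + 2 * s))"
  have \<kappa>: "\<kappa> > 0" using as d by (simp add: \<kappa>_def)
  show thesis
  proof (rule that[of "1 / (2 * \<kappa>)"])
    fix u assume u: "u \<in> X"
    have int: "integrable lebesgue (\<lambda>z. (increment u z)\<^sup>2 * kernel_at K z)"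
      using u by (simp add: X_space_iff)
    have lower: "\<kappa> \<le> K (x - y)" if "x \<in> Q" "y \<in> Q" "x \<noteq> y" for x y
      unfolding \<kappa>_def using that d by (intro as(3)) auto
    note lP = local_Poincare[OF u Q \<kappa> lower]
    have "(LINT z|lebesgue. indicator Q (fst z) * indicator Q (snd z) * ((increment u z)\<^sup>2 * kernel_at K z))
      \<le> (LINT z|lebesgue. (increment u z)\<^sup>2 * kernel_at K z)"
      using increment_kernel_nonneg[of u]
      by (intro integral_mono lP(2) int) (auto simp: indicator_def)
    also have "\<dots> = K_inner K u u" by (simp add: K_inner_eq power2_eq_square)
    finally have le: "(LINT z|lebesgue. indicator Q (fst z) * indicator Q (snd z) * ((increment u z)\<^sup>2 * kernel_at K z))
      \<le> K_inner K u u" .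
    have "(m + 1) * mass u \<le> measure lebesgue Q * mass u"
      using q mass_nonneg by (intro mult_right_mono)
    also have "\<dots> \<le> (LINT x|lebesgue. indicator \<Omega> x * u x)\<^sup>2 + 1 / (2 * \<kappa>) * (LINT z|lebesgue. indicator Q (fst z) * indicator Q (snd z) * ((increment u z)\<^sup>2 * kernel_at K z))"
      using lP(1) X_indicator_domain[OF u sub fmeasurableD[OF Q]] by simp
    also have "\<dots> \<le> (LINT x|lebesgue. indicator \<Omega> x * u x)\<^sup>2 + 1 / (2 * \<kappa>) * K_inner K u u"
      using le \<kappa> by (intro add_left_mono mult_left_mono) auto
    also have "(LINT x|lebesgue. indicator \<Omega> x * u x)\<^sup>2 \<le> m * mass u"
      using mean_square_le[OF u, of \<Omega>] X_indicator_domain(2)[OF u order_refl] by (simp add: m_def)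
    finally show "mass u \<le> 1 / (2 * \<kappa>) * K_inner K u u" by (simp add: algebra_simps)
  qed (use \<kappa> in auto)
qed

end

text \<open>
  The cell containing \<open>x\<close> of the grid of half-open cubes with side \<open>h\<close>.
\<close>

definition grid_cell :: "real \<Rightarrow> 'a::euclidean_space \<Rightarrow> 'a set" where
  "grid_cell h x = {y. \<forall>b\<in>Basis. \<lfloor>y \<bullet> b / h\<rfloor> = \<lfloor>x \<bullet> b / h\<rfloor>}"

lemma self_in_grid_cell: "x \<in> grid_cell h x"
  by (simp add: grid_cell_def)

lemma grid_cell_disjoint:
  assumes "A \<in> range (grid_cell h)" "B \<in> range (grid_cell h)" "z \<in> A" "z \<in> B"
  shows "A = B"
  using assms by (fastforce simp: grid_cell_def)

lemma grid_cell_norm_le: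
  fixes y z :: "'a::euclidean_space"
  assumes "h > 0" "y \<in> grid_cell h x" "z \<in> grid_cell h x"
  shows "norm (y - z) \<le> real DIM('a) * h"
proof -
  have "\<bar>(y - z) \<bullet> b\<bar> \<le> h" if "b \<in> Basis" for b
  proof -
    have "\<lfloor>y \<bullet> b / h\<rfloor> = \<lfloor>z \<bullet> b / h\<rfloor>" using assms that by (simp add: grid_cell_def)
    then have "\<bar>y \<bullet> b / h - z \<bullet> b / h\<bar> \<le> 1" by linarith
    then have "\<bar>(y \<bullet> b - z \<bullet> b) / h\<bar> \<le> 1" by (simp add: diff_divide_distrib)
    then show ?thesis using assms(1) by (simp add: inner_diff_left)
  qed
  then have "(\<Sum>b\<in>Basis. \<bar>(y - z) \<bullet> b\<bar>) \<le> real DIM('a) * h"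
    by (rule sum_bounded_above)
  with norm_le_l1[of "y - z"] show ?thesis by linarith
qed

lemma grid_cell_measurable:
  fixes x :: "'a::euclidean_space"
  assumes "h > 0"
  shows "grid_cell h x \<in> lmeasurable" and "h ^ DIM('a) \<le> measure lebesgue (grid_cell h x)"
proof -
  have "grid_cell h x = {y \<in> space borel. \<forall>b\<in>Basis. \<lfloor>y \<bullet> b / h\<rfloor> = \<lfloor>x \<bullet> b / h\<rfloor>}"
    by (simp add: grid_cell_def)
  also have "\<dots> \<in> sets borel" by measurable
  finally have "grid_cell h x \<in> sets lebesgue" by simp
  moreover have "bounded (grid_cell h x)"
    using grid_cell_norm_le[OF assms _ self_in_grid_cell, of _ x]
    by (intro boundedI[of _ "norm x + real DIM('a) * h"]) (smt (verit) norm_triangle_sub)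
  ultimately show m: "grid_cell h x \<in> lmeasurable"
    by (rule bounded_set_imp_lmeasurable[rotated])
  define p where "p = (\<Sum>b\<in>Basis. (h * \<lfloor>x \<bullet> b / h\<rfloor>) *\<^sub>R b)"
  have pb: "p \<bullet> b = h * \<lfloor>x \<bullet> b / h\<rfloor>" if "b \<in> Basis" for b
    using that by (simp add: p_def)
  have "box p (p + h *\<^sub>R One) \<subseteq> grid_cell h x"
  proof
    fix y assume y: "y \<in> box p (p + h *\<^sub>R One)"
    have "\<lfloor>y \<bullet> b / h\<rfloor> = \<lfloor>x \<bullet> b / h\<rfloor>" if b: "b \<in> Basis" for b
    proof -
      have "h * \<lfloor>x \<bullet> b / h\<rfloor> < y \<bullet> b" "y \<bullet> b < h * \<lfloor>x \<bullet> b / h\<rfloor> + h"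
        using y b pb[OF b] by (auto simp: mem_box inner_add_left)
      then show ?thesis using assms by (intro floor_unique) (auto simp: field_simps)
    qed
    then show "y \<in> grid_cell h x" by (simp add: grid_cell_def)
  qed
  then have "measure lebesgue (box p (p + h *\<^sub>R One)) \<le> measure lebesgue (grid_cell h x)"
    using m by (intro measure_mono_fmeasurable) auto
  moreover have "measure lebesgue (box p (p + h *\<^sub>R One)) = h ^ DIM('a)"
    using assms by (simp add: measure_lborel_box_eq inner_add_left)
  ultimately show "h ^ DIM('a) \<le> measure lebesgue (grid_cell h x)" by simp
qed

lemma finite_grid_cells:
  fixes S :: "'a::euclidean_space set"
  assumes "bounded S" "h > 0"
  shows "finite (grid_cell h ` S)"
proof -
  obtain R where R: "\<And>x. x \<in> S \<Longrightarrow> norm x \<le> R" using assms(1) by (auto simp: bounded_iff)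
  \<comment> \<open>A cell is determined by its integer corner, and those of cells that meet \<open>S\<close> are bounded.\<close>
  define M where "M = \<lceil>R / h\<rceil> + 1"
  define g where "g x = (\<lambda>b\<in>Basis. \<lfloor>x \<bullet> b / h\<rfloor>)" for x :: 'a
  have "g ` S \<subseteq> Basis \<rightarrow>\<^sub>E {-M..M}"
  proof (intro image_subsetI, unfold g_def, rule PiE_I)
    fix x b assume "x \<in> S" "b \<in> (Basis :: 'a set)"
    then have "\<bar>x \<bullet> b\<bar> \<le> R" using R[of x] Basis_le_norm[of b x] by linarith
    then have "\<bar>x \<bullet> b / h\<bar> \<le> R / h" using assms(2) by (simp add: divide_right_mono)
    then have "- M \<le> \<lfloor>x \<bullet> b / h\<rfloor>" "\<lfloor>x \<bullet> b / h\<rfloor> \<le> M" unfolding M_def by linarith+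
    then show "restrict (\<lambda>b. \<lfloor>x \<bullet> b / h\<rfloor>) Basis b \<in> {-M..M}" using \<open>b \<in> Basis\<close> by simp
  qed (auto simp: restrict_def)
  then have "finite (g ` S)" by (rule finite_subset) (auto intro: finite_PiE)
  moreover have "grid_cell h x = {y. g y = g x}" for x
    by (auto simp: grid_cell_def g_def fun_eq_iff restrict_def)
  then have "grid_cell h ` S = (\<lambda>k. {y. g y = k}) ` (g ` S)" by auto
  ultimately show ?thesis by simp
qed

context bounded_domain_kernel
begin

text \<open>
  Sum the local inequality over a grid of side \<open>h\<close>. On a cell of volume \<open>h\<close> to the power \<open>N\<close> and diameter
  at most \<open>N h\<close>, the kernel is at least of order \<open>h\<close> to the power \<open>-(N + 2 s)\<close>, so the energy enters with a
  factor of order \<open>h\<close> to the power \<open>2 s\<close>, which is as small as desired. This is where the singularity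
  of the kernel is used; with the finitely many cell averages, it yields compactness.
\<close>

lemma grid_Poincare:
  assumes "\<epsilon> > 0"
  shows "\<exists>\<Q> C. finite \<Q> \<and> C \<ge> 0 \<and> (\<forall>Q\<in>\<Q>. Q \<in> lmeasurable) \<and>
    (\<forall>u\<in>X. mass u \<le> \<epsilon> * K_inner K u u + C * (\<Sum>Q\<in>\<Q>. (LINT x|lebesgue. indicator Q x * u x)\<^sup>2))"
proof -
  obtain \<alpha> s where as: "\<alpha> > 0" "0 < s"
    "\<And>d z. norm z \<le> d \<Longrightarrow> z \<noteq> 0 \<Longrightarrow> \<alpha> * d powr (- (real DIM('a) + 2 * s)) \<le> K z"
    by (rule kernel_lower_bound) blast
  define N where "N = real DIM('a)"
  have N: "N > 0" by (simp add: N_def)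
  \<comment> \<open>This side length gives the factor of the energy in the local inequality exactly the value \<open>\<epsilon>\<close>.\<close>
  define h where "h = (2 * \<alpha> * \<epsilon> / N powr (N + 2 * s)) powr (1 / (2 * s))"
  have h: "h > 0" using as N assms by (simp add: h_def)
  define \<kappa> where "\<kappa> = \<alpha> * (N * h) powr (- (N + 2 * s))"
  have \<kappa>: "\<kappa> > 0" using as N h by (simp add: \<kappa>_def)
  have "h powr (2 * s) = 2 * \<alpha> * \<epsilon> / N powr (N + 2 * s)"
    using as N assms by (simp add: h_def powr_powr)
  then have "\<epsilon> * 2 * \<alpha> = N powr (N + 2 * s) * h powr (2 * s)"
    using as N by (simp add: field_simps)
  moreover have "1 / \<kappa> = N powr (N + 2 * s) * h powr (2 * s) * h powr N / \<alpha>"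
    unfolding \<kappa>_def powr_minus using N h by (simp add: powr_mult powr_add[of h] divide_inverse)
  ultimately have "1 / \<kappa> = \<epsilon> * 2 * \<alpha> * h powr N / \<alpha>" by simp
  then have "1 / (2 * \<kappa>) = \<epsilon> * h powr N" using as(1) by simp
  then have \<kappa>_eq: "1 / (2 * \<kappa>) = \<epsilon> * h ^ DIM('a)"
    using h by (simp add: N_def powr_realpow)
  define \<Q> where "\<Q> = grid_cell h ` \<Omega>"
  have fin: "finite \<Q>" unfolding \<Q>_def by (rule finite_grid_cells[OF bounded_domain h])
  have Qm: "Q \<in> lmeasurable" and Qh: "h ^ DIM('a) \<le> measure lebesgue Q" if "Q \<in> \<Q>" for Q
    using that grid_cell_measurable[OF h] by (auto simp: \<Q>_def)
  have disj: "A = B" if "A \<in> \<Q>" "B \<in> \<Q>" "z \<in> A" "z \<in> B" for A B z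
    using grid_cell_disjoint[of A h B z] that by (auto simp: \<Q>_def)
  have one: "(\<Sum>Q\<in>\<Q>. indicat_real Q x) \<le> 1" for x
  proof (cases "\<exists>Q\<in>\<Q>. x \<in> Q")
    case True
    then obtain A where A: "A \<in> \<Q>" "x \<in> A" by auto
    have "(\<Sum>Q\<in>\<Q>. indicat_real Q x) = (\<Sum>Q\<in>\<Q>. if Q = A then 1 else 0)"
      using A disj by (intro sum.cong) (auto simp: indicator_def)
    then show ?thesis using fin A by simp
  qed (auto simp: indicator_def)
  have cover: "\<Omega> \<subseteq> \<Union>\<Q>" using self_in_grid_cell by (force simp: \<Q>_def)
  define H where "H = h ^ DIM('a)"
  have H: "H > 0" using h by (simp add: H_def)
  show ?thesis
  proof (intro exI conjI ballI)
    show "finite \<Q>" by fact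
    show "0 \<le> 1 / H" using H by simp
    show "Q \<in> lmeasurable" if "Q \<in> \<Q>" for Q using Qm[OF that] .
    fix u assume u: "u \<in> X"
    define S where "S Q = (LINT x|lebesgue. indicator Q x * (u x)\<^sup>2)" for Q
    define J where "J Q = (LINT z|lebesgue. indicator Q (fst z) * indicator Q (snd z) * ((increment u z)\<^sup>2 * kernel_at K z))" for Q
    define m where "m Q = (LINT x|lebesgue. indicator Q x * u x)" for Q
    have lower: "\<kappa> \<le> K (x - y)" if "Q \<in> \<Q>" "x \<in> Q" "y \<in> Q" "x \<noteq> y" for Q x y
    proof -
      have "norm (x - y) \<le> N * h"
        using that grid_cell_norm_le[OF h] by (auto simp: \<Q>_def N_def)
      then show ?thesis unfolding \<kappa>_def N_def using that as(3)[of "x - y"] by (simp add: N_def)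
    qed
    note lP = local_Poincare[OF u Qm \<kappa> lower]
    have J: "integrable lebesgue (\<lambda>z. indicator Q (fst z) * indicator Q (snd z) * ((increment u z)\<^sup>2 * kernel_at K z))"
      if "Q \<in> \<Q>" for Q using lP(2)[OF that that] .
    have S0: "0 \<le> S Q" for Q unfolding S_def by (intro integral_nonneg_AE) (auto)
    have SQ: "S Q \<le> (m Q)\<^sup>2 / H + \<epsilon> * J Q" if "Q \<in> \<Q>" for Q
    proof -
      have "H * S Q \<le> measure lebesgue Q * S Q"
        using Qh[OF that] S0 by (intro mult_right_mono) (auto simp: H_def)
      also have "\<dots> \<le> (m Q)\<^sup>2 + \<epsilon> * H * J Q"
        using lP(1)[OF that that] by (simp add: S_def J_def m_def \<kappa>_eq H_def)
      finally show ?thesis using H by (simp add: field_simps)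
    qed
    have "mass u \<le> (LINT x|lebesgue. (\<Sum>Q\<in>\<Q>. indicator Q x * (u x)\<^sup>2))"
      unfolding mass_def
    proof (intro integral_mono_AE)
      show "integrable lebesgue (\<lambda>x. (u x)\<^sup>2)" using u by (simp add: X_space_iff)
      show "integrable lebesgue (\<lambda>x. \<Sum>Q\<in>\<Q>. indicator Q x * (u x)\<^sup>2)"
        by (intro Bochner_Integration.integrable_sum square_integrable_on[OF u Qm])
      have "AE x in lebesgue. x \<notin> \<Omega> \<longrightarrow> u x = 0" using u by (simp add: X_space_iff)
      then show "AE x in lebesgue. (u x)\<^sup>2 \<le> (\<Sum>Q\<in>\<Q>. indicator Q x * (u x)\<^sup>2)"
      proof eventually_elim
        case (elim x)
        show ?case
        proof (cases "x \<in> \<Omega>")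
          case True
          then obtain A where A: "A \<in> \<Q>" "x \<in> A" using cover by auto
          have "(u x)\<^sup>2 = indicator A x * (u x)\<^sup>2" using A by simp
          also have "\<dots> \<le> (\<Sum>Q\<in>\<Q>. indicator Q x * (u x)\<^sup>2)"
            using A fin by (intro member_le_sum) auto
          finally show ?thesis .
        qed (use elim in simp)
      qed
    qed
    also have "\<dots> = (\<Sum>Q\<in>\<Q>. S Q)"
      unfolding S_def by (intro Bochner_Integration.integral_sum square_integrable_on[OF u Qm])
    also have "\<dots> \<le> (\<Sum>Q\<in>\<Q>. (m Q)\<^sup>2 / H + \<epsilon> * J Q)"
      by (intro sum_mono SQ)
    also have "\<dots> = \<epsilon> * (\<Sum>Q\<in>\<Q>. J Q) + 1 / H * (\<Sum>Q\<in>\<Q>. (m Q)\<^sup>2)"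
      by (simp add: sum.distrib sum_distrib_left)
    also have "(\<Sum>Q\<in>\<Q>. J Q) \<le> K_inner K u u"
    proof -
      have "(\<Sum>Q\<in>\<Q>. J Q) = (LINT z|lebesgue. (\<Sum>Q\<in>\<Q>. indicator Q (fst z) * indicator Q (snd z) * ((increment u z)\<^sup>2 * kernel_at K z)))"
        unfolding J_def by (intro Bochner_Integration.integral_sum[symmetric] J)
      also have "\<dots> \<le> (LINT z|lebesgue. (increment u z)\<^sup>2 * kernel_at K z)"
      proof (intro integral_mono Bochner_Integration.integrable_sum J)
        show "integrable lebesgue (\<lambda>z. (increment u z)\<^sup>2 * kernel_at K z)"
          using u by (simp add: X_space_iff)
        fix z :: "'a \<times> 'a"
        have "(\<Sum>Q\<in>\<Q>. indicat_real Q (fst z) * indicator Q (snd z)) \<le> (\<Sum>Q\<in>\<Q>. indicat_real Q (fst z))"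
          by (intro sum_mono) (auto simp: indicator_def)
        also have "\<dots> \<le> 1" by (rule one)
        finally have "(\<Sum>Q\<in>\<Q>. indicat_real Q (fst z) * indicator Q (snd z)) * ((increment u z)\<^sup>2 * kernel_at K z)
          \<le> 1 * ((increment u z)\<^sup>2 * kernel_at K z)"
          by (intro mult_right_mono increment_kernel_nonneg)
        then show "(\<Sum>Q\<in>\<Q>. indicator Q (fst z) * indicator Q (snd z) * ((increment u z)\<^sup>2 * kernel_at K z))
          \<le> (increment u z)\<^sup>2 * kernel_at K z" by (simp add: sum_distrib_right)
      qed
      also have "\<dots> = K_inner K u u" by (simp add: K_inner_eq power2_eq_square)
      finally show ?thesis .
    qed
    finally show "mass u \<le> \<epsilon> * K_inner K u u + 1 / H * (\<Sum>Q\<in>\<Q>. (LINT x|lebesgue. indicator Q x * u x)\<^sup>2)"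
      using assms by (simp add: m_def)
  qed
qed

end

section \<open>Compactness of the unit ball\<close>

text \<open>
  Fatou's lemma for nonnegative integrable functions, in the form needed three times below: for the
  square of a limit, for its energy and for its distance to the sequence.
\<close>

lemma Fatou_integral_le:
  fixes g :: "nat \<Rightarrow> 'b \<Rightarrow> real"
  assumes g: "\<And>n. integrable M (g n)" "\<And>n x. 0 \<le> g n x" and le: "\<And>n. n \<ge> N \<Longrightarrow> integral\<^sup>L M (g n) \<le> B"
    and h: "h \<in> borel_measurable M" and lim: "AE x in M. (\<lambda>n. g n x) \<longlonglongrightarrow> h x"
  shows "integrable M h" and "integral\<^sup>L M h \<le> B"
proof -
  have h0: "AE x in M. 0 \<le> h x"
    using lim by eventually_elim (use g(2) in \<open>auto intro: LIMSEQ_le_const\<close>)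
  have nn: "(\<integral>\<^sup>+x. ennreal (g n x) \<partial>M) = ennreal (integral\<^sup>L M (g n))" for n
    using g by (intro nn_integral_eq_integral) auto
  have "(\<integral>\<^sup>+x. ennreal (h x) \<partial>M) = (\<integral>\<^sup>+x. liminf (\<lambda>n. ennreal (g n x)) \<partial>M)"
  proof (rule nn_integral_cong_AE)
    show "AE x in M. ennreal (h x) = liminf (\<lambda>n. ennreal (g n x))"
      using lim by eventually_elim (intro lim_imp_Liminf[symmetric] tendsto_ennrealI sequentially_bot)
  qed
  also have "\<dots> \<le> liminf (\<lambda>n. \<integral>\<^sup>+x. ennreal (g n x) \<partial>M)"
    using borel_measurable_integrable[OF g(1)] by (intro nn_integral_liminf) simp
  also have "\<dots> \<le> ennreal B"
  proof -
    have "\<forall>\<^sub>F n in sequentially. (\<integral>\<^sup>+x. ennreal (g n x) \<partial>M) \<le> ennreal B"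
      using le by (intro eventually_sequentiallyI[of N])
        (auto simp: nn intro: ennreal_leI)
    then show ?thesis by (intro Liminf_le) auto
  qed
  finally have fin: "(\<integral>\<^sup>+x. ennreal (h x) \<partial>M) \<le> ennreal B" .
  show int: "integrable M h"
    using h h0 fin by (intro integrableI_nonneg) (auto simp: le_less_trans)
  have "0 \<le> integral\<^sup>L M (g N)" using g by (intro integral_nonneg_AE) auto
  then have "0 \<le> B" using le[of N] by simp
  then show "integral\<^sup>L M h \<le> B"
    using fin nn_integral_eq_integral[OF int h0] by simp
qed

context bounded_domain_kernel
begin

lemma integral_norm_le_mass:
  assumes u: "u \<in> X" and "\<eta> > 0"
  shows "integrable lebesgue u" "(LINT x|lebesgue. norm (u x)) \<le> \<eta> * measure lebesgue \<Omega> + mass u / \<eta>"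
proof -
  have um: "u \<in> borel_measurable lebesgue" and z: "AE x in lebesgue. x \<notin> \<Omega> \<longrightarrow> u x = 0"
    and u2: "integrable lebesgue (\<lambda>x. (u x)\<^sup>2)"
    using u by (auto simp: X_space_iff)
  have int: "integrable lebesgue (\<lambda>x. \<eta> * indicat_real \<Omega> x + (u x)\<^sup>2 / \<eta>)"
    using u2 square_integrable_on(3)[OF u, of \<Omega>] by auto
  have le: "AE x in lebesgue. norm (u x) \<le> \<eta> * indicat_real \<Omega> x + (u x)\<^sup>2 / \<eta>"
    using z
  proof eventually_elim
    case (elim x)
    have "\<bar>u x\<bar> \<le> \<eta> + (u x)\<^sup>2 / \<eta>"
    proof -
      have "\<eta> * \<bar>u x\<bar> \<le> \<eta>\<^sup>2 + (u x)\<^sup>2"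
        using abs_mult_le_sum_squares[of \<eta> "u x"] \<open>\<eta> > 0\<close> by (simp add: abs_mult)
      then show ?thesis using \<open>\<eta> > 0\<close> by (simp add: field_simps power2_eq_square)
    qed
    then show ?case using elim by (auto simp: indicator_def)
  qed
  show i: "integrable lebesgue u"
    using int um by (rule Bochner_Integration.integrable_bound) (use le in eventually_elim, auto)
  have "(LINT x|lebesgue. norm (u x)) \<le> (LINT x|lebesgue. \<eta> * indicat_real \<Omega> x + (u x)\<^sup>2 / \<eta>)"
    using i by (intro integral_mono_AE int le) auto
  also have "\<dots> = \<eta> * measure lebesgue \<Omega> + mass u / \<eta>"
    using u2 square_integrable_on(3)[OF u, of \<Omega>] by (simp add: mass_def)
  finally show "(LINT x|lebesgue. norm (u x)) \<le> \<eta> * measure lebesgue \<Omega> + mass u / \<eta>" .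
qed

text \<open>
  Each of the countably many averages is bounded along the sequence, so a diagonal subsequence makes all
  of them converge.
\<close>

lemma mean_subsequence:
  fixes u :: "nat \<Rightarrow> 'a \<Rightarrow> real"
  assumes u: "\<And>n. u n \<in> X" and bnd: "\<And>n. K_inner K (u n) (u n) \<le> 1"
    and U: "countable U" "\<And>Q. Q \<in> U \<Longrightarrow> Q \<in> lmeasurable"
  obtains d where "strict_mono (d :: nat \<Rightarrow> nat)"
    "\<And>Q. Q \<in> U \<Longrightarrow> convergent (\<lambda>n. LINT x|lebesgue. indicator Q x * u (d n) x)"
proof -
  \<comment> \<open>The empty set is added because an enumeration needs a nonempty set.\<close>
  define q where "q j = from_nat_into (insert {} U) j" for j
  have q: "q j \<in> lmeasurable" for j
    using from_nat_into[of "insert {} U" j] U by (auto simp: q_def)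
  define f where "f j n = (LINT x|lebesgue. indicator (q j) x * u n x)" for j n
  obtain C where C: "C \<ge> 0" "\<And>u. u \<in> X \<Longrightarrow> mass u \<le> C * K_inner K u u" by (rule Poincare) blast
  have "(f j n)\<^sup>2 \<le> measure lebesgue (q j) * C" for j n
  proof -
    have "(f j n)\<^sup>2 \<le> measure lebesgue (q j) * (LINT x|lebesgue. indicator (q j) x * (u n x)\<^sup>2)"
      unfolding f_def by (rule mean_square_le[OF u q])
    also have "(LINT x|lebesgue. indicator (q j) x * (u n x)\<^sup>2) \<le> mass (u n)"
      unfolding mass_def using square_integrable_on(2)[OF u q] u[of n]
      by (intro integral_mono) (auto simp: X_space_iff indicator_def)
    also have "mass (u n) \<le> C * K_inner K (u n) (u n)" using C u by blast
    also have "\<dots> \<le> C * 1" using C bnd by (intro mult_left_mono) auto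
    finally show ?thesis by (simp add: mult_left_mono)
  qed
  then have fb: "\<bar>f j n\<bar> \<le> sqrt (measure lebesgue (q j) * C)" for j n
    by (metis real_sqrt_abs real_sqrt_le_mono)
  interpret subseqs "\<lambda>j s. convergent (\<lambda>n. f j (s n))"
  proof
    fix j and s :: "nat \<Rightarrow> nat"
    have "bounded (range (\<lambda>n. f j (s n)))"
      using fb by (intro boundedI[of _ "sqrt (measure lebesgue (q j) * C)"]) auto
    then obtain l r where "strict_mono r" "((\<lambda>n. f j (s n)) \<circ> r) \<longlonglongrightarrow> l"
      using bounded_imp_convergent_subsequence by blast
    then show "\<exists>r'. strict_mono r' \<and> convergent (\<lambda>n. f j ((s \<circ> r') n))"
      by (intro exI[of _ r]) (auto simp: convergent_def comp_def)
  qed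
  show thesis
  proof (rule that[OF subseq_diagseq])
    fix Q assume "Q \<in> U"
    then obtain j where j: "Q = q j"
      using U from_nat_into_surj[of "insert {} U" Q] by (auto simp: q_def)
    have "convergent (\<lambda>n. f j ((diagseq \<circ> (+) (Suc j)) n))"
    proof (rule diagseq_holds)
      fix r s :: "nat \<Rightarrow> nat" and i
      assume "strict_mono r" "convergent (\<lambda>n. f i (s n))"
      then show "convergent (\<lambda>n. f i ((s \<circ> r) n))"
        using convergent_subseq_convergent[of "\<lambda>n. f i (s n)" r] by (simp add: comp_def)
    qed
    then have "convergent (\<lambda>n. f j (diagseq (n + Suc j)))" by (simp add: comp_def add.commute)
    then have "convergent (\<lambda>n. f j (diagseq n))"
      by (simp only: convergent_ignore_initial_segment[of "\<lambda>n. f j (diagseq n)"])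
    then show "convergent (\<lambda>n. LINT x|lebesgue. indicator Q x * u (diagseq n) x)"
      by (simp add: f_def j)
  qed
qed

lemma K_inner_diff_le:
  assumes "u \<in> X" "v \<in> X" "K_inner K u u \<le> 1" "K_inner K v v \<le> 1"
  shows "K_inner K (\<lambda>x. u x - v x) (\<lambda>x. u x - v x) \<le> 4"
proof -
  have "K_inner K (\<lambda>x. 1 * u x + 1 * v x) (\<lambda>x. 1 * u x + 1 * v x) \<ge> 0" by (rule K_inner_nonneg)
  then show ?thesis
    using K.comb_square[OF assms(1,2), of 1 1] K.comb_square[OF assms(1,2), of 1 "-1"] assms(3,4)
    by simp
qed

text \<open>
  Once all cell averages converge, \<open>grid_Poincare\<close> bounds the mass of differences by a small multiple of
  the energy, which is at most \<open>4\<close>, plus a term that tends to zero.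
\<close>

lemma mass_Cauchy_subsequence:
  fixes u :: "nat \<Rightarrow> 'a \<Rightarrow> real"
  assumes u: "\<And>n. u n \<in> X" and bnd: "\<And>n. K_inner K (u n) (u n) \<le> 1"
  obtains d where "strict_mono (d :: nat \<Rightarrow> nat)"
    "\<And>\<epsilon>. \<epsilon> > 0 \<Longrightarrow> \<exists>N. \<forall>n\<ge>N. \<forall>m\<ge>N. mass (\<lambda>x. u (d n) x - u (d m) x) < \<epsilon>"
proof -
  define P where "P k \<Q> C \<longleftrightarrow> finite \<Q> \<and> C \<ge> 0 \<and> (\<forall>Q\<in>\<Q>. Q \<in> lmeasurable) \<and>
    (\<forall>u\<in>X. mass u \<le> (1 / real (Suc k)) * K_inner K u u + C * (\<Sum>Q\<in>\<Q>. (LINT x|lebesgue. indicator Q x * u x)\<^sup>2))"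
    for k \<Q> C
  have "\<exists>\<Q> C. P k \<Q> C" for k
    unfolding P_def by (rule grid_Poincare) simp
  then obtain \<Q> C where P: "\<And>k. P k (\<Q> k) (C k)" by metis
  have QC: "finite (\<Q> k)" "0 \<le> C k" "Q \<in> \<Q> k \<Longrightarrow> Q \<in> lmeasurable"
    "u \<in> X \<Longrightarrow> mass u \<le> (1 / real (Suc k)) * K_inner K u u
       + C k * (\<Sum>Q\<in>\<Q> k. (LINT x|lebesgue. indicator Q x * u x)\<^sup>2)" for k Q u
    using P[of k] unfolding P_def by blast+
  obtain d where d: "strict_mono (d :: nat \<Rightarrow> nat)"
    "\<And>Q. Q \<in> (\<Union>k. \<Q> k) \<Longrightarrow> convergent (\<lambda>n. LINT x|lebesgue. indicator Q x * u (d n) x)"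
  proof (rule mean_subsequence[where u=u, OF u bnd, of "\<Union>k. \<Q> k"])
    show "countable (\<Union>k. \<Q> k)" using countable_finite[OF QC(1)] by simp
  qed (use QC(3) in auto)
  define f where "f Q n = (LINT x|lebesgue. indicator Q x * u (d n) x)" for Q n
  define l where "l Q = lim (f Q)" for Q
  have lim: "f Q \<longlonglongrightarrow> l Q" if "Q \<in> \<Q> k" for Q k
    using d(2)[of Q] that unfolding l_def f_def[abs_def] convergent_LIMSEQ_iff by blast
  show thesis
  proof (rule that[OF d(1)])
    fix \<epsilon> :: real assume "\<epsilon> > 0"
    then obtain k where k: "1 / real (Suc k) < \<epsilon> / 8"
      using nat_approx_posE[of "\<epsilon> / 8"] by auto
    define G where "G n = C k * (\<Sum>Q\<in>\<Q> k. 2 * (f Q n - l Q)\<^sup>2)" for n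
    have "G \<longlonglongrightarrow> C k * (\<Sum>Q\<in>\<Q> k. 2 * (l Q - l Q)\<^sup>2)"
      unfolding G_def by (intro tendsto_intros lim)
    then have "G \<longlonglongrightarrow> 0" by simp
    then obtain N where N: "\<And>n. n \<ge> N \<Longrightarrow> G n < \<epsilon> / 4"
      using order_tendstoD(2)[of G 0 sequentially "\<epsilon> / 4"] \<open>\<epsilon> > 0\<close> by (auto simp: eventually_sequentially)
    show "\<exists>N. \<forall>n\<ge>N. \<forall>m\<ge>N. mass (\<lambda>x. u (d n) x - u (d m) x) < \<epsilon>"
    proof (intro exI[of _ N] allI impI)
      fix n m assume nm: "n \<ge> N" "m \<ge> N"
      define v where "v x = u (d n) x - u (d m) x" for x
      have v: "v \<in> X" unfolding v_def[abs_def] by (intro diff_mem u)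
      have "(LINT x|lebesgue. indicator Q x * v x)\<^sup>2 \<le> 2 * (f Q n - l Q)\<^sup>2 + 2 * (f Q m - l Q)\<^sup>2" if "Q \<in> \<Q> k" for Q
      proof -
        have "(LINT x|lebesgue. indicator Q x * v x) = f Q n - f Q m"
          unfolding v_def f_def right_diff_distrib
          by (intro Bochner_Integration.integral_diff square_integrable_on(1)[OF u QC(3)[OF that]])
        moreover have "(f Q n - f Q m)\<^sup>2 \<le> 2 * (f Q n - l Q)\<^sup>2 + 2 * (f Q m - l Q)\<^sup>2"
          using zero_le_power2[of "(f Q n - l Q) + (f Q m - l Q)"]
          by (simp add: power2_eq_square algebra_simps)
        ultimately show ?thesis by simp
      qed
      then have "C k * (\<Sum>Q\<in>\<Q> k. (LINT x|lebesgue. indicator Q x * v x)\<^sup>2)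
         \<le> C k * (\<Sum>Q\<in>\<Q> k. 2 * (f Q n - l Q)\<^sup>2 + 2 * (f Q m - l Q)\<^sup>2)"
        using QC(2) by (intro mult_left_mono sum_mono) auto
      also have "\<dots> = G n + G m" by (simp add: G_def sum.distrib distrib_left)
      finally have "mass v \<le> (1 / real (Suc k)) * K_inner K v v + (G n + G m)"
        using QC(4)[OF v, of k] by linarith
      also have "(1 / real (Suc k)) * K_inner K v v \<le> (\<epsilon> / 8) * 4"
        using k K_inner_nonneg[of v] K_inner_diff_le[OF u u bnd bnd, of "d n" "d m"]
          \<open>\<epsilon> > 0\<close>
        unfolding v_def[abs_def] by (intro mult_mono) auto
      finally show "mass (\<lambda>x. u (d n) x - u (d m) x) < \<epsilon>"
        using N[OF nm(1)] N[OF nm(2)] \<open>\<epsilon> > 0\<close> by (simp add: v_def[abs_def])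
    qed
  qed
qed

text \<open>
  A sequence that is Cauchy in \<open>L\<^sup>2\<close> is Cauchy in \<open>L\<^sup>1\<close>, because all functions vanish outside the bounded
  set \<open>\<Omega>\<close>, and so has a subsequence that converges almost everywhere. Fatou's lemma places the
  limit in the unit ball of the energy and shows that the convergence holds in \<open>L\<^sup>2\<close>.
\<close>

lemma closed_unit_ball_compact:
  fixes u :: "nat \<Rightarrow> 'a \<Rightarrow> real"
  assumes u: "\<And>n. u n \<in> X" and bnd: "\<And>n. K_inner K (u n) (u n) \<le> 1"
  obtains w r where "w \<in> X" "K_inner K w w \<le> 1" "strict_mono (r :: nat \<Rightarrow> nat)"
    "(\<lambda>n. mass (\<lambda>x. u (r n) x - w x)) \<longlonglongrightarrow> 0"
proof -
  obtain d where d: "strict_mono (d :: nat \<Rightarrow> nat)"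
    "\<And>\<epsilon>. \<epsilon> > 0 \<Longrightarrow> \<exists>N. \<forall>n\<ge>N. \<forall>m\<ge>N. mass (\<lambda>x. u (d n) x - u (d m) x) < \<epsilon>"
    by (rule mass_Cauchy_subsequence[where u=u, OF u bnd]) blast
  have L1: "\<exists>N. \<forall>i\<ge>N. \<forall>j\<ge>N. (LINT x|lebesgue. norm (u (d i) x - u (d j) x)) < e" if "e > 0" for e
  proof -
    define m where "m = measure lebesgue \<Omega>"
    have m: "m \<ge> 0" by (simp add: m_def)
    \<comment> \<open>The term \<open>\<eta> * |\<Omega>|\<close> uses up half of \<open>e\<close>; a small mass takes care of the other half.\<close>
    define \<eta> where "\<eta> = e / (2 * (m + 1))"
    have \<eta>: "\<eta> > 0" using that m by (simp add: \<eta>_def)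
    have \<eta>m: "\<eta> * m \<le> e / 2" using that m by (simp add: \<eta>_def field_simps)
    have "\<eta> * e / 2 > 0" using \<eta> that by simp
    from d(2)[OF this] obtain N where
      N: "\<forall>n\<ge>N. \<forall>k\<ge>N. mass (\<lambda>x. u (d n) x - u (d k) x) < \<eta> * e / 2" by blast
    show ?thesis
    proof (intro exI[of _ N] allI impI)
      fix i j assume ij: "i \<ge> N" "j \<ge> N"
      have "mass (\<lambda>x. u (d i) x - u (d j) x) / \<eta> < e / 2"
        using N[rule_format, OF ij] \<eta> by (simp add: field_simps)
      then show "(LINT x|lebesgue. norm (u (d i) x - u (d j) x)) < e"
        using integral_norm_le_mass(2)[OF diff_mem[OF u u] \<eta>, of "d i" "d j"] \<eta>m
        unfolding m_def by linarith
    qed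
  qed
  obtain r where r: "strict_mono r" "AE x in lebesgue. Cauchy (\<lambda>i. u (d (r i)) x)"
    by (rule cauchy_L1_AE_cauchy_subseq[of lebesgue "\<lambda>n. u (d n)"])
      (use L1 integral_norm_le_mass(1)[OF u, of 1] in \<open>auto\<close>)
  define t where "t n = u (d (r n))" for n
  define w where "w x = lim (\<lambda>n. t n x)" for x
  have t: "t n \<in> X" "K_inner K (t n) (t n) \<le> 1" for n using u bnd by (auto simp: t_def)
  have tm: "t n \<in> borel_measurable lebesgue" for n using t(1)[of n] by (simp add: X_space_iff)
  have wm: "w \<in> borel_measurable lebesgue"
    unfolding w_def[abs_def] by (rule borel_measurable_lim_metric[OF tm])
  have lim: "AE x in lebesgue. (\<lambda>n. t n x) \<longlonglongrightarrow> w x"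
    using r(2) by eventually_elim (simp add: w_def t_def Cauchy_convergent_iff convergent_LIMSEQ_iff)
  have Cau: "\<exists>N. \<forall>n\<ge>N. \<forall>m\<ge>N. mass (\<lambda>x. t n x - t m x) < \<epsilon>" if "\<epsilon> > 0" for \<epsilon>
  proof -
    obtain N where N: "\<forall>n\<ge>N. \<forall>m\<ge>N. mass (\<lambda>x. u (d n) x - u (d m) x) < \<epsilon>" using d(2)[OF \<open>\<epsilon> > 0\<close>] by blast
    have "r n \<ge> n" for n using r(1) by (rule seq_suble)
    then show ?thesis using N by (intro exI[of _ N]) (auto simp: t_def intro: order_trans)
  qed
  obtain C where C: "C \<ge> 0" "\<And>u. u \<in> X \<Longrightarrow> mass u \<le> C * K_inner K u u" by (rule Poincare) blast
  have mC: "mass (t n) \<le> C" for n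
    using C(2)[OF t(1)[of n]] mult_left_mono[OF t(2)[of n] C(1)] by simp
  have w2: "integrable lebesgue (\<lambda>x. (w x)\<^sup>2)"
  proof (rule Fatou_integral_le(1)[where g="\<lambda>n x. (t n x)\<^sup>2" and B=C and N=0])
    show "AE x in lebesgue. (\<lambda>n. (t n x)\<^sup>2) \<longlonglongrightarrow> (w x)\<^sup>2"
      using lim by eventually_elim (rule tendsto_power)
  qed (use t(1) mC wm in \<open>auto simp: X_space_iff mass_def\<close>)
  have "(\<lambda>z. (increment w z)\<^sup>2 * kernel_at K z) \<in> borel_measurable lebesgue"
    using measurable_increment[OF wm] kernel_at_measurable by (intro borel_measurable_times borel_measurable_power)
  moreover have "AE z in lebesgue. (\<lambda>n. (increment (t n) z)\<^sup>2 * kernel_at K z) \<longlonglongrightarrow> (increment w z)\<^sup>2 * kernel_at K z"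
    using AE_lebesgue_fst[OF lim] AE_lebesgue_snd[OF lim]
    by eventually_elim (unfold increment_def, intro tendsto_intros)
  ultimately have w3: "integrable lebesgue (\<lambda>z. (increment w z)\<^sup>2 * kernel_at K z)"
    and w4: "(LINT z|lebesgue. (increment w z)\<^sup>2 * kernel_at K z) \<le> 1"
    using Fatou_integral_le[where M=lebesgue and g="\<lambda>n z. (increment (t n) z)\<^sup>2 * kernel_at K z" and B=1 and N=0
        and h="\<lambda>z. (increment w z)\<^sup>2 * kernel_at K z"] t increment_kernel_nonneg
    by (auto simp: X_space_iff K_inner_eq power2_eq_square)
  have "AE x in lebesgue. \<forall>n. x \<notin> \<Omega> \<longrightarrow> t n x = 0"
    using t(1) by (intro AE_all_countable[THEN iffD2]) (auto simp: X_space_iff)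
  then have w5: "AE x in lebesgue. x \<notin> \<Omega> \<longrightarrow> w x = 0"
    using lim by eventually_elim (auto simp: LIMSEQ_const_iff)
  have wX: "w \<in> X" using wm w2 w3 w5 by (simp add: X_space_iff)
  show thesis
  proof (rule that[OF wX])
    show "K_inner K w w \<le> 1" using w4 by (simp add: K_inner_eq power2_eq_square)
    show "strict_mono (d \<circ> r)" using d(1) r(1) by (rule strict_mono_o)
    show "(\<lambda>n. mass (\<lambda>x. u ((d \<circ> r) n) x - w x)) \<longlonglongrightarrow> 0"
    proof (rule LIMSEQ_I)
      fix \<epsilon> :: real assume "\<epsilon> > 0"
      then obtain N where N: "\<And>n m. n \<ge> N \<Longrightarrow> m \<ge> N \<Longrightarrow> mass (\<lambda>x. t n x - t m x) < \<epsilon> / 2"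
        using Cau[of "\<epsilon> / 2"] by auto
      have "mass (\<lambda>x. t n x - w x) \<le> \<epsilon> / 2" if "n \<ge> N" for n
        unfolding mass_def
      proof (rule Fatou_integral_le(2)[where g="\<lambda>m x. (t n x - t m x)\<^sup>2" and N=N])
        show "integrable lebesgue (\<lambda>x. (t n x - t m x)\<^sup>2)" for m
          using diff_mem[OF t(1) t(1), of n m] by (simp add: X_space_iff)
        show "integral\<^sup>L lebesgue (\<lambda>x. (t n x - t m x)\<^sup>2) \<le> \<epsilon> / 2" if "m \<ge> N" for m
          using N[OF \<open>n \<ge> N\<close> that] by (simp add: mass_def)
        show "(\<lambda>x. (t n x - w x)\<^sup>2) \<in> borel_measurable lebesgue"
          using tm wm by (intro borel_measurable_power borel_measurable_diff)
        show "AE x in lebesgue. (\<lambda>m. (t n x - t m x)\<^sup>2) \<longlonglongrightarrow> (t n x - w x)\<^sup>2"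
          using lim by eventually_elim (intro tendsto_intros)
      qed auto
      then show "\<exists>N. \<forall>n\<ge>N. norm (mass (\<lambda>x. u ((d \<circ> r) n) x - w x) - 0) < \<epsilon>"
        using \<open>\<epsilon> > 0\<close> mass_nonneg by (intro exI[of _ N]) (fastforce simp: t_def)
    qed
  qed
qed

end

section \<open>The form of a bounded weight\<close>

definition weight_pairing ::
  "'a::euclidean_space set \<Rightarrow> ('a \<Rightarrow> real) \<Rightarrow> ('a \<Rightarrow> real) \<Rightarrow> ('a \<Rightarrow> real) \<Rightarrow> real" where
  "weight_pairing \<Omega> \<rho> u v = (LINT x|lebesgue_on \<Omega>. \<rho> x * u x * v x)"

lemma weight_form_eq: "weight_form \<Omega> \<rho> u = weight_pairing \<Omega> \<rho> u u"
  by (simp add: weight_form_def weight_pairing_def power2_eq_square mult.assoc)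

context bounded_domain_kernel
begin

lemma kernel_cutoff_even: "min ((norm z)\<^sup>2) 1 * K (- z) = min ((norm z)\<^sup>2) 1 * K z"
  using admissible by (cases "z = 0") (auto simp: admissible_kernel_def)

text \<open>
  The squared increment of \<open>\<phi>\<close> is bounded by a multiple of \<open>min (norm (x - y))\<^sup>2 1\<close>, the cutoff that makes
  the kernel integrable, and it vanishes unless \<open>x\<close> or \<open>y\<close> lies in the bounded set \<open>\<Omega>\<close>. The energy density is
  therefore dominated by two convolution integrands.
\<close>

lemma Lipschitz_in_X_space:
  fixes \<phi> :: "'a \<Rightarrow> real"
  assumes lip: "L-lipschitz_on UNIV \<phi>" and range: "\<And>x. 0 \<le> \<phi> x \<and> \<phi> x \<le> 1"
    and supp: "\<And>x. x \<notin> \<Omega> \<Longrightarrow> \<phi> x = 0"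
  shows "\<phi> \<in> X"
proof -
  have "continuous_on UNIV \<phi>" using lip by (rule lipschitz_on_continuous_on)
  then have "\<phi> \<in> borel_measurable borel" by (rule borel_measurable_continuous_onI)
  then have m: "\<phi> \<in> borel_measurable lebesgue" by (intro measurable_completion) simp
  have iO: "integrable lebesgue (indicat_real \<Omega>)"
    using domain_sets(2) by (simp add: fmeasurable_def)
  have sq: "integrable lebesgue (\<lambda>x. (\<phi> x)\<^sup>2)"
  proof (rule Bochner_Integration.integrable_bound[OF iO])
    have "(\<phi> x)\<^sup>2 \<le> 1" for x using range[of x] by (simp add: power_le_one)
    then show "AE x in lebesgue. norm ((\<phi> x)\<^sup>2) \<le> norm (indicat_real \<Omega> x)"
      using supp by (intro AE_I2) (auto simp: indicator_def)
  qed (use m in measurable)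
  define k where "k z = min ((norm z)\<^sup>2) 1 * K z" for z
  have k: "integrable lebesgue k" using admissible by (simp add: admissible_kernel_def k_def[abs_def])
  have k_sym: "k (x - y) = k (y - x)" for x y
    using kernel_cutoff_even[of "y - x"] by (simp add: k_def norm_minus_commute)
  have i1: "integrable lebesgue (\<lambda>z::'a \<times> 'a. indicat_real \<Omega> (fst z) * k (fst z - snd z))"
    by (rule integrable_lebesgue_convolution[OF iO k])
  have i2: "integrable lebesgue (\<lambda>z::'a \<times> 'a. indicat_real \<Omega> (snd z) * k (fst z - snd z))"
    using integrable_lebesgue_swap[OF i1] k_sym by simp
  \<comment> \<open>The summand \<open>L\<^sup>2\<close> serves points at distance below \<open>1\<close>, the summand \<open>1\<close> all the others.\<close>
  define M where "M = L\<^sup>2 + 1"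
  have inc: "(increment \<phi> z)\<^sup>2 \<le> M * min ((norm (fst z - snd z))\<^sup>2) 1" for z
  proof -
    have "\<bar>increment \<phi> z\<bar> \<le> L * norm (fst z - snd z)"
      using lipschitz_onD[OF lip, of "fst z" "snd z"] by (simp add: increment_def dist_norm)
    then have "(increment \<phi> z)\<^sup>2 \<le> (L * norm (fst z - snd z))\<^sup>2"
      by (metis abs_ge_zero power2_abs power_mono)
    then have 1: "(increment \<phi> z)\<^sup>2 \<le> M * (norm (fst z - snd z))\<^sup>2"
      unfolding M_def by (simp add: power_mult_distrib distrib_right add_increasing2)
    have "\<bar>increment \<phi> z\<bar> \<le> 1" using range[of "fst z"] range[of "snd z"] by (simp add: increment_def abs_le_iff)
    then have "(increment \<phi> z)\<^sup>2 \<le> 1" by (simp add: abs_square_le_1)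
    also have "1 \<le> M * 1" by (simp add: M_def)
    finally show ?thesis using 1 by (simp add: min_def)
  qed
  have "integrable lebesgue (\<lambda>z. (increment \<phi> z)\<^sup>2 * kernel_at K z)"
  proof (rule Bochner_Integration.integrable_bound)
    show "integrable lebesgue (\<lambda>z. M * (indicat_real \<Omega> (fst z) * k (fst z - snd z) + indicat_real \<Omega> (snd z) * k (fst z - snd z)))"
      using i1 i2 by auto
    show "(\<lambda>z. (increment \<phi> z)\<^sup>2 * kernel_at K z) \<in> borel_measurable lebesgue"
      using measurable_increment[OF m] kernel_at_measurable by (intro borel_measurable_times borel_measurable_power)
    show "AE z in lebesgue. norm ((increment \<phi> z)\<^sup>2 * kernel_at K z) \<le>
      norm (M * (indicat_real \<Omega> (fst z) * k (fst z - snd z) + indicat_real \<Omega> (snd z) * k (fst z - snd z)))"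
    proof (rule AE_I2)
      fix z :: "'a \<times> 'a"
      show "norm ((increment \<phi> z)\<^sup>2 * kernel_at K z) \<le>
        norm (M * (indicat_real \<Omega> (fst z) * k (fst z - snd z) + indicat_real \<Omega> (snd z) * k (fst z - snd z)))"
      proof (cases "fst z \<noteq> snd z \<and> (fst z \<in> \<Omega> \<or> snd z \<in> \<Omega>)")
        case True
        then have K0: "0 < K (fst z - snd z)" using admissible by (simp add: admissible_kernel_def)
        then have k0: "0 \<le> k (fst z - snd z)" by (simp add: k_def)
        have M0: "M \<ge> 0" by (simp add: M_def)
        have "(increment \<phi> z)\<^sup>2 * kernel_at K z \<le> M * min ((norm (fst z - snd z))\<^sup>2) 1 * K (fst z - snd z)"
          unfolding kernel_at_def using K0 by (intro mult_right_mono inc) auto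
        also have "\<dots> = M * (1 * k (fst z - snd z))" by (simp add: k_def)
        also have "\<dots> \<le> M * ((indicat_real \<Omega> (fst z) + indicat_real \<Omega> (snd z)) * k (fst z - snd z))"
          using True k0 M0 by (intro mult_left_mono mult_right_mono) (auto simp: indicator_def)
        finally show ?thesis
          using increment_kernel_nonneg[of \<phi> z] by (simp add: distrib_right)
      qed (auto simp: increment_def supp)
    qed
  qed
  then show ?thesis using m sq supp by (simp add: X_space_iff)
qed

end

locale weighted_domain = bounded_domain_kernel +
  fixes \<rho> :: "'a \<Rightarrow> real"
  assumes weight_bounded: "\<rho> \<in> Linfty \<Omega>"
begin

text \<open>
  Extension of the weight by zero, so that all integrals are taken over the whole space.
\<close>

definition ext_weight :: "'a \<Rightarrow> real" where
  "ext_weight x = indicator \<Omega> x * \<rho> x"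

lemma ext_weight_measurable: "ext_weight \<in> borel_measurable lebesgue"
  using weight_bounded unfolding ext_weight_def[abs_def] Linfty_def
  by (simp add: borel_measurable_restrict_space_iff)

lemma ext_weight_bounded:
  obtains C where "C > 0" "AE x in lebesgue. \<bar>ext_weight x\<bar> \<le> C * indicator \<Omega> x"
proof -
  obtain B where "AE x in lebesgue_on \<Omega>. \<bar>\<rho> x\<bar> \<le> B"
    using weight_bounded by (auto simp: Linfty_def)
  then have "AE x in lebesgue. x \<in> \<Omega> \<longrightarrow> \<bar>\<rho> x\<bar> \<le> B"
    by (subst (asm) AE_restrict_space_iff) auto
  then have "AE x in lebesgue. \<bar>ext_weight x\<bar> \<le> (\<bar>B\<bar> + 1) * indicator \<Omega> x"
    by eventually_elim (auto simp: ext_weight_def indicator_def)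
  then show thesis by (intro that) auto
qed

lemma weight_pairing_eq: "weight_pairing \<Omega> \<rho> u v = (LINT x|lebesgue. ext_weight x * (u x * v x))"
  unfolding weight_pairing_def by (subst integral_restrict_space) (auto simp: ext_weight_def mult.assoc)

lemma weight_pairing_integrable:
  assumes "u \<in> X" "v \<in> X"
  shows "integrable lebesgue (\<lambda>x. ext_weight x * (u x * v x))"
proof -
  obtain C where C: "C > 0" "AE x in lebesgue. \<bar>ext_weight x\<bar> \<le> C * indicator \<Omega> x" by (rule ext_weight_bounded)
  show ?thesis
  proof (rule Bochner_Integration.integrable_bound)
    show "integrable lebesgue (\<lambda>x. C * (u x * v x))" using product_integrable[OF assms] by simp
    show "(\<lambda>x. ext_weight x * (u x * v x)) \<in> borel_measurable lebesgue"
      using ext_weight_measurable assms by (auto simp: X_space_iff)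
    show "AE x in lebesgue. norm (ext_weight x * (u x * v x)) \<le> norm (C * (u x * v x))"
      using C(2)
    proof eventually_elim
      case (elim x)
      have "\<bar>ext_weight x\<bar> \<le> C" using elim C(1) by (cases "x \<in> \<Omega>") auto
      then show ?case using C(1) by (simp add: abs_mult mult_right_mono)
    qed
  qed
qed

text \<open>
  Young's inequality with a free parameter: it lets one factor tend to zero in \<open>L\<^sup>2\<close> while the other is
  kept fixed.
\<close>

lemma weight_pairing_bound:
  obtains C where "C > 0"
    "\<And>u v \<eta>. u \<in> X \<Longrightarrow> v \<in> X \<Longrightarrow> \<eta> > 0 \<Longrightarrow> \<bar>weight_pairing \<Omega> \<rho> u v\<bar> \<le> C * (mass u / \<eta> + \<eta> * mass v)"
proof -
  obtain C where C: "C > 0" "AE x in lebesgue. \<bar>ext_weight x\<bar> \<le> C * indicator \<Omega> x" by (rule ext_weight_bounded)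
  show thesis
  proof (rule that[OF C(1)])
    fix u v and \<eta> :: real assume uv: "u \<in> X" "v \<in> X" and \<eta>: "\<eta> > 0"
    have int: "integrable lebesgue (\<lambda>x. C * ((u x)\<^sup>2 / \<eta> + \<eta> * (v x)\<^sup>2))"
      using uv by (auto simp: X_space_iff)
    have "\<bar>weight_pairing \<Omega> \<rho> u v\<bar> \<le> (LINT x|lebesgue. \<bar>ext_weight x * (u x * v x)\<bar>)"
      unfolding weight_pairing_eq by (rule integral_abs_bound)
    also have "\<dots> \<le> (LINT x|lebesgue. C * ((u x)\<^sup>2 / \<eta> + \<eta> * (v x)\<^sup>2))"
    proof (intro integral_mono_AE int integrable_abs weight_pairing_integrable uv)
      show "AE x in lebesgue. \<bar>ext_weight x * (u x * v x)\<bar> \<le> C * ((u x)\<^sup>2 / \<eta> + \<eta> * (v x)\<^sup>2)"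
        using C(2)
      proof eventually_elim
        case (elim x)
        have w: "\<bar>ext_weight x\<bar> \<le> C" using elim C(1) by (cases "x \<in> \<Omega>") auto
        have "\<bar>u x * v x\<bar> = \<bar>(u x / sqrt \<eta>) * (sqrt \<eta> * v x)\<bar>" using \<eta> by simp
        also have "\<dots> \<le> (u x / sqrt \<eta>)\<^sup>2 + (sqrt \<eta> * v x)\<^sup>2" by (rule abs_mult_le_sum_squares)
        also have "\<dots> = (u x)\<^sup>2 / \<eta> + \<eta> * (v x)\<^sup>2" using \<eta> by (simp add: power_divide power_mult_distrib)
        finally show ?case unfolding abs_mult[of "ext_weight x"] using w C(1) by (intro mult_mono) auto
      qed
    qed
    also have "\<dots> = C * (mass u / \<eta> + \<eta> * mass v)"
      using uv by (simp add: mass_def X_space_iff)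
    finally show "\<bar>weight_pairing \<Omega> \<rho> u v\<bar> \<le> C * (mass u / \<eta> + \<eta> * mass v)" .
  qed
qed

sublocale W: symmetric_form X "weight_pairing \<Omega> \<rho>"
proof
  fix u v w :: "'a \<Rightarrow> real" and p q
  assume X: "u \<in> X" "v \<in> X" "w \<in> X"
  have "ext_weight x * ((p * u x + q * v x) * w x)
     = p * (ext_weight x * (u x * w x)) + q * (ext_weight x * (v x * w x))" for x
    by (simp add: algebra_simps)
  then show "weight_pairing \<Omega> \<rho> (\<lambda>x. p * u x + q * v x) w = p * weight_pairing \<Omega> \<rho> u w + q * weight_pairing \<Omega> \<rho> v w"
    unfolding weight_pairing_eq using weight_pairing_integrable X by simp
qed (simp add: weight_pairing_eq mult.commute)

lemma weight_pairing_tendsto_zero: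
  assumes z: "\<And>n. z n \<in> X" and v: "v \<in> X" and lim: "(\<lambda>n. mass (z n)) \<longlonglongrightarrow> 0"
  shows "(\<lambda>n. weight_pairing \<Omega> \<rho> (z n) v) \<longlonglongrightarrow> 0"
proof (rule LIMSEQ_I)
  fix \<epsilon> :: real assume \<epsilon>: "\<epsilon> > 0"
  obtain C where C: "C > 0"
    "\<And>u v \<eta>. u \<in> X \<Longrightarrow> v \<in> X \<Longrightarrow> \<eta> > 0 \<Longrightarrow> \<bar>weight_pairing \<Omega> \<rho> u v\<bar> \<le> C * (mass u / \<eta> + \<eta> * mass v)"
    by (rule weight_pairing_bound) blast
  \<comment> \<open>With this parameter, the contribution of the fixed factor \<open>v\<close> is at most \<open>\<epsilon> / 2\<close>.\<close>
  define \<eta> where "\<eta> = \<epsilon> / (2 * C * (mass v + 1))"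
  have mv: "0 \<le> mass v" by (rule mass_nonneg)
  have \<eta>: "\<eta> > 0" using \<epsilon> C mv by (simp add: \<eta>_def add_nonneg_pos)
  have "C * \<eta> * mass v \<le> C * \<eta> * (mass v + 1)" using C(1) \<eta> by simp
  also have "\<dots> = \<epsilon> / 2"
  proof -
    have "C * (\<epsilon> / (2 * C * m)) * m = \<epsilon> / 2" if "m \<noteq> 0" for m
      using that C(1) by simp
    moreover have "mass v + 1 \<noteq> 0" using mv by linarith
    ultimately show ?thesis unfolding \<eta>_def by blast
  qed
  finally have 1: "C * (\<eta> * mass v) \<le> \<epsilon> / 2" by (simp add: mult.assoc)
  have "\<epsilon> * \<eta> / (2 * C) > 0" using \<epsilon> \<eta> C by simp
  then obtain N where N: "\<And>n. n \<ge> N \<Longrightarrow> mass (z n) < \<epsilon> * \<eta> / (2 * C)"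
    using order_tendstoD(2)[OF lim] by (auto simp: eventually_sequentially)
  show "\<exists>N. \<forall>n\<ge>N. norm (weight_pairing \<Omega> \<rho> (z n) v - 0) < \<epsilon>"
  proof (intro exI[of _ N] allI impI)
    fix n assume "n \<ge> N"
    have "C * (mass (z n) / \<eta>) < \<epsilon> / 2"
      using N[OF \<open>n \<ge> N\<close>] \<eta> C(1) by (simp add: field_simps)
    then have "C * (mass (z n) / \<eta> + \<eta> * mass v) < \<epsilon>" using 1 unfolding distrib_left by linarith
    then show "norm (weight_pairing \<Omega> \<rho> (z n) v - 0) < \<epsilon>"
      using C(2)[OF z v \<eta>, of n] by simp
  qed
qed

sublocale compact_form_pair X "K_inner K" "weight_pairing \<Omega> \<rho>"
proof
  show "0 \<le> K_inner K u u" for u by (rule K_inner_nonneg)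
  obtain C where C: "C > 0"
    "\<And>u v \<eta>. u \<in> X \<Longrightarrow> v \<in> X \<Longrightarrow> \<eta> > 0 \<Longrightarrow> \<bar>weight_pairing \<Omega> \<rho> u v\<bar> \<le> C * (mass u / \<eta> + \<eta> * mass v)"
    by (rule weight_pairing_bound) blast
  obtain P where P: "P \<ge> 0" "\<And>u. u \<in> X \<Longrightarrow> mass u \<le> P * K_inner K u u" by (rule Poincare) blast
  have "weight_pairing \<Omega> \<rho> u u \<le> (2 * C * P) * K_inner K u u" if "u \<in> X" for u
  proof -
    have "weight_pairing \<Omega> \<rho> u u \<le> (2 * C) * mass u" using C(2)[OF that that, of 1] by simp
    also have "\<dots> \<le> (2 * C) * (P * K_inner K u u)" using C(1) P(2)[OF that] by simp
    finally show ?thesis by (simp add: mult.assoc)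
  qed
  then show "\<exists>C. \<forall>u\<in>X. weight_pairing \<Omega> \<rho> u u \<le> C * K_inner K u u" by blast
  fix u :: "nat \<Rightarrow> 'a \<Rightarrow> real"
  assume u: "\<And>n. u n \<in> X" "\<And>n. K_inner K (u n) (u n) \<le> 1"
  obtain w r where w: "w \<in> X" "K_inner K w w \<le> 1" "strict_mono (r :: nat \<Rightarrow> nat)"
    "(\<lambda>n. mass (\<lambda>x. u (r n) x - w x)) \<longlonglongrightarrow> 0"
    by (rule closed_unit_ball_compact[where u=u, OF u]) blast
  define z where "z n x = u (r n) x - w x" for n x
  have z: "z n \<in> X" for n unfolding z_def[abs_def] by (intro diff_mem u w)
  have mz: "(\<lambda>n. mass (z n)) \<longlonglongrightarrow> 0" using w(4) by (simp add: z_def[abs_def])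
  have zv: "weight_pairing \<Omega> \<rho> (z n) v = weight_pairing \<Omega> \<rho> (u (r n)) v - weight_pairing \<Omega> \<rho> w v"
    if "v \<in> X" for n v
    unfolding z_def[abs_def] by (rule W.diff_left[OF u(1) w(1) that])
  have lin: "(\<lambda>n. weight_pairing \<Omega> \<rho> (u (r n)) v) \<longlonglongrightarrow> weight_pairing \<Omega> \<rho> w v" if "v \<in> X" for v
    using weight_pairing_tendsto_zero[OF z that mz] unfolding zv[OF that] by (rule LIM_zero_cancel)
  have "(\<lambda>n. weight_pairing \<Omega> \<rho> (z n) (z n)) \<longlonglongrightarrow> 0"
  proof (rule Lim_null_comparison)
    show "\<forall>\<^sub>F n in sequentially. norm (weight_pairing \<Omega> \<rho> (z n) (z n)) \<le> 2 * C * mass (z n)"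
    proof (intro always_eventually allI)
      fix n
      show "norm (weight_pairing \<Omega> \<rho> (z n) (z n)) \<le> 2 * C * mass (z n)"
        using C(2)[OF z[of n] z[of n], of 1] by simp
    qed
    show "(\<lambda>n. 2 * C * mass (z n)) \<longlonglongrightarrow> 0" using tendsto_mult_right_zero[OF mz] by simp
  qed
  then have "(\<lambda>n. weight_pairing \<Omega> \<rho> (z n) (z n) + 2 * weight_pairing \<Omega> \<rho> (u (r n)) w - weight_pairing \<Omega> \<rho> w w)
    \<longlonglongrightarrow> 0 + 2 * weight_pairing \<Omega> \<rho> w w - weight_pairing \<Omega> \<rho> w w"
    by (intro tendsto_intros lin w(1))
  moreover have "weight_pairing \<Omega> \<rho> (z n) (z n) + 2 * weight_pairing \<Omega> \<rho> (u (r n)) w - weight_pairing \<Omega> \<rho> w w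
      = weight_pairing \<Omega> \<rho> (u (r n)) (u (r n))" for n
    using W.comb_square[OF u(1)[of "r n"] w(1), of 1 "-1"] by (simp add: z_def[abs_def])
  ultimately have "(\<lambda>n. weight_pairing \<Omega> \<rho> (u (r n)) (u (r n))) \<longlonglongrightarrow> weight_pairing \<Omega> \<rho> w w" by simp
  with w lin show "\<exists>w\<in>X. \<exists>r::nat\<Rightarrow>nat. K_inner K w w \<le> 1 \<and>
      (\<forall>v\<in>X. (\<lambda>n. weight_pairing \<Omega> \<rho> (u (r n)) v) \<longlonglongrightarrow> weight_pairing \<Omega> \<rho> w v) \<and>
      (\<lambda>n. weight_pairing \<Omega> \<rho> (u (r n)) (u (r n))) \<longlonglongrightarrow> weight_pairing \<Omega> \<rho> w w \<and> strict_mono r"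
    by blast
qed

definition positivity_set :: "'a set" where
  "positivity_set = {x \<in> \<Omega>. 0 < \<rho> x}"

lemma positivity_set_measurable: "positivity_set \<in> sets lebesgue"
proof -
  have "positivity_set = {x \<in> space lebesgue. 0 < ext_weight x}"
    by (auto simp: positivity_set_def ext_weight_def indicator_def)
  also have "\<dots> \<in> sets lebesgue" using ext_weight_measurable by measurable
  finally show ?thesis .
qed

lemma ext_weight_integrable: "integrable lebesgue ext_weight"
proof -
  obtain C where C: "C > 0" "AE x in lebesgue. \<bar>ext_weight x\<bar> \<le> C * indicator \<Omega> x" by (rule ext_weight_bounded)
  have "integrable lebesgue (\<lambda>x. C * indicat_real \<Omega> x)"
    using domain_sets(2) by (simp add: fmeasurable_def)
  then show ?thesis
    using ext_weight_measurable
  proof (rule Bochner_Integration.integrable_bound)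
    show "AE x in lebesgue. norm (ext_weight x) \<le> norm (C * indicat_real \<Omega> x)"
      using C(2) by eventually_elim (use C(1) in simp)
  qed
qed

text \<open>
  Choose a compact set \<open>T\<close> of positive measure inside the part of the ball where \<open>\<rho>\<close> is positive. The
  Lipschitz cutoffs \<open>max 0 (1 - n * infdist x T)\<close> decrease to the indicator of \<open>T\<close>, so their weighted
  squares integrate to a positive number for large \<open>n\<close>, when their supports are also inside the ball and \<open>\<Omega>\<close>.
\<close>

lemma bump_exists:
  assumes nn: "\<not> negligible (positivity_set \<inter> ball a r)"
  obtains \<phi> where "\<phi> \<in> X" "\<And>x. x \<notin> ball a r \<Longrightarrow> \<phi> x = 0" "0 < weight_pairing \<Omega> \<rho> \<phi> \<phi>"
proof -
  define P where "P = positivity_set \<inter> ball a r"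
  have P: "P \<in> sets lebesgue" unfolding P_def using positivity_set_measurable by auto
  have bP: "bounded P" unfolding P_def by (auto intro: bounded_Int)
  have Pm: "P \<in> lmeasurable" using bP P by (rule bounded_set_imp_lmeasurable)
  have Ppos: "0 < measure lebesgue P"
    using nn Pm unfolding P_def by (metis negligible_iff_measure zero_less_measure_iff)
  obtain T where T: "closed T" "T \<subseteq> P" "P - T \<in> lmeasurable" "emeasure lebesgue (P - T) < ennreal (measure lebesgue P)"
    using sets_lebesgue_inner_closed[OF P Ppos] by blast
  have cT: "compact T" using T bP by (simp add: bounded_subset compact_eq_bounded_closed)
  have nT: "\<not> negligible T"
  proof
    assume "negligible T"
    then have "measure lebesgue (P - T) = measure lebesgue P"
      using measure_Diff_null_set[of P lebesgue T] P by (simp add: negligible_iff_null_sets)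
    moreover have "emeasure lebesgue (P - T) = ennreal (measure lebesgue (P - T))"
      using T(3) by (simp add: emeasure_eq_measure2)
    ultimately show False using T(4) by simp
  qed
  then have "T \<noteq> {}" by auto
  have "T \<subseteq> \<Omega> \<inter> ball a r" using T(2) by (auto simp: P_def positivity_set_def)
  then obtain e where e: "e > 0" "(\<Union>x\<in>T. ball x e) \<subseteq> \<Omega> \<inter> ball a r"
    using compact_subset_open_imp_ball_epsilon_subset[OF cT, of "\<Omega> \<inter> ball a r"] open_domain by auto
  define \<phi> where "\<phi> n x = max 0 (1 - real n * infdist x T)" for n x
  have supp: "x \<in> \<Omega> \<inter> ball a r" if "\<phi> n x \<noteq> 0" "1 < real n * e" for n x
  proof -
    have lt: "real n * infdist x T < 1" using that by (auto simp: \<phi>_def max_def split: if_splits)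
    have "infdist x T < e"
    proof (rule ccontr)
      assume "\<not> infdist x T < e"
      then have "real n * e \<le> real n * infdist x T" by (intro mult_left_mono) auto
      then show False using lt that by simp
    qed
    moreover obtain y where "y \<in> T" "infdist x T = dist x y"
      using infdist_attains_inf[OF T(1) \<open>T \<noteq> {}\<close>, of x] by blast
    ultimately have "x \<in> (\<Union>x\<in>T. ball x e)" by (auto simp: dist_commute)
    then show ?thesis using e by blast
  qed
  have range: "0 \<le> \<phi> n x \<and> \<phi> n x \<le> 1" for n x
    by (simp add: \<phi>_def infdist_nonneg)
  have cont: "(real n)-lipschitz_on UNIV (\<phi> n)" for n
  proof (rule lipschitz_onI)
    fix x y :: 'a
    have "\<bar>infdist x T - infdist y T\<bar> \<le> dist x y" by (rule infdist_triangle_abs)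
    then have "\<bar>real n * infdist x T - real n * infdist y T\<bar> \<le> real n * dist x y"
      by (simp add: abs_mult mult_left_mono flip: right_diff_distrib)
    then show "dist (\<phi> n x) (\<phi> n y) \<le> real n * dist x y"
      unfolding \<phi>_def dist_real_def by linarith
  qed simp
  have "(\<lambda>n. LINT x|lebesgue. ext_weight x * (\<phi> n x * \<phi> n x)) \<longlonglongrightarrow> (LINT x|lebesgue. ext_weight x * indicator T x)"
  proof (rule integral_dominated_convergence[where w="\<lambda>x. \<bar>ext_weight x\<bar>"])
    show "integrable lebesgue (\<lambda>x. \<bar>ext_weight x\<bar>)" using ext_weight_integrable by simp
    show "(\<lambda>x. ext_weight x * indicator T x) \<in> borel_measurable lebesgue"
      using ext_weight_measurable T(1)
      by (intro borel_measurable_times borel_measurable_indicator) (simp_all add: borel_closed)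
    fix n
    have "continuous_on UNIV (\<phi> n)" using cont by (rule lipschitz_on_continuous_on)
    then have "\<phi> n \<in> borel_measurable borel" by (rule borel_measurable_continuous_onI)
    then have "\<phi> n \<in> borel_measurable lebesgue" by (intro measurable_completion) simp
    then show "(\<lambda>x. ext_weight x * (\<phi> n x * \<phi> n x)) \<in> borel_measurable lebesgue"
      using ext_weight_measurable by (intro borel_measurable_times)
    show "AE x in lebesgue. norm (ext_weight x * (\<phi> n x * \<phi> n x)) \<le> \<bar>ext_weight x\<bar>"
      using range[of n] by (intro AE_I2) (simp add: abs_mult mult_left_le mult_le_one)
  next
    show "AE x in lebesgue. (\<lambda>n. ext_weight x * (\<phi> n x * \<phi> n x)) \<longlonglongrightarrow> ext_weight x * indicator T x"
    proof (rule AE_I2)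
      fix x
      have "(\<lambda>n. \<phi> n x * \<phi> n x) \<longlonglongrightarrow> indicator T x"
      proof (cases "x \<in> T")
        case True
        then show ?thesis by (simp add: \<phi>_def)
      next
        case False
        then have pos: "infdist x T > 0" using infdist_pos_not_in_closed[OF T(1) \<open>T \<noteq> {}\<close>] by simp
        obtain N :: nat where N: "1 / infdist x T < real N" using reals_Archimedean2 by blast
        have "\<phi> n x = 0" if "n \<ge> N" for n
        proof -
          have "1 / infdist x T \<le> real n" using N that by linarith
          then show ?thesis using pos by (simp add: \<phi>_def field_simps)
        qed
        then have "\<forall>\<^sub>F n in sequentially. \<phi> n x * \<phi> n x = 0"
          by (intro eventually_sequentiallyI[of N]) simp
        then show ?thesis using False by (simp add: tendsto_eventually)
      qed
      then show "(\<lambda>n. ext_weight x * (\<phi> n x * \<phi> n x)) \<longlonglongrightarrow> ext_weight x * indicator T x"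
        by (intro tendsto_intros)
    qed
  qed
  moreover have "0 < (LINT x|lebesgue. ext_weight x * indicator T x)"
  proof -
    have int: "integrable lebesgue (\<lambda>x. ext_weight x * indicator T x)"
      using integrable_mult_indicator[OF _ ext_weight_integrable, of T] T(1) by (simp add: mult.commute)
    have pos: "ext_weight x > 0" if "x \<in> T" for x
      using that T(2) by (auto simp: P_def positivity_set_def ext_weight_def)
    have nneg: "0 \<le> ext_weight x * indicator T x" for x
      using pos[of x] by (auto simp: indicator_def)
    have "(LINT x|lebesgue. ext_weight x * indicator T x) \<noteq> 0"
    proof
      assume "(LINT x|lebesgue. ext_weight x * indicator T x) = 0"
      then have "AE x in lebesgue. ext_weight x * indicator T x = 0"
        using integral_nonneg_eq_0_iff_AE[OF int] nneg by simp
      then have "AE x in lebesgue. x \<notin> T"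
        by eventually_elim (use pos in \<open>force simp: indicator_def split: if_splits\<close>)
      then have "T \<in> null_sets lebesgue"
        using T(1) AE_iff_null_sets[of T lebesgue] by auto
      then show False using nT by (simp add: negligible_iff_null_sets)
    qed
    moreover have "0 \<le> (LINT x|lebesgue. ext_weight x * indicator T x)"
      using nneg by (intro integral_nonneg_AE) auto
    ultimately show ?thesis by simp
  qed
  ultimately have "\<forall>\<^sub>F n in sequentially. 0 < (LINT x|lebesgue. ext_weight x * (\<phi> n x * \<phi> n x))"
    by (rule order_tendstoD)
  then obtain N where N: "\<And>n. n \<ge> N \<Longrightarrow> 0 < (LINT x|lebesgue. ext_weight x * (\<phi> n x * \<phi> n x))"
    by (auto simp: eventually_sequentially)
  obtain M :: nat where M: "1 / e < real M" using reals_Archimedean2 by blast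
  define n where "n = max N M"
  have "1 / e < real n" using M by (simp add: n_def)
  then have ne: "1 < real n * e" using e(1) by (simp add: field_simps)
  show thesis
  proof (rule that[of "\<phi> n"])
    show "\<phi> n \<in> X" using cont range supp[OF _ ne] by (intro Lipschitz_in_X_space) auto
    show "\<phi> n x = 0" if "x \<notin> ball a r" for x using supp[OF _ ne, of x] that by auto
    show "0 < weight_pairing \<Omega> \<rho> (\<phi> n) (\<phi> n)" unfolding weight_pairing_eq by (rule N) (simp add: n_def)
  qed
qed

text \<open>
  Negligibility is a local property, so almost every point of the positivity set has only
  neighbourhoods that meet this set in positive measure. A finite set of such points would be null.
\<close>

lemma support_points_infinite:
  assumes "\<not> (AE x in lebesgue_on \<Omega>. max (\<rho> x) 0 = 0)"
  shows "infinite {x. \<forall>r>0. \<not> negligible (positivity_set \<inter> ball x r)}" (is "infinite ?S")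
proof
  assume "finite ?S"
  have "negligible (positivity_set - ?S)"
  proof (subst locally_negligible_alt, intro ballI)
    fix x assume x: "x \<in> positivity_set - ?S"
    then obtain r where r: "r > 0" "negligible (positivity_set \<inter> ball x r)" by auto
    have "openin (top_of_set (positivity_set - ?S)) ((positivity_set - ?S) \<inter> ball x r)"
      by (auto intro: openin_open_Int)
    moreover have "negligible ((positivity_set - ?S) \<inter> ball x r)"
      using r(2) by (rule negligible_subset) auto
    ultimately show "\<exists>U. openin (top_of_set (positivity_set - ?S)) U \<and> x \<in> U \<and> negligible U"
      using x r(1) by (intro exI[of _ "(positivity_set - ?S) \<inter> ball x r"]) auto
  qed
  moreover have "negligible ?S" using \<open>finite ?S\<close> by (rule negligible_finite)
  ultimately have "negligible positivity_set"
    by (rule negligible_subset[OF negligible_Un]) auto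
  then have "AE x in lebesgue. x \<notin> positivity_set"
    by (intro AE_not_in) (simp add: negligible_iff_null_sets)
  then have "AE x in lebesgue. x \<in> \<Omega> \<longrightarrow> max (\<rho> x) 0 = 0"
    by eventually_elim (auto simp: positivity_set_def)
  then have "AE x in lebesgue_on \<Omega>. max (\<rho> x) 0 = 0"
    by (subst AE_restrict_space_iff) auto
  with assms show False ..
qed

text \<open>
  Bumps around distinct support points, in disjoint balls, are orthogonal for the weighted form and each
  of them has a positive square. So the form is positive definite on their span.
\<close>

lemma positive_subspaces:
  assumes "\<not> (AE x in lebesgue_on \<Omega>. max (\<rho> x) 0 = 0)"
  shows "\<exists>f. (\<forall>i<(n::nat). f i \<in> X) \<and> (\<forall>c. (\<exists>i<n. c i \<noteq> 0) \<longrightarrow>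
    0 < weight_pairing \<Omega> \<rho> (\<lambda>x. \<Sum>i<n. c i * f i x) (\<lambda>x. \<Sum>i<n. c i * f i x))"
proof -
  obtain A where A: "finite A" "card A = n" "A \<subseteq> {x. \<forall>r>0. \<not> negligible (positivity_set \<inter> ball x r)}"
    using infinite_arbitrarily_large[OF support_points_infinite[OF assms]] by blast
  obtain p where p: "bij_betw p {..<n} A"
    using ex_bij_betw_nat_finite[OF A(1)] A(2) by (auto simp: atLeast0LessThan)
  \<comment> \<open>Balls of half these radii around the points of \<open>A\<close> are pairwise disjoint.\<close>
  have "\<exists>\<delta>>0. \<forall>x\<in>A. x \<noteq> a \<longrightarrow> \<delta> \<le> dist a x" for a by (rule finite_set_avoid[OF A(1)])
  then obtain \<delta> where \<delta>: "\<And>a. \<delta> a > 0" "\<And>a x. x \<in> A \<Longrightarrow> x \<noteq> a \<Longrightarrow> \<delta> a \<le> dist a x" by metis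
  have "\<exists>\<phi>. \<phi> \<in> X \<and> (\<forall>x. x \<notin> ball a (\<delta> a / 2) \<longrightarrow> \<phi> x = 0) \<and> 0 < weight_pairing \<Omega> \<rho> \<phi> \<phi>" if "a \<in> A" for a
  proof -
    have "\<not> negligible (positivity_set \<inter> ball a (\<delta> a / 2))"
      using A(3) that half_gt_zero[OF \<delta>(1)[of a]] by blast
    then show ?thesis by (rule bump_exists) blast
  qed
  then obtain \<phi> where \<phi>: "\<And>a. a \<in> A \<Longrightarrow> \<phi> a \<in> X" "\<And>a x. a \<in> A \<Longrightarrow> x \<notin> ball a (\<delta> a / 2) \<Longrightarrow> \<phi> a x = 0"
    "\<And>a. a \<in> A \<Longrightarrow> 0 < weight_pairing \<Omega> \<rho> (\<phi> a) (\<phi> a)" by metis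
  define f where "f i = \<phi> (p i)" for i
  have pA: "p i \<in> A" if "i < n" for i using p that by (auto simp: bij_betw_def)
  have f: "f i \<in> X" if "i < n" for i using \<phi>(1)[OF pA[OF that]] by (simp add: f_def)
  have orth: "weight_pairing \<Omega> \<rho> (f i) (f j) = 0" if ij: "i < n" "j < n" "i \<noteq> j" for i j
  proof -
    have ne: "p i \<noteq> p j" using p ij by (auto simp: bij_betw_def inj_on_def)
    have "f i x * f j x = 0" for x
    proof (rule ccontr)
      assume "f i x * f j x \<noteq> 0"
      then have "x \<in> ball (p i) (\<delta> (p i) / 2)" "x \<in> ball (p j) (\<delta> (p j) / 2)"
        using \<phi>(2)[OF pA] ij by (auto simp: f_def)
      then have "dist (p i) x < \<delta> (p i) / 2" "dist (p j) x < \<delta> (p j) / 2" by auto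
      moreover have "dist (p i) (p j) \<le> dist (p i) x + dist (p j) x" by (rule dist_triangle2)
      moreover have "\<delta> (p i) \<le> dist (p i) (p j)" "\<delta> (p j) \<le> dist (p i) (p j)"
        using \<delta>(2)[OF pA[OF ij(2)], of "p i"] \<delta>(2)[OF pA[OF ij(1)], of "p j"] ne by (auto simp: dist_commute)
      ultimately show False by linarith
    qed
    then have "(\<lambda>x. ext_weight x * (f i x * f j x)) = (\<lambda>x. 0)" by (intro ext) (simp only: mult_zero_right)
    then show ?thesis unfolding weight_pairing_eq by simp
  qed
  show ?thesis
  proof (intro exI[of _ f] conjI allI impI)
    show "f i \<in> X" if "i < n" for i by (rule f[OF that])
    fix c :: "nat \<Rightarrow> real" assume "\<exists>i<n. c i \<noteq> 0"
    then obtain k where k: "k < n" "c k \<noteq> 0" by blast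
    define g where "g x = (\<Sum>i<n. c i * f i x)" for x
    have g: "g \<in> X" unfolding g_def[abs_def] by (rule sum_mem[OF f])
    have fg: "weight_pairing \<Omega> \<rho> (f i) g = c i * weight_pairing \<Omega> \<rho> (f i) (f i)" if "i < n" for i
    proof -
      have "weight_pairing \<Omega> \<rho> (f i) g = (\<Sum>j<n. c j * weight_pairing \<Omega> \<rho> (f i) (f j))"
        unfolding g_def[abs_def] by (rule W.sum_right[OF f f[OF that]])
      also have "\<dots> = (\<Sum>j<n. if j = i then c i * weight_pairing \<Omega> \<rho> (f i) (f i) else 0)"
        using that orth by (intro sum.cong) auto
      finally show ?thesis using that by simp
    qed
    have "weight_pairing \<Omega> \<rho> g g = (\<Sum>i<n. c i * weight_pairing \<Omega> \<rho> (f i) g)"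
      unfolding g_def[abs_def] by (rule W.sum_left[OF f]) (use g in \<open>simp_all add: g_def[abs_def]\<close>)
    also have "\<dots> = (\<Sum>i<n. (c i)\<^sup>2 * weight_pairing \<Omega> \<rho> (f i) (f i))"
      by (intro sum.cong) (auto simp: fg power2_eq_square)
    also have "\<dots> > 0"
      using k \<phi>(3)[OF pA] by (intro sum_pos2[of _ k]) (auto simp: f_def less_imp_le)
    finally show "0 < weight_pairing \<Omega> \<rho> (\<lambda>x. \<Sum>i<n. c i * f i x) (\<lambda>x. \<Sum>i<n. c i * f i x)"
      by (simp add: g_def[abs_def])
  qed
qed

end

section \<open>Min-max formulas and strict monotonicity\<close>

lemma unit_sphere_iff: "u \<in> unit_sphere K F \<longleftrightarrow> u \<in> F \<and> K_inner K u u = 1"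
  by (simp add: unit_sphere_def K_norm_eq)

context bounded_domain_kernel
begin

definition AE_span :: "(nat \<Rightarrow> 'a \<Rightarrow> real) \<Rightarrow> nat \<Rightarrow> ('a \<Rightarrow> real) set" where
  "AE_span e k = {u \<in> X. \<exists>c. AE x in lebesgue. u x = (\<Sum>i<k. c i * e i x)}"

lemma K_inner_AE_cong:
  assumes "u \<in> X" "v \<in> X" "w \<in> X" "AE x in lebesgue. u x = v x"
  shows "K_inner K u w = K_inner K v w"
proof -
  have "AE x in lebesgue. u x - v x = 0" using assms(4) by eventually_elim simp
  then show ?thesis
    using K.diff_left[OF assms(1-3)] K_inner_AE_zero[of "\<lambda>x. u x - v x" w] by simp
qed

lemma K_inner_zero_imp_AE_zero:
  assumes u: "u \<in> X" and "K_inner K u u = 0"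
  shows "AE x in lebesgue. u x = 0"
proof -
  obtain C where "mass u \<le> C * K_inner K u u" using Poincare u by metis
  then have "mass u = 0" using assms(2) mass_nonneg[of u] by simp
  then have "AE x in lebesgue. (u x)\<^sup>2 = 0"
    using u integral_nonneg_eq_0_iff_AE[of lebesgue "\<lambda>x. (u x)\<^sup>2"] by (simp add: mass_def X_space_iff)
  then show ?thesis by eventually_elim simp
qed

lemma normalize:
  assumes u: "u \<in> X" and "\<not> (AE x in lebesgue. u x = 0)"
  obtains t where "t > 0" "K_inner K (\<lambda>x. t * u x) (\<lambda>x. t * u x) = 1"
proof
  have "K_inner K u u \<noteq> 0" using assms K_inner_zero_imp_AE_zero by blast
  then have pos: "K_inner K u u > 0" using K_inner_nonneg[of u] by simp
  then show "1 / sqrt (K_inner K u u) > 0" by simp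
  show "K_inner K (\<lambda>x. 1 / sqrt (K_inner K u u) * u x) (\<lambda>x. 1 / sqrt (K_inner K u u) * u x) = 1"
    using pos unfolding K.scale_square[OF u] by (simp add: power_divide)
qed

lemma subspacesE:
  assumes "F \<in> subspaces \<Omega> K k"
  obtains f where "\<And>i. i < k \<Longrightarrow> f i \<in> X"
    "\<And>c. AE x in lebesgue. (\<Sum>i<k. c i * f i x) = 0 \<Longrightarrow> \<forall>i<k. c i = 0" "F = AE_span f k"
  using assms unfolding subspaces_def AE_span_def by blast

lemma AE_span_scaled_sum:
  assumes "\<And>i. i < k \<Longrightarrow> f i \<in> X"
  shows "(\<lambda>x. t * (\<Sum>i<k. c i * f i x)) \<in> AE_span f k"
proof -
  have "t * (\<Sum>i<k. c i * f i x) = (\<Sum>i<k. (t * c i) * f i x)" for x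
    by (simp add: sum_distrib_left mult.assoc)
  then show ?thesis
    using scale_mem[OF sum_mem[where n=k and e=f and c=c], of t] assms unfolding AE_span_def
    by (auto intro!: exI[of _ "\<lambda>i. t * c i"])
qed

lemma basis_mem_AE_span:
  assumes "\<And>i. i < k \<Longrightarrow> f i \<in> X" "j < k"
  shows "f j \<in> AE_span f k"
proof -
  have "(\<Sum>i<k. (if i = j then 1 else 0) * f i x) = f j x" for x
    using assms(2) by (simp add: if_distrib if_distribR cong: if_cong)
  then show ?thesis using assms unfolding AE_span_def
    by (auto intro!: exI[of _ "\<lambda>i. if i = j then 1 else 0"])
qed

lemma orthogonal_AE_span:
  assumes "\<And>i. i < k \<Longrightarrow> f i \<in> X" "u \<in> X" "\<And>i. i < k \<Longrightarrow> K_inner K u (f i) = 0" "v \<in> AE_span f k"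
  shows "K_inner K u v = 0"
proof -
  obtain c where v: "v \<in> X" "AE x in lebesgue. v x = (\<Sum>i<k. c i * f i x)"
    using assms(4) by (auto simp: AE_span_def)
  have s: "(\<lambda>x. \<Sum>i<k. c i * f i x) \<in> X" by (rule sum_mem[OF assms(1)])
  have "K_inner K v u = K_inner K (\<lambda>x. \<Sum>i<k. c i * f i x) u"
    by (rule K_inner_AE_cong[OF v(1) s assms(2) v(2)])
  also have "\<dots> = (\<Sum>i<k. c i * K_inner K (f i) u)" by (rule K.sum_left[OF assms(1,2)])
  also have "\<dots> = 0" using assms by (intro sum.neutral) (auto simp: K.sym[of _ u])
  finally show ?thesis using K.sym[OF assms(2) v(1)] by simp
qed

end

context weighted_domain
begin

lemma weight_pairing_AE_zero:
  assumes "AE x in lebesgue. u x = 0"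
  shows "weight_pairing \<Omega> \<rho> u v = 0"
  unfolding weight_pairing_eq
proof (rule integral_eq_zero_AE)
  show "AE x in lebesgue. ext_weight x * (u x * v x) = 0"
    using assms by eventually_elim simp
qed

lemma weight_pairing_AE_cong:
  assumes "u \<in> X" "v \<in> X" "w \<in> X" "AE x in lebesgue. u x = v x"
  shows "weight_pairing \<Omega> \<rho> u w = weight_pairing \<Omega> \<rho> v w"
proof -
  have "AE x in lebesgue. u x - v x = 0" using assms(4) by eventually_elim simp
  then show ?thesis
    using W.diff_left[OF assms(1-3)] weight_pairing_AE_zero[of "\<lambda>x. u x - v x" w] by simp
qed

lemma weight_form_bounded_on_sphere:
  obtains B where "\<And>u. u \<in> X \<Longrightarrow> K_inner K u u = 1 \<Longrightarrow> \<bar>weight_form \<Omega> \<rho> u\<bar> \<le> B"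
proof -
  obtain C where C: "C > 0"
    "\<And>u v \<eta>. u \<in> X \<Longrightarrow> v \<in> X \<Longrightarrow> \<eta> > 0 \<Longrightarrow> \<bar>weight_pairing \<Omega> \<rho> u v\<bar> \<le> C * (mass u / \<eta> + \<eta> * mass v)"
    by (rule weight_pairing_bound) blast
  obtain P where P: "P \<ge> 0" "\<And>u. u \<in> X \<Longrightarrow> mass u \<le> P * K_inner K u u" by (rule Poincare) blast
  show thesis
  proof (rule that[of "2 * C * P"])
    fix u assume u: "u \<in> X" "K_inner K u u = 1"
    have "\<bar>weight_form \<Omega> \<rho> u\<bar> \<le> (2 * C) * mass u"
      using C(2)[OF u(1) u(1), of 1] by (simp add: weight_form_eq)
    also have "\<dots> \<le> (2 * C) * P" using C(1) P(2)[OF u(1)] u(2) by simp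
    finally show "\<bar>weight_form \<Omega> \<rho> u\<bar> \<le> 2 * C * P" .
  qed
qed

context
  fixes n e \<mu>
  assumes sys: "eigen_system X (K_inner K) (weight_pairing \<Omega> \<rho>) (Suc n) e \<mu>"
begin

lemma eigen_span_subspace:
  assumes "k \<le> Suc n"
  shows "AE_span e k \<in> subspaces \<Omega> K k"
proof -
  have sysk: "eigen_system X (K_inner K) (weight_pairing \<Omega> \<rho>) k e \<mu>"
    using eigen_system_le[OF sys assms] .
  have "\<forall>i<k. c i = 0" if "AE x in lebesgue. (\<Sum>i<k. c i * e i x) = 0" for c
    using eigen_span_coeff[OF sysk, of _ c] K_inner_AE_zero[OF that] by simp
  then show ?thesis
    unfolding subspaces_def AE_span_def using eigen_mem[OF sysk] by blast
qed

lemma weight_form_ge_on_span: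
  assumes u: "u \<in> AE_span e (Suc n)" and one: "K_inner K u u = 1"
  shows "\<mu> n \<le> weight_form \<Omega> \<rho> u"
proof -
  obtain c where c: "u \<in> X" "AE x in lebesgue. u x = (\<Sum>i<Suc n. c i * e i x)"
    using u by (auto simp: AE_span_def)
  define s where "s x = (\<Sum>i<Suc n. c i * e i x)" for x
  have s: "s \<in> X" unfolding s_def[abs_def] by (rule sum_mem[OF eigen_mem[OF sys]])
  have us: "AE x in lebesgue. u x = s x" using c(2) by (simp add: s_def)
  have K: "K_inner K s s = 1"
    using one K_inner_AE_cong[OF c(1) s c(1) us] K_inner_AE_cong[OF c(1) s s us] K.sym[OF s c(1)] by simp
  have W: "weight_pairing \<Omega> \<rho> u u = weight_pairing \<Omega> \<rho> s s"
    using weight_pairing_AE_cong[OF c(1) s c(1) us] weight_pairing_AE_cong[OF c(1) s s us] W.sym[OF s c(1)] by simp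
  have "\<mu> n * K_inner K s s \<le> weight_pairing \<Omega> \<rho> s s"
    unfolding s_def[abs_def] eigen_span_norm[OF sys] eigen_span_form[OF sys] by (rule eigen_span_ge[OF sys])
  then show ?thesis by (simp add: K W weight_form_eq)
qed

text \<open>
  Every \<open>(n + 1)\<close>-dimensional subspace meets the orthogonal complement of \<open>e 0, \<dots>, e (n - 1)\<close>, where the
  Rayleigh quotient is at most \<open>\<mu> n\<close>.
\<close>

lemma subspace_unit_vector_le:
  assumes "F \<in> subspaces \<Omega> K (Suc n)"
  obtains u where "u \<in> unit_sphere K F" "u \<in> X" "weight_form \<Omega> \<rho> u \<le> \<mu> n"
proof -
  obtain f where f: "\<And>i. i < Suc n \<Longrightarrow> f i \<in> X"
    "\<And>c. AE x in lebesgue. (\<Sum>i<Suc n. c i * f i x) = 0 \<Longrightarrow> \<forall>i<Suc n. c i = 0" "F = AE_span f (Suc n)"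
    by (rule subspacesE[OF assms]) blast
  obtain c where c: "\<exists>i<Suc n. c i \<noteq> 0" "\<And>j. j < n \<Longrightarrow> K_inner K (\<lambda>x. \<Sum>i<Suc n. c i * f i x) (e j) = 0"
    by (rule span_meets_orthogonal[where f=f and g=e and k="Suc n" and m=n])
      (use f(1) eigen_mem[OF sys] in auto)
  define s where "s x = (\<Sum>i<Suc n. c i * f i x)" for x
  have s: "s \<in> X" unfolding s_def[abs_def] by (rule sum_mem[OF f(1)])
  have "\<not> (AE x in lebesgue. s x = 0)" using f(2)[of c] c(1) unfolding s_def by blast
  then obtain t where t: "t > 0" "K_inner K (\<lambda>x. t * s x) (\<lambda>x. t * s x) = 1" by (rule normalize[OF s])
  have tX: "(\<lambda>x. t * s x) \<in> X" by (rule scale_mem[OF s])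
  have orth: "K_inner K (\<lambda>x. t * s x) (e j) = 0" if "j < n" for j
    using K.scale_left[OF s eigen_mem[OF sys], of j t] c(2)[OF that] that by (simp add: s_def[abs_def])
  show thesis
  proof (rule that[OF _ tX])
    show "(\<lambda>x. t * s x) \<in> unit_sphere K F"
      using AE_span_scaled_sum[where f=f and k="Suc n" and t=t and c=c] f(1) t(2) f(3) by (simp add: unit_sphere_iff s_def[abs_def])
    show "weight_form \<Omega> \<rho> (\<lambda>x. t * s x) \<le> \<mu> n"
      using eigen_max[OF sys _ tX orth, of n] t(2) by (simp add: weight_form_eq)
  qed
qed

text \<open>
  Dually, the span of \<open>e 0, \<dots>, e n\<close> meets the orthogonal complement of every \<open>n\<close>-dimensional subspace,
  and on this span the Rayleigh quotient is at least \<open>\<mu> n\<close>.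
\<close>

lemma orth_compl_unit_vector_ge:
  assumes "G \<in> subspaces \<Omega> K n"
  obtains u where "u \<in> unit_sphere K (orth_compl \<Omega> K G)" "u \<in> X" "\<mu> n \<le> weight_form \<Omega> \<rho> u"
proof -
  obtain g where g: "\<And>i. i < n \<Longrightarrow> g i \<in> X" "G = AE_span g n"
    by (rule subspacesE[OF assms]) blast
  obtain c where c: "\<exists>i<Suc n. c i \<noteq> 0" "\<And>j. j < n \<Longrightarrow> K_inner K (\<lambda>x. \<Sum>i<Suc n. c i * e i x) (g j) = 0"
    by (rule span_meets_orthogonal[where f=e and g=g and k="Suc n" and m=n])
      (use g(1) eigen_mem[OF sys] in auto)
  define s where "s x = (\<Sum>i<Suc n. c i * e i x)" for x
  have s: "s \<in> X" unfolding s_def[abs_def] by (rule sum_mem[OF eigen_mem[OF sys]])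
  obtain i where i: "i < Suc n" "c i \<noteq> 0" using c(1) by blast
  have "\<not> (AE x in lebesgue. s x = 0)"
    using eigen_span_coeff[OF sys i(1), of c] i(2) K_inner_AE_zero[of s "e i"] unfolding s_def[abs_def] by auto
  then obtain t where t: "t > 0" "K_inner K (\<lambda>x. t * s x) (\<lambda>x. t * s x) = 1" by (rule normalize[OF s])
  have tX: "(\<lambda>x. t * s x) \<in> X" by (rule scale_mem[OF s])
  have orth: "K_inner K (\<lambda>x. t * s x) (g j) = 0" if "j < n" for j
    using K.scale_left[OF s g(1), of j t] c(2)[OF that] that by (simp add: s_def[abs_def])
  show thesis
  proof (rule that[OF _ tX])
    show "(\<lambda>x. t * s x) \<in> unit_sphere K (orth_compl \<Omega> K G)"
      using orthogonal_AE_span[OF g(1) tX orth] t(2) tX by (auto simp: unit_sphere_iff orth_compl_def g(2))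
    show "\<mu> n \<le> weight_form \<Omega> \<rho> (\<lambda>x. t * s x)"
      using AE_span_scaled_sum[where f=e and k="Suc n" and t=t and c=c] eigen_mem[OF sys] t(2)
      by (intro weight_form_ge_on_span) (simp_all add: s_def[abs_def])
  qed
qed

text \<open>
  The supremum is attained at the span of the first \<open>n + 1\<close> eigenvectors.
\<close>

lemma sup_inf_eq: "(SUP F\<in>subspaces \<Omega> K (Suc n). INF u\<in>unit_sphere K F. weight_form \<Omega> \<rho> u) = \<mu> n"
proof (rule cSup_eq_maximum)
  obtain B where B: "\<And>u. u \<in> X \<Longrightarrow> K_inner K u u = 1 \<Longrightarrow> \<bar>weight_form \<Omega> \<rho> u\<bar> \<le> B"
    by (rule weight_form_bounded_on_sphere) blast
  have le: "(INF u\<in>unit_sphere K F. weight_form \<Omega> \<rho> u) \<le> \<mu> n" if F: "F \<in> subspaces \<Omega> K (Suc n)" for F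
  proof -
    obtain u where u: "u \<in> unit_sphere K F" "weight_form \<Omega> \<rho> u \<le> \<mu> n"
      by (rule subspace_unit_vector_le[OF F]) blast
    have "F \<subseteq> X" using F by (auto simp: subspaces_def)
    have "bdd_below (weight_form \<Omega> \<rho> ` unit_sphere K F)"
    proof (rule bdd_belowI2)
      fix v assume "v \<in> unit_sphere K F"
      then show "- B \<le> weight_form \<Omega> \<rho> v" using B[of v] \<open>F \<subseteq> X\<close> by (auto simp: unit_sphere_iff)
    qed
    then show ?thesis using u(2) by (intro cINF_lower2[OF _ u(1)])
  qed
  have E: "AE_span e (Suc n) \<in> subspaces \<Omega> K (Suc n)" by (rule eigen_span_subspace) simp
  have "(INF u\<in>unit_sphere K (AE_span e (Suc n)). weight_form \<Omega> \<rho> u) = \<mu> n"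
  proof (rule antisym[OF le[OF E]])
    show "\<mu> n \<le> (INF u\<in>unit_sphere K (AE_span e (Suc n)). weight_form \<Omega> \<rho> u)"
    proof (rule cINF_greatest)
      show "unit_sphere K (AE_span e (Suc n)) \<noteq> {}"
        using subspace_unit_vector_le[OF E] by blast
    qed (auto simp: unit_sphere_iff intro: weight_form_ge_on_span)
  qed
  then show "\<mu> n \<in> (\<lambda>F. INF u\<in>unit_sphere K F. weight_form \<Omega> \<rho> u) ` subspaces \<Omega> K (Suc n)"
    using E by (metis imageI)
  show "x \<le> \<mu> n" if "x \<in> (\<lambda>F. INF u\<in>unit_sphere K F. weight_form \<Omega> \<rho> u) ` subspaces \<Omega> K (Suc n)" for x
    using that le by auto
qed

text \<open>
  The infimum is attained at the span of the first \<open>n\<close> eigenvectors.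
\<close>

lemma inf_sup_eq:
  "(INF G\<in>subspaces \<Omega> K n. SUP u\<in>unit_sphere K (orth_compl \<Omega> K G). weight_form \<Omega> \<rho> u) = \<mu> n"
proof (rule cInf_eq_minimum)
  obtain B where B: "\<And>u. u \<in> X \<Longrightarrow> K_inner K u u = 1 \<Longrightarrow> \<bar>weight_form \<Omega> \<rho> u\<bar> \<le> B"
    by (rule weight_form_bounded_on_sphere) blast
  have ge: "\<mu> n \<le> (SUP u\<in>unit_sphere K (orth_compl \<Omega> K G). weight_form \<Omega> \<rho> u)" if G: "G \<in> subspaces \<Omega> K n" for G
  proof -
    obtain u where u: "u \<in> unit_sphere K (orth_compl \<Omega> K G)" "\<mu> n \<le> weight_form \<Omega> \<rho> u"
      by (rule orth_compl_unit_vector_ge[OF G]) blast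
    have "bdd_above (weight_form \<Omega> \<rho> ` unit_sphere K (orth_compl \<Omega> K G))"
    proof (rule bdd_aboveI2)
      fix v assume "v \<in> unit_sphere K (orth_compl \<Omega> K G)"
      then show "weight_form \<Omega> \<rho> v \<le> B" using B[of v] by (auto simp: unit_sphere_iff orth_compl_def)
    qed
    then show ?thesis using u(2) by (intro cSUP_upper2[OF _ u(1)])
  qed
  have E: "AE_span e n \<in> subspaces \<Omega> K n" by (rule eigen_span_subspace) simp
  have "(SUP u\<in>unit_sphere K (orth_compl \<Omega> K (AE_span e n)). weight_form \<Omega> \<rho> u) = \<mu> n"
  proof (rule antisym[OF _ ge[OF E]])
    show "(SUP u\<in>unit_sphere K (orth_compl \<Omega> K (AE_span e n)). weight_form \<Omega> \<rho> u) \<le> \<mu> n"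
    proof (rule cSUP_least)
      show "unit_sphere K (orth_compl \<Omega> K (AE_span e n)) \<noteq> {}"
        using orth_compl_unit_vector_ge[OF E] by blast
      fix u assume "u \<in> unit_sphere K (orth_compl \<Omega> K (AE_span e n))"
      then have u: "u \<in> X" "K_inner K u u = 1" "\<And>v. v \<in> AE_span e n \<Longrightarrow> K_inner K u v = 0"
        by (auto simp: unit_sphere_iff orth_compl_def)
      have "K_inner K u (e j) = 0" if "j < n" for j
        using that eigen_mem[OF sys] by (intro u(3) basis_mem_AE_span) auto
      then show "weight_form \<Omega> \<rho> u \<le> \<mu> n"
        using eigen_max[OF sys _ u(1), of n] u(2) by (simp add: weight_form_eq)
    qed
  qed
  then show "\<mu> n \<in> (\<lambda>G. SUP u\<in>unit_sphere K (orth_compl \<Omega> K G). weight_form \<Omega> \<rho> u) ` subspaces \<Omega> K n"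
    using E by (metis imageI)
  show "\<mu> n \<le> x" if "x \<in> (\<lambda>G. SUP u\<in>unit_sphere K (orth_compl \<Omega> K G). weight_form \<Omega> \<rho> u) ` subspaces \<Omega> K n" for x
    using that ge by auto
qed

lemma eigenvalue_of_positive_index: "is_eigenvalue_of_index \<Omega> K \<rho> (int (Suc n)) (inverse (\<mu> n))"
proof -
  have "eigenfunction \<Omega> K \<rho> (inverse (\<mu> n)) (e n)"
  proof -
    have "\<not> (AE x in lebesgue. e n x = 0)"
      using K_inner_AE_zero[of "e n" "e n"] eigen_orthonormal[OF sys, of n n] by auto
    moreover have "K_inner K (e n) v = inverse (\<mu> n) * (LINT x|lebesgue_on \<Omega>. \<rho> x * e n x * v x)" if "v \<in> X" for v
      using eigen_eq[OF sys _ that, of n] eigen_pos[OF sys, of n] by (simp add: weight_pairing_def)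
    ultimately show ?thesis
      using eigen_mem[OF sys, of n] by (simp add: eigenfunction_def)
  qed
  then show ?thesis
    using eigen_pos[OF sys, of n] sup_inf_eq inf_sup_eq
    unfolding is_eigenvalue_of_index_def spectrum_of_def by (auto simp: nat_add_distrib)
qed

end

lemma kernel_vector_eigenfunction:
  assumes "u \<in> X" "K_inner K u u \<noteq> 0" "m > 0" "\<And>v. v \<in> X \<Longrightarrow> weight_pairing \<Omega> \<rho> u v = m * K_inner K u v"
  shows "eigenfunction \<Omega> K \<rho> (inverse m) u"
  using assms K_inner_AE_zero[of u u] by (auto simp: eigenfunction_def weight_pairing_def[symmetric])

end

lemma inverse_eigenvalue_of_index:
  assumes "is_eigenvalue_of_index \<Omega> K \<rho> k l"
  shows "inverse l = (if k > 0 then SUP F\<in>subspaces \<Omega> K (nat k). INF u\<in>unit_sphere K F. weight_form \<Omega> \<rho> u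
    else INF F\<in>subspaces \<Omega> K (nat (- k)). SUP u\<in>unit_sphere K F. weight_form \<Omega> \<rho> u)"
  using assms unfolding is_eigenvalue_of_index_def by (cases "k > 0") simp_all

lemma eigval_eqI:
  assumes "is_eigenvalue_of_index \<Omega> K \<rho> k l"
  shows "eigval \<Omega> K \<rho> k = l"
  unfolding eigval_def
proof (rule the_equality)
  show "is_eigenvalue_of_index \<Omega> K \<rho> k l" by fact
  fix l' assume "is_eigenvalue_of_index \<Omega> K \<rho> k l'"
  then have "inverse l' = inverse l"
    using inverse_eigenvalue_of_index[OF assms] inverse_eigenvalue_of_index by metis
  then show "l' = l" by simp
qed

text \<open>
  On the reals the infimum is by definition the negated supremum of the negated set, so these two identities
  hold for all sets, bounded or not.
\<close>

lemma real_INF_uminus: "(INF x\<in>A. - f x :: real) = - (SUP x\<in>A. f x)"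
  by (simp add: Inf_real_def image_image)

lemma real_SUP_uminus: "(SUP x\<in>A. - f x :: real) = - (INF x\<in>A. f x)"
  by (simp add: Inf_real_def image_image)

lemma weight_form_uminus: "weight_form \<Omega> (\<lambda>x. - \<rho> x) u = - weight_form \<Omega> \<rho> u"
  by (simp add: weight_form_def)

lemma eigenfunction_uminus: "eigenfunction \<Omega> K (\<lambda>x. - \<rho> x) (- l) u \<longleftrightarrow> eigenfunction \<Omega> K \<rho> l u"
  by (simp add: eigenfunction_def)

lemma ucp_uminus: "ucp \<Omega> K \<rho> \<Longrightarrow> ucp \<Omega> K (\<lambda>x. - \<rho> x)"
proof -
  have flip: "eigenfunction \<Omega> K \<rho> (- l) u" if "eigenfunction \<Omega> K (\<lambda>x. - \<rho> x) l u" for l u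
    using that eigenfunction_uminus[of \<Omega> K \<rho> "- l" u] by simp
  assume "ucp \<Omega> K \<rho>"
  then show ?thesis
    unfolding ucp_def spectrum_of_def using flip by blast
qed

lemma is_eigenvalue_of_index_uminus:
  assumes "k > 0" "is_eigenvalue_of_index \<Omega> K (\<lambda>x. - \<rho> x) k l"
  shows "is_eigenvalue_of_index \<Omega> K \<rho> (- k) (- l)"
proof -
  have "- l \<in> spectrum_of \<Omega> K \<rho>"
    using assms eigenfunction_uminus[of \<Omega> K \<rho> "- l"] by (auto simp: is_eigenvalue_of_index_def spectrum_of_def)
  moreover have "inverse (- l) = - inverse l" by simp
  ultimately show ?thesis
    using assms unfolding is_eigenvalue_of_index_def
    by (simp add: weight_form_uminus real_INF_uminus real_SUP_uminus)
qed

text \<open>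
  In the exceptional case of \<open>eigenvalue_comparison\<close> the common eigenfunction \<open>u\<close> has equal weighted squares
  for \<open>\<rho>\<close> and \<open>\<rho>'\<close>; the integrand \<open>(\<rho>' - \<rho>) u\<^sup>2\<close> is nonnegative, hence zero, while unique continuation for
  either weight makes \<open>u\<close> nonzero almost everywhere on \<open>\<Omega>\<close>.
\<close>

lemma eigval_strict_mono_positive_index:
  assumes "weighted_domain \<Omega> K \<rho>" "weighted_domain \<Omega> K \<rho>'"
    and le: "AE x in lebesgue_on \<Omega>. \<rho> x \<le> \<rho>' x"
    and ne: "\<not> (AE x in lebesgue_on \<Omega>. \<rho> x = \<rho>' x)"
    and ucp: "ucp \<Omega> K \<rho> \<or> ucp \<Omega> K \<rho>'"
    and pos: "\<not> (AE x in lebesgue_on \<Omega>. max (\<rho> x) 0 = 0)" "\<not> (AE x in lebesgue_on \<Omega>. max (\<rho>' x) 0 = 0)"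
  obtains m m' where "m' < m"
    "is_eigenvalue_of_index \<Omega> K \<rho> (int (Suc n)) m" "is_eigenvalue_of_index \<Omega> K \<rho>' (int (Suc n)) m'"
proof -
  interpret R: weighted_domain \<Omega> K \<rho> by fact
  interpret R': weighted_domain \<Omega> K \<rho>' by fact
  obtain e \<mu> where sys: "eigen_system (X_space \<Omega> K) (K_inner K) (weight_pairing \<Omega> \<rho>) (Suc n) e \<mu>"
    using R.eigen_system_exists[OF R.positive_subspaces[OF pos(1)]] by blast
  obtain e' \<mu>' where sys': "eigen_system (X_space \<Omega> K) (K_inner K) (weight_pairing \<Omega> \<rho>') (Suc n) e' \<mu>'"
    using R'.eigen_system_exists[OF R'.positive_subspaces[OF pos(2)]] by blast
  have mu: "0 < \<mu> n" "0 < \<mu>' n" using R.eigen_pos[OF sys] R'.eigen_pos[OF sys'] by auto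
  have w_le: "AE x in lebesgue. R.ext_weight x \<le> R'.ext_weight x"
  proof -
    have "AE x in lebesgue. x \<in> \<Omega> \<longrightarrow> \<rho> x \<le> \<rho>' x" using le by (subst (asm) AE_restrict_space_iff) auto
    then show ?thesis by eventually_elim (auto simp: R.ext_weight_def R'.ext_weight_def indicator_def)
  qed
  have form_le: "weight_pairing \<Omega> \<rho> u u \<le> weight_pairing \<Omega> \<rho>' u u" if "u \<in> X_space \<Omega> K" for u
    unfolding R.weight_pairing_eq R'.weight_pairing_eq
  proof (intro integral_mono_AE R.weight_pairing_integrable R'.weight_pairing_integrable that)
    show "AE x in lebesgue. R.ext_weight x * (u x * u x) \<le> R'.ext_weight x * (u x * u x)"
      using w_le by eventually_elim (auto intro: mult_right_mono)
  qed
  have "\<mu> n < \<mu>' n"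
  proof (rule eigenvalue_comparison[OF R.form_pair_axioms R'.form_pair_axioms sys sys' form_le])
    fix u assume u: "u \<in> X_space \<Omega> K" "K_inner K u u \<noteq> 0" "weight_pairing \<Omega> \<rho> u u = weight_pairing \<Omega> \<rho>' u u"
      "\<And>v. v \<in> X_space \<Omega> K \<Longrightarrow> weight_pairing \<Omega> \<rho> u v = \<mu> n * K_inner K u v"
      "\<And>v. v \<in> X_space \<Omega> K \<Longrightarrow> weight_pairing \<Omega> \<rho>' u v = \<mu> n * K_inner K u v"
    have "eigenfunction \<Omega> K \<rho> (inverse (\<mu> n)) u" "eigenfunction \<Omega> K \<rho>' (inverse (\<mu> n)) u"
      using R.kernel_vector_eigenfunction[OF u(1,2) mu(1) u(4)]
        R'.kernel_vector_eigenfunction[OF u(1,2) mu(1) u(5)] by auto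
    then have "{x \<in> \<Omega>. u x = 0} \<in> null_sets lebesgue"
      using ucp unfolding ucp_def spectrum_of_def by blast
    then have nz: "AE x in lebesgue. x \<notin> {x \<in> \<Omega>. u x = 0}" by (rule AE_not_in)
    note int = R.weight_pairing_integrable[OF u(1) u(1)] R'.weight_pairing_integrable[OF u(1) u(1)]
    have int': "integrable lebesgue (\<lambda>x. R'.ext_weight x * (u x * u x) - R.ext_weight x * (u x * u x))"
      using int by (intro Bochner_Integration.integrable_diff)
    have "(LINT x|lebesgue. R'.ext_weight x * (u x * u x) - R.ext_weight x * (u x * u x)) = 0"
      using int u(3) by (simp add: R.weight_pairing_eq R'.weight_pairing_eq)
    moreover have "AE x in lebesgue. 0 \<le> R'.ext_weight x * (u x * u x) - R.ext_weight x * (u x * u x)"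
      using w_le by eventually_elim (auto intro: mult_right_mono)
    ultimately have "AE x in lebesgue. R'.ext_weight x * (u x * u x) - R.ext_weight x * (u x * u x) = 0"
      using integral_nonneg_eq_0_iff_AE[OF int'] by simp
    then have "AE x in lebesgue. x \<in> \<Omega> \<longrightarrow> \<rho> x = \<rho>' x"
      using nz by eventually_elim (auto simp: R.ext_weight_def R'.ext_weight_def)
    then have "AE x in lebesgue_on \<Omega>. \<rho> x = \<rho>' x" by (subst AE_restrict_space_iff) auto
    with ne show ?thesis ..
  qed
  then have "inverse (\<mu>' n) < inverse (\<mu> n)" using mu by simp
  then show thesis
    using R.eigenvalue_of_positive_index[OF sys] R'.eigenvalue_of_positive_index[OF sys'] mu
    by (intro that[of "inverse (\<mu>' n)" "inverse (\<mu> n)"]) auto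
qed

theorem theorem3p2:
  fixes \<Omega> :: "'a::euclidean_space set"
    and K :: "'a \<Rightarrow> real"
    and \<rho> \<rho>' :: "'a \<Rightarrow> real"
  assumes "bounded_lipschitz_domain \<Omega>"
    and "admissible_kernel K"
    and "\<rho> \<in> Linfty \<Omega>" and "\<not> (AE x in lebesgue_on \<Omega>. \<rho> x = 0)"
    and "\<rho>' \<in> Linfty \<Omega>" and "\<not> (AE x in lebesgue_on \<Omega>. \<rho>' x = 0)"
    and "AE x in lebesgue_on \<Omega>. \<rho> x \<le> \<rho>' x"
    and "\<not> (AE x in lebesgue_on \<Omega>. \<rho> x = \<rho>' x)"
    and "ucp \<Omega> K \<rho> \<or> ucp \<Omega> K \<rho>'"
  shows "\<forall>k::int. k \<noteq> 0 \<and> admissible \<Omega> \<rho> \<rho>' k \<longrightarrow> eigval \<Omega> K \<rho> k > eigval \<Omega> K \<rho>' k"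
proof (intro allI impI)
  fix k :: int assume k: "k \<noteq> 0 \<and> admissible \<Omega> \<rho> \<rho>' k"
  have dom: "weighted_domain \<Omega> K r" if "r \<in> Linfty \<Omega>" for r
    using assms(1,2) that by unfold_locales (auto simp: bounded_lipschitz_domain_def)
  have neg_Linfty: "(\<lambda>x. - r x) \<in> Linfty \<Omega>" if "r \<in> Linfty \<Omega>" for r
    using that by (auto simp: Linfty_def)
  show "eigval \<Omega> K \<rho> k > eigval \<Omega> K \<rho>' k"
  proof (cases "k > 0")
    case True
    then obtain n where n: "k = int (Suc n)" by (metis gr0_implies_Suc zero_less_imp_eq_int)
    obtain m m' where "m' < m" "is_eigenvalue_of_index \<Omega> K \<rho> k m" "is_eigenvalue_of_index \<Omega> K \<rho>' k m'"
      using eigval_strict_mono_positive_index[OF dom[OF assms(3)] dom[OF assms(5)] assms(7-9), of n] True k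
      unfolding n admissible_def by (smt (verit))
    then show ?thesis by (simp add: eigval_eqI)
  next
    case False
    then have "- k > 0" using k by simp
    then obtain n where n: "- k = int (Suc n)" by (metis gr0_implies_Suc zero_less_imp_eq_int)
    \<comment> \<open>The sign change reverses the order of the weights, and again that of the eigenvalues.\<close>
    have le: "AE x in lebesgue_on \<Omega>. - \<rho>' x \<le> - \<rho> x" using assms(7) by simp
    have ne: "\<not> (AE x in lebesgue_on \<Omega>. - \<rho>' x = - \<rho> x)" using assms(8) by (simp add: eq_commute)
    have ucp: "ucp \<Omega> K (\<lambda>x. - \<rho>' x) \<or> ucp \<Omega> K (\<lambda>x. - \<rho> x)" using assms(9) ucp_uminus by blast
    have pos: "\<not> (AE x in lebesgue_on \<Omega>. max (- \<rho>' x) 0 = 0)" "\<not> (AE x in lebesgue_on \<Omega>. max (- \<rho> x) 0 = 0)"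
      using False k unfolding admissible_def by auto
    obtain m m' where m: "m' < m" "is_eigenvalue_of_index \<Omega> K (\<lambda>x. - \<rho>' x) (- k) m"
      "is_eigenvalue_of_index \<Omega> K (\<lambda>x. - \<rho> x) (- k) m'"
      unfolding n
      by (rule eigval_strict_mono_positive_index[OF dom[OF neg_Linfty[OF assms(5)]] dom[OF neg_Linfty[OF assms(3)]] le ne ucp pos])
    then show ?thesis
      using is_eigenvalue_of_index_uminus[OF \<open>- k > 0\<close> m(2)] is_eigenvalue_of_index_uminus[OF \<open>- k > 0\<close> m(3)]
      by (simp add: eigval_eqI)
  qed
qed

end
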